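(* Let \[ \mathcal{E}_d:=\{ f\in\mathrm{End}_d^2 : \mathcal{C}_f \text{ is smooth and irreducible}\}. \] (a) For $d\ge1$, $\mathcal{E}_d$ is a non-empty Zariski open subset of $\mathrm{End}_d^2$. (b) For $d\ge2$, $\mathcal{E}_d$ contains no post-critically periodic maps. (c) For all $d\ge2$, the set $\{f\in\mathrm{End}_d^2 : f \text{ is post-critically periodic}\}$ is not Zariski dense in $\mathrm{End}_d^2$.
   Context: Work over an algebraically closed field $\mathbb{F}$ of characteristic $0$. $\mathrm{End}_d^n$ is the set of morphisms $f:\mathbb{P}^n\to\mathbb{P}^n$ of algebraic degree $d$ (i.e. $f=[f_0:\dots:f_n]$, $f_i$ homogeneous of degree $d$ with no common zero), viewed as a Zariski open subset of $\mathbb{P}^N$, $N=(n+1)\binom{d+n}{n}-1$. The critical locus is $\mathcal{C}_f=\{\det(\partial f_i/\partial x_j)=0\}$. A map $f$ is post-critically periodic if $f^k(\mathcal{C}_f)\subseteq\mathcal{C}_f$ for some $k\ge1$. *)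

theory Defs
  imports "HOL-Library.Poly_Mapping" "HOL-Library.Numeral_Type"
          "HOL-Computational_Algebra.Polynomial"
begin

type_synonym ('v, 'k) mpol = "('v \<Rightarrow>\<^sub>0 nat) \<Rightarrow>\<^sub>0 'k"

definition mon_deg :: "('v \<Rightarrow>\<^sub>0 nat) \<Rightarrow> nat" where
  "mon_deg m = (\<Sum>v\<in>Poly_Mapping.keys m. Poly_Mapping.lookup m v)"

definition mp_eval :: "('v, 'k::comm_ring_1) mpol \<Rightarrow> ('v \<Rightarrow> 'k) \<Rightarrow> 'k" where
  "mp_eval p x = (\<Sum>m\<in>Poly_Mapping.keys p. Poly_Mapping.lookup p m * (\<Prod>v\<in>Poly_Mapping.keys m. x v ^ Poly_Mapping.lookup m v))"

definition homog :: "nat \<Rightarrow> ('v, 'k::zero) mpol \<Rightarrow> bool" where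
  "homog d p \<longleftrightarrow> (\<forall>m\<in>Poly_Mapping.keys p. mon_deg m = d)"

definition is_homog :: "('v, 'k::zero) mpol \<Rightarrow> bool" where
  "is_homog p \<longleftrightarrow> (\<exists>d. homog d p)"

definition mp_pderiv :: "'v \<Rightarrow> ('v, 'k::comm_ring_1) mpol \<Rightarrow> ('v, 'k) mpol" where
  "mp_pderiv j p = Abs_poly_mapping
     (\<lambda>m. of_nat (Poly_Mapping.lookup m j + 1) * Poly_Mapping.lookup p (m + Poly_Mapping.single j 1))"

text \<open>Homogeneous coordinates x0,x1,x2 are indexed by the type 3; a point of the
affine cone is a map 3 \<Rightarrow> 'k.  A map f = [f0:f1:f2] is a triple of polynomials.\<close>

type_synonym 'k pol3 = "(3, 'k) mpol"
type_synonym 'k endo = "3 \<Rightarrow> 'k pol3"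

definition End2 :: "nat \<Rightarrow> 'k::comm_ring_1 endo set" where
  "End2 d = {f. (\<forall>i. homog d (f i)) \<and>
                (\<forall>x. (\<forall>i. mp_eval (f i) x = 0) \<longrightarrow> (\<forall>i. x i = 0))}"

definition apply_endo :: "'k::comm_ring_1 endo \<Rightarrow> (3 \<Rightarrow> 'k) \<Rightarrow> (3 \<Rightarrow> 'k)" where
  "apply_endo f x = (\<lambda>i. mp_eval (f i) x)"

definition det3 :: "(3 \<Rightarrow> 3 \<Rightarrow> 'a::comm_ring_1) \<Rightarrow> 'a" where
  "det3 M = M 0 0 * M 1 1 * M 2 2 + M 0 1 * M 1 2 * M 2 0 + M 0 2 * M 1 0 * M 2 1
          - M 0 2 * M 1 1 * M 2 0 - M 0 0 * M 1 2 * M 2 1 - M 0 1 * M 1 0 * M 2 2"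

definition jac :: "'k::comm_ring_1 endo \<Rightarrow> 'k pol3" where
  "jac f = det3 (\<lambda>i j. mp_pderiv j (f i))"

text \<open>The critical locus C_f, as a cone in k^3 minus 0 (its projectivisation is
the subset of P^2).\<close>
definition crit :: "'k::comm_ring_1 endo \<Rightarrow> (3 \<Rightarrow> 'k) set" where
  "crit f = {x. (\<exists>i. x i \<noteq> 0) \<and> mp_eval (jac f) x = 0}"

definition zclosed_P2 :: "(3 \<Rightarrow> 'k::comm_ring_1) set \<Rightarrow> bool" where
  "zclosed_P2 A \<longleftrightarrow> (\<exists>P. (\<forall>p\<in>P. is_homog p) \<and>
       A = {x. (\<exists>i. x i \<noteq> 0) \<and> (\<forall>p\<in>P. mp_eval p x = 0)})"

text \<open>Irreducibility of a closed set (no nonemptiness required).\<close>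
definition irreducible_P2 :: "(3 \<Rightarrow> 'k::comm_ring_1) set \<Rightarrow> bool" where
  "irreducible_P2 Z \<longleftrightarrow> (\<forall>A B. zclosed_P2 A \<longrightarrow> zclosed_P2 B \<longrightarrow> Z \<subseteq> A \<union> B
       \<longrightarrow> Z \<subseteq> A \<or> Z \<subseteq> B)"

text \<open>Smoothness of the plane curve {J = 0} (Jacobian criterion).\<close>
definition smooth_crit :: "'k::comm_ring_1 endo \<Rightarrow> bool" where
  "smooth_crit f \<longleftrightarrow> (\<forall>x\<in>crit f. \<exists>j. mp_eval (mp_pderiv j (jac f)) x \<noteq> 0)"

definition Ed :: "nat \<Rightarrow> 'k::comm_ring_1 endo set" where
  "Ed d = {f\<in>End2 d. smooth_crit f \<and> irreducible_P2 (crit f)}"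

definition pcp :: "'k::comm_ring_1 endo \<Rightarrow> bool" where
  "pcp f \<longleftrightarrow> (\<exists>k\<ge>1. \<forall>x\<in>crit f. (apply_endo f ^^ k) x \<in> crit f)"

text \<open>Homogeneous coordinates of f in P^N: the coefficients of f_i at the
monomials m of degree d, indexed by (i, m).\<close>
definition coord :: "'k::comm_ring_1 endo \<Rightarrow> (3 \<times> (3 \<Rightarrow>\<^sub>0 nat)) \<Rightarrow> 'k" where
  "coord f = (\<lambda>(i, m). Poly_Mapping.lookup (f i) m)"

definition coord_poly :: "nat \<Rightarrow> (3 \<times> (3 \<Rightarrow>\<^sub>0 nat), 'k::comm_ring_1) mpol \<Rightarrow> bool" where
  "coord_poly d p \<longleftrightarrow> is_homog p \<and>
     (\<forall>m\<in>Poly_Mapping.keys p. \<forall>(i, n)\<in>Poly_Mapping.keys m. mon_deg n = d)"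

definition zclosed_End :: "nat \<Rightarrow> 'k::comm_ring_1 endo set \<Rightarrow> bool" where
  "zclosed_End d Z \<longleftrightarrow> (\<exists>P. (\<forall>p\<in>P. coord_poly d p) \<and>
       Z = {f\<in>End2 d. \<forall>p\<in>P. mp_eval p (coord f) = 0})"

definition zopen_End :: "nat \<Rightarrow> 'k::comm_ring_1 endo set \<Rightarrow> bool" where
  "zopen_End d U \<longleftrightarrow> U \<subseteq> End2 d \<and> zclosed_End d (End2 d - U)"

definition zdense_End :: "nat \<Rightarrow> 'k::comm_ring_1 endo set \<Rightarrow> bool" where
  "zdense_End d S \<longleftrightarrow> (\<forall>Z. zclosed_End d Z \<longrightarrow> S \<subseteq> Z \<longrightarrow> Z = End2 d)"

end

theory Submission
  imports Defs "Berlekamp_Zassenhaus.Unique_Factorization_Poly" "Jordan_Normal_Form.Char_Poly"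
begin

text \<open>Let \<open>J\<close> be the Jacobian determinant of \<open>f\<close>, a form of degree \<open>3(d - 1)\<close>. Two plane curves always meet,
  so a smooth \<open>J\<close> is irreducible, and \<open>\<E>\<^sub>d\<close> is given by smoothness alone; smoothness is open by
  elimination theory, in the form of the projective Nullstellensatz.

  Suppose that \<open>g = f\<^sup>k\<close> maps the smooth critical curve \<open>C\<close> into itself. As \<open>C\<close> is critical, \<open>Dg\<close> is singular
  along \<open>C\<close>. Either the normal derivative of \<open>g\<close> along \<open>C\<close> is not identically zero, and then the tangential one is;
  or \<open>\<nabla>J(g)\<close> is a left null vector of \<open>Dg\<close>, and then \<open>adj Dg = v \<otimes> \<nabla>J(g)\<close> on \<open>C\<close> for a section \<open>v\<close>
  of degree \<open>2(deg g - 1) - (deg J - 1) deg g < 0\<close>, so that \<open>v = 0\<close>. In both cases \<open>g\<close> has zero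
  derivative along \<open>C\<close>, hence is constant on \<open>C\<close>, which is impossible for a morphism of the plane.\<close>


section \<open>Polynomials, substitution and partial derivatives\<close>

text \<open>For d >= 2 the form \<open>J\<close> has degree e >= 3, and 2 (D - 1) < 2 D <= (e - 1) D
  for every D >= 1; one estimate therefore serves all iterates, whatever their degree D. For d = 1
  the critical locus is empty. Cohomological arguments are replaced by linear algebra on forms of
  one fixed degree. The Nullstellensatz is needed in graded form: if given forms have no common
  zero, every monomial of large degree is a combination of them with homogeneous coefficients.
  Intersecting two curves then becomes a divisibility argument, openness the nonvanishing of a
  determinant in the coefficients of f, and the absence of sections of negative degree the
  finiteness of a set of eigenvalues. Since \<open>J\<close> is prime, statements about points of C
  are exchanged for congruences modulo \<open>J\<close>. The derivative along C of a quotient of two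
  forms of equal degree is encoded by the Jacobian determinant of \<open>J\<close> and these forms,
  so no parametrisation of C is needed.\<close>

abbreviation "lookup \<equiv> Poly_Mapping.lookup"
abbreviation "keys \<equiv> Poly_Mapping.keys"
abbreviation "single \<equiv> Poly_Mapping.single"

definition Cst :: "'k::comm_ring_1 \<Rightarrow> ('v, 'k) mpol" where
  "Cst c = single 0 c"

definition Var :: "'v \<Rightarrow> ('v, 'k::comm_ring_1) mpol" where
  "Var v = single (single v 1) 1"

definition mon_eval :: "('v \<Rightarrow> 'r::comm_ring_1) \<Rightarrow> ('v \<Rightarrow>\<^sub>0 nat) \<Rightarrow> 'r" where
  "mon_eval s m = (\<Prod>v\<in>keys m. s v ^ lookup m v)"

text \<open>The universal homomorphism out of the polynomial ring, when \<open>h\<close> is a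
  homomorphism. Evaluation, composition of maps, passage to nested univariate polynomials and
  restriction to a line are all instances.\<close>

definition msub :: "('k::comm_ring_1 \<Rightarrow> 'r::comm_ring_1) \<Rightarrow> ('v \<Rightarrow> 'r) \<Rightarrow> ('v, 'k) mpol \<Rightarrow> 'r" where
  "msub h s p = (\<Sum>m\<in>keys p. h (lookup p m) * mon_eval s m)"

lemma mp_eval_msub: "mp_eval p x = msub id x p"
  by (simp add: mp_eval_def msub_def mon_eval_def)

lemma poly_mapping_sum_singles: "p = (\<Sum>m\<in>keys p. single m (lookup p m))"
  by (rule poly_mapping_eqI)
    (auto simp: lookup_sum lookup_single when_def in_keys_iff sum.delta)

lemma mon_eval_superset:
  assumes "finite K" "keys m \<subseteq> K"
  shows "mon_eval s m = (\<Prod>v\<in>K. s v ^ lookup m v)"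
  unfolding mon_eval_def using assms by (intro prod.mono_neutral_left) (auto simp: in_keys_iff)

lemma mon_eval_add: "mon_eval s (a + b) = mon_eval s a * mon_eval s b"
proof -
  let ?K = "keys a \<union> keys b"
  have "keys (a + b) \<subseteq> ?K" by (rule keys_add)
  thus ?thesis
    by (simp add: mon_eval_superset[of ?K] lookup_add power_add prod.distrib)
qed

lemma mon_eval_0 [simp]: "mon_eval s 0 = 1"
  by (simp add: mon_eval_def)

lemma mon_eval_single [simp]: "mon_eval s (single v n) = s v ^ n"
  by (cases "n = 0") (simp_all add: mon_eval_def)

lemma mon_deg_superset:
  assumes "finite K" "keys m \<subseteq> K"
  shows "mon_deg m = (\<Sum>v\<in>K. lookup m v)"
  unfolding mon_deg_def using assms by (intro sum.mono_neutral_left) (auto simp: in_keys_iff)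

lemma mon_deg_add: "mon_deg (a + b) = mon_deg a + mon_deg b"
proof -
  let ?K = "keys a \<union> keys b"
  have "keys (a + b) \<subseteq> ?K" by (rule keys_add)
  thus ?thesis
    by (simp add: mon_deg_superset[of ?K] lookup_add sum.distrib)
qed

lemma mon_deg_0 [simp]: "mon_deg 0 = 0"
  by (simp add: mon_deg_def)

lemma mon_deg_single [simp]: "mon_deg (single v n) = n"
  by (cases "n = 0") (simp_all add: mon_deg_def)

lemma msub_superset:
  assumes "comm_ring_hom h" "finite K" "keys p \<subseteq> K"
  shows "msub h s p = (\<Sum>m\<in>K. h (lookup p m) * mon_eval s m)"
proof -
  interpret comm_ring_hom h by fact
  show ?thesis unfolding msub_def using assms
    by (intro sum.mono_neutral_left) (auto simp: in_keys_iff)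
qed

lemma msub_single:
  assumes "comm_ring_hom h"
  shows "msub h s (single m c) = h c * mon_eval s m"
proof -
  interpret comm_ring_hom h by fact
  show ?thesis by (simp add: msub_def)
qed

lemma msub_add:
  assumes "comm_ring_hom h"
  shows "msub h s (p + q) = msub h s p + msub h s q"
proof -
  interpret comm_ring_hom h by fact
  let ?K = "keys p \<union> keys q"
  have "keys (p + q) \<subseteq> ?K" by (rule keys_add)
  thus ?thesis
    by (simp add: msub_superset[OF assms, of ?K] lookup_add hom_add algebra_simps sum.distrib)
qed

lemma msub_0 [simp]: "msub h s 0 = 0"
  by (simp add: msub_def)

lemma msub_sum:
  assumes "comm_ring_hom h"
  shows "msub h s (sum f A) = (\<Sum>i\<in>A. msub h s (f i))"
  by (induction A rule: infinite_finite_induct) (simp_all add: msub_add[OF assms])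

lemma mult_sum_singles:
  "p * q = (\<Sum>a\<in>keys p. \<Sum>b\<in>keys q. single (a + b) (lookup p a * lookup q b))"
  by (subst (1) poly_mapping_sum_singles[of p], subst (1) poly_mapping_sum_singles[of q])
    (simp add: sum_product mult_single)

lemma msub_mult:
  assumes "comm_ring_hom h"
  shows "msub h s (p * q) = msub h s p * msub h s q"
proof -
  interpret comm_ring_hom h by fact
  have "msub h s (p * q) = (\<Sum>a\<in>keys p. \<Sum>b\<in>keys q.
      (h (lookup p a) * mon_eval s a) * (h (lookup q b) * mon_eval s b))"
    by (subst mult_sum_singles)
      (simp add: msub_sum[OF assms] msub_single[OF assms] mon_eval_add hom_mult ac_simps)
  thus ?thesis by (simp add: msub_def sum_product)
qed

lemma comm_ring_hom_msub:
  assumes "comm_ring_hom h"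
  shows "comm_ring_hom (msub h s)"
proof -
  interpret comm_ring_hom h by fact
  show ?thesis
    by unfold_locales
      (simp_all add: msub_add[OF assms] msub_mult[OF assms] msub_single[OF assms]
        flip: single_one)
qed

lemma Cst_0 [simp]: "Cst 0 = 0" and Cst_1 [simp]: "Cst 1 = 1"
  by (simp_all add: Cst_def)

lemma Cst_add: "Cst (a + b) = Cst a + Cst b"
  and Cst_mult: "Cst (a * b) = Cst a * Cst b"
  by (simp_all add: Cst_def single_add mult_single)

lemma comm_ring_hom_Cst: "comm_ring_hom Cst"
  by unfold_locales (simp_all add: Cst_add Cst_mult)

lemma comm_ring_hom_id: "comm_ring_hom (id :: 'a::comm_ring_1 \<Rightarrow> 'a)"
  by unfold_locales simp_all

lemma msub_Cst [simp]: "comm_ring_hom h \<Longrightarrow> msub h s (Cst c) = h c"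
  by (simp add: Cst_def msub_single)

lemma msub_Var [simp]: "comm_ring_hom h \<Longrightarrow> msub h s (Var v) = s v"
proof -
  assume h: "comm_ring_hom h"
  then interpret comm_ring_hom h .
  show ?thesis by (simp add: Var_def msub_single[OF h])
qed

lemma mon_eval_Var: "mon_eval Var m = (single m 1 :: ('v, 'k::comm_ring_1) mpol)"
proof (induction m rule: update_induct)
  case const show ?case by simp
next
  case (update m v n)
  have eq: "Poly_Mapping.update v n m = m + single v n"
    using update(1) by (intro poly_mapping_eqI)
      (auto simp: lookup_update lookup_add lookup_single in_keys_iff when_def)
  have pw: "single (single v n) 1 = (Var v :: ('v, 'k) mpol) ^ n" for n
  proof (induction n)
    case (Suc n)
    have "single v (Suc n) = single v 1 + single v n" by (simp flip: single_add)
    hence "single (single v (Suc n)) 1 = Var v * single (single v n) (1::'k)"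
      by (simp add: Var_def mult_single)
    thus ?case by (simp add: Suc)
  qed simp
  have "single (m + single v n) 1 = single m 1 * single (single v n) (1::'k)"
    by (simp add: mult_single)
  thus ?case using update(3) by (simp add: eq mon_eval_add pw)
qed

lemma Var_power: "Var v ^ n = single (single v n) 1"
  using mon_eval_Var[of "single v n"] by simp

lemma single_eq_Cst_mult: "single m c = Cst c * mon_eval Var m"
  by (simp add: mon_eval_Var Cst_def mult_single)

text \<open>Constants and variables generate the polynomial ring, so identities between
  homomorphisms or derivations need only be checked there.\<close>

lemma mpol_induct [case_names Cst Var add mult]:
  assumes "\<And>c. P (Cst c)" "\<And>v. P (Var v)"
    "\<And>p q. P p \<Longrightarrow> P q \<Longrightarrow> P (p + q)" "\<And>p q. P p \<Longrightarrow> P q \<Longrightarrow> P (p * q)"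
  shows "P p"
proof -
  have P01: "P 0" "P 1" using assms(1)[of 0] assms(1)[of 1] by simp_all
  have pow: "P (Var v ^ n)" for v n
    by (induction n) (auto intro: P01 assms)
  have prd: "P (\<Prod>v\<in>A. Var v ^ e v)" for A e
    by (induction A rule: infinite_finite_induct) (auto intro: P01 assms pow)
  have s: "P (single m c)" for m c
    unfolding single_eq_Cst_mult mon_eval_def by (intro assms prd)
  have "P (\<Sum>m\<in>A. single m (f m))" for A f
    by (induction A rule: infinite_finite_induct) (auto intro: P01 assms s)
  thus ?thesis using poly_mapping_sum_singles[of p] by metis
qed

lemma hom_eq_msub:
  assumes "comm_ring_hom F"
  shows "F p = msub (\<lambda>c. F (Cst c)) (\<lambda>v. F (Var v)) p"
proof -
  interpret F: comm_ring_hom F by fact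
  have h: "comm_ring_hom (\<lambda>c. F (Cst c))"
    by unfold_locales (simp_all add: Cst_add Cst_mult F.hom_add F.hom_mult)
  show ?thesis
    by (induction p rule: mpol_induct)
      (simp_all add: h msub_add[OF h] msub_mult[OF h] F.hom_add F.hom_mult)
qed

lemma hom_msub:
  assumes "comm_ring_hom F" "comm_ring_hom h"
  shows "F (msub h s p) = msub (\<lambda>c. F (h c)) (\<lambda>v. F (s v)) p"
proof -
  interpret F: comm_ring_hom F by fact
  show ?thesis by (simp add: msub_def F.hom_sum F.hom_mult mon_eval_def F.hom_prod F.hom_power)
qed

lemma msub_Cst_Var [simp]: "msub Cst Var p = p"
  using hom_eq_msub[OF comm_ring_hom_id, of p] by simp

lemma mp_eval_add: "mp_eval (p + q) x = mp_eval p x + mp_eval q x"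
  and mp_eval_mult: "mp_eval (p * q) x = mp_eval p x * mp_eval q x"
  and mp_eval_sum: "mp_eval (sum f A) x = (\<Sum>i\<in>A. mp_eval (f i) x)"
  by (simp_all add: mp_eval_msub msub_add[OF comm_ring_hom_id] msub_mult[OF comm_ring_hom_id]
      msub_sum[OF comm_ring_hom_id])

lemma comm_ring_hom_mp_eval: "comm_ring_hom (\<lambda>p. mp_eval p x)"
  unfolding mp_eval_msub by (rule comm_ring_hom_msub[OF comm_ring_hom_id])

lemma mp_eval_diff: "mp_eval (p - q) x = mp_eval p x - mp_eval q x"
  and mp_eval_uminus: "mp_eval (- q) x = - mp_eval q x"
  and mp_eval_power: "mp_eval (p ^ n) x = mp_eval p x ^ n"
  and mp_eval_prod: "mp_eval (prod f A) x = (\<Prod>i\<in>A. mp_eval (f i) x)"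
  and mp_eval_0 [simp]: "mp_eval 0 x = 0"
  and mp_eval_1 [simp]: "mp_eval 1 x = 1"
proof -
  interpret comm_ring_hom "\<lambda>p. mp_eval p x" by (rule comm_ring_hom_mp_eval)
  show "mp_eval (p - q) x = mp_eval p x - mp_eval q x" "mp_eval (- q) x = - mp_eval q x"
    "mp_eval (p ^ n) x = mp_eval p x ^ n" "mp_eval 0 x = 0" "mp_eval 1 x = 1"
    "mp_eval (prod f A) x = (\<Prod>i\<in>A. mp_eval (f i) x)"
    by (simp_all add: hom_minus hom_uminus hom_power hom_prod)
qed

lemma mp_eval_of_nat [simp]: "mp_eval (of_nat n) x = of_nat n"
  by (induction n) (simp_all add: mp_eval_add)

lemma mp_eval_Cst [simp]: "mp_eval (Cst c) x = c"
  and mp_eval_Var [simp]: "mp_eval (Var v) x = x v"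
  by (simp_all add: mp_eval_msub comm_ring_hom_id)

lemma mp_eval_single: "mp_eval (single m c) x = c * mon_eval x m"
  by (simp add: mp_eval_msub msub_single[OF comm_ring_hom_id])

lemmas mp_eval_simps = mp_eval_add mp_eval_mult mp_eval_sum mp_eval_diff mp_eval_uminus
  mp_eval_power mp_eval_prod

lemma mp_eval_msub_Cst: "mp_eval (msub Cst g p) x = mp_eval p (\<lambda>v. mp_eval (g v) x)"
  by (subst hom_msub[OF comm_ring_hom_mp_eval comm_ring_hom_Cst]) (simp add: mp_eval_msub id_def comm_ring_hom_id[unfolded id_def])

lemma lookup_mp_pderiv:
  "lookup (mp_pderiv j p) m = of_nat (lookup m j + 1) * lookup p (m + single j 1)"
proof -
  let ?f = "\<lambda>m. of_nat (lookup m j + 1) * lookup p (m + single j 1)"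
  have "{m. ?f m \<noteq> 0} \<subseteq> (\<lambda>m. m - single j 1) ` keys p"
  proof
    fix m assume "m \<in> {m. ?f m \<noteq> 0}"
    hence "m + single j 1 \<in> keys p" by (auto simp: in_keys_iff)
    thus "m \<in> (\<lambda>m. m - single j 1) ` keys p" by (rule rev_image_eqI) simp
  qed
  hence "finite {m. ?f m \<noteq> 0}" by (rule finite_subset) simp
  thus ?thesis by (simp add: mp_pderiv_def)
qed

lemma mp_pderiv_add: "mp_pderiv j (p + q) = mp_pderiv j p + mp_pderiv j q"
  by (rule poly_mapping_eqI) (simp add: lookup_mp_pderiv lookup_add algebra_simps)

lemma mp_pderiv_0 [simp]: "mp_pderiv j 0 = 0"
  by (rule poly_mapping_eqI) (simp add: lookup_mp_pderiv)

lemma mp_pderiv_sum: "mp_pderiv j (sum f A) = (\<Sum>i\<in>A. mp_pderiv j (f i))"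
  by (induction A rule: infinite_finite_induct) (simp_all add: mp_pderiv_add)

lemma mp_pderiv_single:
  "mp_pderiv j (single m c) = single (m - single j 1) (of_nat (lookup m j) * c)"
proof (rule poly_mapping_eqI)
  fix n
  show "lookup (mp_pderiv j (single m c)) n = lookup (single (m - single j 1) (of_nat (lookup m j) * c)) n"
  proof (cases "lookup m j = 0")
    case True
    have "m \<noteq> n + single j 1" using True by (auto simp: lookup_add)
    thus ?thesis using True by (simp add: lookup_mp_pderiv lookup_single)
  next
    case False
    have "m = (m - single j 1) + single j 1"
      using False by (intro poly_mapping_eqI) (auto simp: lookup_add lookup_minus lookup_single when_def)
    hence iff: "m = n + single j 1 \<longleftrightarrow> m - single j 1 = n" by (metis add_diff_cancel_right')
    show ?thesis
    proof (cases "m = n + single j 1")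
      case True
      thus ?thesis by (simp add: lookup_mp_pderiv lookup_add)
    next
      case False
      thus ?thesis using iff by (simp add: lookup_mp_pderiv lookup_single when_def)
    qed
  qed
qed

lemma mp_pderiv_mult_single:
  "mp_pderiv j (single a c * single b d) =
     mp_pderiv j (single a c) * single b d + single a c * mp_pderiv j (single b d)"
proof -
  \<comment> \<open>Subtraction of exponents truncates, so the two monomials can differ when
    \<open>a\<close> has exponent zero at \<open>j\<close>; the coefficient is zero in that
    case.\<close>
  have 1: "single (a + b - single j 1) (of_nat (lookup a j) * (c * d))
     = single (a - single j 1 + b) (of_nat (lookup a j) * (c * d))" for a b :: "'a \<Rightarrow>\<^sub>0 nat" and c d
  proof (cases "lookup a j = 0")
    case False
    hence "a + b - single j 1 = a - single j 1 + b"
      by (intro poly_mapping_eqI) (auto simp: lookup_add lookup_minus lookup_single when_def)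
    thus ?thesis by simp
  qed simp
  have "mp_pderiv j (single a c * single b d) =
    single (a + b - single j 1) (of_nat (lookup a j) * (c * d)) + single (b + a - single j 1) (of_nat (lookup b j) * (c * d))"
    by (simp add: mult_single mp_pderiv_single lookup_add algebra_simps flip: single_add)
  thus ?thesis unfolding 1 by (simp add: mult_single mp_pderiv_single ac_simps)
qed

lemma mp_pderiv_mult: "mp_pderiv j (p * q) = mp_pderiv j p * q + p * mp_pderiv j q"
proof -
  let ?s = "\<lambda>p m. single m (lookup p m)"
  have d: "mp_pderiv j r = (\<Sum>a\<in>keys r. mp_pderiv j (?s r a))" for r :: "('a, 'b) mpol"
    by (subst poly_mapping_sum_singles) (simp only: mp_pderiv_sum)
  have "mp_pderiv j (p * q) = (\<Sum>a\<in>keys p. \<Sum>b\<in>keys q. mp_pderiv j (?s p a * ?s q b))"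
    by (subst mult_sum_singles) (simp add: mult_single mp_pderiv_sum)
  also have "\<dots> = (\<Sum>a\<in>keys p. \<Sum>b\<in>keys q. mp_pderiv j (?s p a) * ?s q b)
     + (\<Sum>a\<in>keys p. \<Sum>b\<in>keys q. ?s p a * mp_pderiv j (?s q b))"
    by (simp add: mp_pderiv_mult_single sum.distrib)
  also have "\<dots> = mp_pderiv j p * (\<Sum>b\<in>keys q. ?s q b) + (\<Sum>a\<in>keys p. ?s p a) * mp_pderiv j q"
    by (simp add: d[of p] d[of q] sum_product)
  finally show ?thesis by (simp flip: poly_mapping_sum_singles)
qed

lemma mp_pderiv_Cst [simp]: "mp_pderiv j (Cst c) = 0"
  by (simp add: Cst_def mp_pderiv_single)

lemma mp_pderiv_Var: "mp_pderiv j (Var v) = (if v = j then 1 else 0)"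
  by (auto simp: Var_def mp_pderiv_single lookup_single when_def)

lemma mp_pderiv_uminus: "mp_pderiv j (- p) = - mp_pderiv j p"
  by (rule poly_mapping_eqI) (simp add: lookup_mp_pderiv)

lemma mp_pderiv_diff: "mp_pderiv j (p - q) = mp_pderiv j p - mp_pderiv j q"
  using mp_pderiv_add[of j p "- q"] by (simp add: mp_pderiv_uminus)

lemma mp_pderiv_power:
  "mp_pderiv j (p ^ n) = of_nat n * p ^ (n - 1) * mp_pderiv j p"
proof (induction n)
  case 0 show ?case using mp_pderiv_Cst[of j 1] by simp
next
  case (Suc n)
  have "p * mp_pderiv j (p ^ n) = of_nat n * p ^ n * mp_pderiv j p"
    unfolding Suc by (cases n) (simp_all add: ac_simps)
  thus ?case by (simp add: mp_pderiv_mult algebra_simps)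
qed

text \<open>The chain rule: both sides are derivations along the homomorphism
  \<open>msub Cst g\<close>, so agreement on constants and variables suffices.\<close>

lemma mp_pderiv_msub:
  fixes g :: "'w::finite \<Rightarrow> ('v, 'k::comm_ring_1) mpol"
  shows "mp_pderiv j (msub Cst g p) = (\<Sum>i\<in>UNIV. msub Cst g (mp_pderiv i p) * mp_pderiv j (g i))"
proof (induction p rule: mpol_induct)
  case (Cst c) show ?case by (simp add: comm_ring_hom_Cst)
next
  case (Var v)
  interpret m: comm_ring_hom "msub Cst g" by (rule comm_ring_hom_msub[OF comm_ring_hom_Cst])
  have "(\<Sum>i\<in>UNIV. msub Cst g (mp_pderiv i (Var v)) * mp_pderiv j (g i))
     = (\<Sum>i\<in>UNIV. if i = v then mp_pderiv j (g i) else 0)"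
    by (intro sum.cong) (auto simp: mp_pderiv_Var)
  thus ?case by (simp add: comm_ring_hom_Cst)
next
  case (add p q)
  thus ?case by (simp add: msub_add[OF comm_ring_hom_Cst] mp_pderiv_add algebra_simps sum.distrib)
next
  case (mult p q)
  thus ?case
    by (simp add: msub_add[OF comm_ring_hom_Cst] msub_mult[OF comm_ring_hom_Cst]
        mp_pderiv_mult algebra_simps sum.distrib sum_distrib_left)
qed

section \<open>Homogeneous polynomials\<close>

lemma homog_0 [simp]: "homog n 0"
  by (simp add: homog_def)

lemma homog_single: "mon_deg m = n \<Longrightarrow> homog n (single m c)"
  by (auto simp: homog_def)

lemma homog_add: "homog n p \<Longrightarrow> homog n q \<Longrightarrow> homog n (p + q)"
  using keys_add[of p q] by (auto simp: homog_def)

lemma homog_uminus: "homog n p \<Longrightarrow> homog n (- p)"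
  for p :: "('v, 'k::ab_group_add) mpol"
  by (auto simp: homog_def in_keys_iff)

lemma homog_diff: "homog n p \<Longrightarrow> homog n q \<Longrightarrow> homog n (p - q)"
  for p :: "('v, 'k::ab_group_add) mpol"
  using homog_add[of n p "- q"] homog_uminus[of n q] by simp

lemma homog_sum: "(\<And>i. i \<in> A \<Longrightarrow> homog n (f i)) \<Longrightarrow> homog n (sum f A)"
  by (induction A rule: infinite_finite_induct) (auto intro: homog_add)

lemma homog_mult:
  fixes p q :: "('v, 'k::comm_ring_1) mpol"
  assumes "homog n p" "homog m q"
  shows "homog (n + m) (p * q)"
  unfolding homog_def
proof
  fix k assume "k \<in> keys (p * q)"
  then obtain a b where "a \<in> keys p" "b \<in> keys q" "k = a + b" using keys_mult by blast
  thus "mon_deg k = n + m" using assms by (auto simp: homog_def mon_deg_add)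
qed

lemma homog_Cst: "homog 0 (Cst c)"
  by (simp add: Cst_def homog_single)

lemma homog_1: "homog 0 (1 :: ('v, 'k::comm_ring_1) mpol)"
  using homog_Cst[of 1] by simp

lemma homog_Var: "homog 1 (Var v)"
  by (simp add: Var_def homog_single)

lemma homog_power: "homog n p \<Longrightarrow> homog (n * k) (p ^ k)"
  for p :: "('v, 'k::comm_ring_1) mpol"
proof (induction k)
  case (Suc k)
  thus ?case using homog_mult[of n p "n * k" "p ^ k"] by simp
qed (simp add: homog_1)

lemma homog_Cst_mult: "homog n p \<Longrightarrow> homog n (Cst c * p)"
  using homog_mult[OF homog_Cst, of n p c] by simp

lemma homog_prod:
  fixes f :: "'i \<Rightarrow> ('v, 'k::comm_ring_1) mpol"
  shows "(\<And>i. i \<in> A \<Longrightarrow> homog (e i) (f i)) \<Longrightarrow> homog (sum e A) (prod f A)"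
  by (induction A rule: infinite_finite_induct) (auto intro: homog_mult homog_1)

lemma homog_mp_pderiv:
  assumes "homog n p" shows "homog (n - 1) (mp_pderiv j p)"
  unfolding homog_def
proof
  fix m assume "m \<in> keys (mp_pderiv j p)"
  hence "m + single j 1 \<in> keys p" by (auto simp: in_keys_iff lookup_mp_pderiv)
  thus "mon_deg m = n - 1" using assms by (auto simp: homog_def mon_deg_add)
qed

lemma homog_msub:
  fixes g :: "'w \<Rightarrow> ('v, 'k::comm_ring_1) mpol"
  assumes p: "homog n p" and g: "\<And>i. homog D (g i)"
  shows "homog (n * D) (msub Cst g p)"
  unfolding msub_def
proof (intro homog_sum homog_Cst_mult)
  fix m assume "m \<in> keys p"
  hence n: "n = mon_deg m" using p by (simp add: homog_def)
  have "homog (\<Sum>v\<in>keys m. D * lookup m v) (mon_eval g m)"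
    unfolding mon_eval_def by (intro homog_prod homog_power g)
  thus "homog (n * D) (mon_eval g m)"
    by (simp add: n mon_deg_def sum_distrib_left mult.commute)
qed

lemma Euler_homog:
  fixes p :: "('v::finite, 'k::comm_ring_1) mpol"
  assumes "homog n p"
  shows "(\<Sum>j\<in>UNIV. Var j * mp_pderiv j p) = of_nat n * p"
proof -
  have s: "(\<Sum>j\<in>UNIV. Var j * mp_pderiv j (single m c)) = of_nat (mon_deg m) * single m c"
    for m :: "'v \<Rightarrow>\<^sub>0 nat" and c :: 'k
  proof -
    have "Var j * mp_pderiv j (single m c) = single m (of_nat (lookup m j) * c)" for j
    proof (cases "lookup m j = 0")
      case False
      have "m = single j 1 + (m - single j 1)"
        using False by (intro poly_mapping_eqI) (auto simp: lookup_add lookup_minus lookup_single when_def)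
      thus ?thesis by (simp add: Var_def mp_pderiv_single mult_single)
    qed (simp add: mp_pderiv_single)
    hence "(\<Sum>j\<in>UNIV. Var j * mp_pderiv j (single m c)) = (\<Sum>j\<in>UNIV. single m (of_nat (lookup m j) * c))"
      by simp
    also have "\<dots> = single m (of_nat (mon_deg m) * c)"
      by (rule poly_mapping_eqI)
        (simp add: lookup_sum mon_deg_superset[of UNIV] lookup_single when_def sum_distrib_right)
    finally show ?thesis by (simp add: mult_single flip: single_of_nat)
  qed
  have "(\<Sum>j\<in>UNIV. Var j * mp_pderiv j p)
      = (\<Sum>m\<in>keys p. \<Sum>j\<in>UNIV. Var j * mp_pderiv j (single m (lookup p m)))"
    by (subst poly_mapping_sum_singles[of p], subst sum.swap)
      (simp add: mp_pderiv_sum sum_distrib_left)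
  also have "\<dots> = (\<Sum>m\<in>keys p. of_nat n * single m (lookup p m))"
    using assms by (intro sum.cong) (auto simp: s homog_def)
  also have "\<dots> = of_nat n * p"
    by (subst (2) poly_mapping_sum_singles) (simp add: sum_distrib_left)
  finally show ?thesis .
qed

section \<open>Homogeneous components\<close>

definition hcomp :: "nat \<Rightarrow> ('v, 'k::comm_ring_1) mpol \<Rightarrow> ('v, 'k) mpol" where
  "hcomp n p = (\<Sum>m\<in>{m\<in>keys p. mon_deg m = n}. single m (lookup p m))"

lemma lookup_hcomp: "lookup (hcomp n p) m = (if mon_deg m = n then lookup p m else 0)"
proof -
  have "finite {m\<in>keys p. mon_deg m = n}" by simp
  thus ?thesis by (auto simp: hcomp_def lookup_sum lookup_single when_def sum.delta in_keys_iff)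
qed

lemma hcomp_add: "hcomp n (p + q) = hcomp n p + hcomp n q"
  by (rule poly_mapping_eqI) (simp add: lookup_hcomp lookup_add)

lemma hcomp_0 [simp]: "hcomp n 0 = 0"
  by (rule poly_mapping_eqI) (simp add: lookup_hcomp)

lemma hcomp_sum: "hcomp n (sum f A) = (\<Sum>i\<in>A. hcomp n (f i))"
  by (induction A rule: infinite_finite_induct) (simp_all add: hcomp_add)

lemma keys_hcomp: "keys (hcomp n p) = {m\<in>keys p. mon_deg m = n}"
  by (auto simp: in_keys_iff lookup_hcomp split: if_splits)

lemma homog_hcomp: "homog n (hcomp n p)"
  by (simp add: homog_def keys_hcomp)

lemma hcomp_homog: "homog n p \<Longrightarrow> hcomp m p = (if m = n then p else 0)"
  by (rule poly_mapping_eqI) (auto simp: lookup_hcomp homog_def in_keys_iff)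

lemma sum_hcomp:
  assumes "\<And>m. m \<in> keys p \<Longrightarrow> mon_deg m < N"
  shows "(\<Sum>n<N. hcomp n p) = p"
  by (rule poly_mapping_eqI) (use assms in \<open>auto simp: lookup_sum lookup_hcomp in_keys_iff sum.delta'\<close>)

lemma ex_sum_hcomp: "\<exists>N. (\<Sum>n<N. hcomp n p) = p"
proof -
  have "\<exists>N. \<forall>m\<in>keys p. mon_deg m < N"
    by (intro exI[of _ "Suc (Max (mon_deg ` keys p))"]) (auto simp: less_Suc_eq_le)
  thus ?thesis using sum_hcomp by metis
qed

lemma hcomp_mult_homog:
  assumes h: "homog d h"
  shows "hcomp n (a * h) = (if d \<le> n then hcomp (n - d) a * h else 0)"
proof -
  obtain N where "(\<Sum>i<N. hcomp i a) = a" using ex_sum_hcomp by blast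
  \<comment> \<open>The range is enlarged so that it contains the only index that can contribute,
    \<open>n - d\<close>, even if that component of \<open>a\<close> is zero.\<close>
  moreover define N' where "N' = max N (Suc n)"
  moreover have "hcomp i a = 0" if "i \<in> {N..<N'}" for i
  proof (rule poly_mapping_eqI)
    fix m
    have "lookup a m = 0" if "mon_deg m = i"
    proof -
      have "lookup a m = lookup (\<Sum>i<N. hcomp i a) m" by (simp add: calculation(1))
      also have "\<dots> = 0" using that \<open>i \<in> {N..<N'}\<close> by (auto simp: lookup_sum lookup_hcomp)
      finally show ?thesis .
    qed
    thus "lookup (hcomp i a) m = lookup 0 m" by (simp add: lookup_hcomp)
  qed
  ultimately have a: "(\<Sum>i<N'. hcomp i a) = a"
    by (metis (no_types, lifting) lessThan_atLeast0 max.cobounded1 sum.atLeastLessThan_concat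
        sum.neutral add.right_neutral le0)
  have "hcomp n (a * h) = (\<Sum>i<N'. hcomp n (hcomp i a * h))"
    by (subst a[symmetric]) (simp add: sum_distrib_right hcomp_sum)
  also have "\<dots> = (\<Sum>i<N'. if i + d = n then hcomp i a * h else 0)"
    by (intro sum.cong) (auto simp: hcomp_homog[OF homog_mult[OF homog_hcomp h]])
  also have "\<dots> = (if d \<le> n then hcomp (n - d) a * h else 0)"
  proof (cases "d \<le> n")
    case True
    have "(\<Sum>i<N'. if i + d = n then hcomp i a * h else 0) = (\<Sum>i<N'. if i = n - d then hcomp i a * h else 0)"
      using True by (intro sum.cong) auto
    thus ?thesis using True by (simp add: N'_def less_max_iff_disj less_Suc_eq_le)
  qed auto
  finally show ?thesis .
qed


section \<open>The projective Nullstellensatz\<close>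

definition polys_in :: "'v set \<Rightarrow> ('v, 'k::comm_ring_1) mpol set" where
  "polys_in V = {p. \<forall>m\<in>keys p. keys m \<subseteq> V}"

lemma polys_in_mono: "V \<subseteq> W \<Longrightarrow> polys_in V \<subseteq> polys_in W"
  by (auto simp: polys_in_def)

lemma polys_in_UNIV [simp]: "polys_in UNIV = UNIV"
  by (auto simp: polys_in_def)

lemma polys_in_0 [simp]: "0 \<in> polys_in V"
  by (simp add: polys_in_def)

lemma polys_in_add: "p \<in> polys_in V \<Longrightarrow> q \<in> polys_in V \<Longrightarrow> p + q \<in> polys_in V"
  using keys_add[of p q] by (auto simp: polys_in_def)

lemma polys_in_uminus: "p \<in> polys_in V \<Longrightarrow> - p \<in> polys_in V"
  by (auto simp: polys_in_def in_keys_iff)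

lemma polys_in_diff: "p \<in> polys_in V \<Longrightarrow> q \<in> polys_in V \<Longrightarrow> p - q \<in> polys_in V"
  using polys_in_add[of p V "- q"] polys_in_uminus[of q V] by simp

lemma polys_in_sum: "(\<And>i. i \<in> A \<Longrightarrow> f i \<in> polys_in V) \<Longrightarrow> sum f A \<in> polys_in V"
  by (induction A rule: infinite_finite_induct) (auto intro: polys_in_add)

lemma polys_in_mult:
  assumes "p \<in> polys_in V" "q \<in> polys_in V" shows "p * q \<in> polys_in V"
  unfolding polys_in_def
proof clarify
  fix k v assume "k \<in> keys (p * q)" and v: "v \<in> keys k"
  then obtain a b where ab: "a \<in> keys p" "b \<in> keys q" "k = a + b" using keys_mult by blast
  hence "v \<in> keys a \<union> keys b" using v keys_add[of a b] by auto
  thus "v \<in> V" using ab assms by (auto simp: polys_in_def)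
qed

lemma polys_in_Cst: "Cst c \<in> polys_in V"
  by (simp add: polys_in_def Cst_def)

lemma polys_in_1: "1 \<in> polys_in V"
  using polys_in_Cst[of 1 V] by simp

lemma polys_in_Var: "v \<in> V \<Longrightarrow> Var v \<in> polys_in V"
  by (auto simp: polys_in_def Var_def)

lemma polys_in_power: "p \<in> polys_in V \<Longrightarrow> p ^ n \<in> polys_in V"
  by (induction n) (auto intro: polys_in_1 polys_in_mult)

lemma msub_cong_polys_in:
  assumes "p \<in> polys_in V" "\<And>v. v \<in> V \<Longrightarrow> s v = t v"
  shows "msub h s p = msub h t p"
  unfolding msub_def mon_eval_def
proof (intro sum.cong prod.cong arg_cong2[where f = "(*)"] refl)
  fix m w assume "m \<in> keys p" "w \<in> keys m"
  hence "w \<in> V" using assms(1) by (auto simp: polys_in_def)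
  thus "s w ^ lookup m w = t w ^ lookup m w" by (simp add: assms(2))
qed

lemma expand_in_variable:
  assumes f: "f \<in> polys_in (insert v V)" and n: "\<And>m. m \<in> keys f \<Longrightarrow> lookup m v < n"
  shows "\<exists>r. (\<forall>i. r i \<in> polys_in V) \<and> f = (\<Sum>i<n. r i * Var v ^ i)"
proof -
  define K where "K i = {m\<in>keys f. lookup m v = i}" for i
  define r where "r i = (\<Sum>m\<in>K i. single (m - single v i) (lookup f m))" for i
  have "r i \<in> polys_in V" for i
    unfolding r_def
  proof (intro polys_in_sum)
    fix m assume m: "m \<in> K i"
    hence "keys m \<subseteq> insert v V" "lookup m v = i" using f by (auto simp: K_def polys_in_def)
    hence "keys (m - single v i) \<subseteq> V"
      by (auto simp: subset_iff in_keys_iff lookup_minus lookup_single when_def split: if_splits)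
    thus "single (m - single v i) (lookup f m) \<in> polys_in V" by (auto simp: polys_in_def)
  qed
  moreover have "f = (\<Sum>i<n. r i * Var v ^ i)"
  proof -
    have "r i * Var v ^ i = (\<Sum>m\<in>K i. single m (lookup f m))" for i
      unfolding r_def sum_distrib_right Var_power
    proof (intro sum.cong refl)
      fix m assume "m \<in> K i"
      hence "m - single v i + single v i = m"
        by (intro poly_mapping_eqI) (auto simp: K_def lookup_add lookup_minus lookup_single when_def)
      thus "single (m - single v i) (lookup f m) * single (single v i) 1 = single m (lookup f m)"
        by (simp add: mult_single)
    qed
    hence "(\<Sum>i<n. r i * Var v ^ i) = (\<Sum>i<n. \<Sum>m\<in>K i. single m (lookup f m))" by simp
    also have "\<dots> = (\<Sum>m\<in>(\<Union>i<n. K i). single m (lookup f m))"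
      by (subst sum.UNION_disjoint) (auto simp: K_def)
    also have "(\<Union>i<n. K i) = keys f" using n by (auto simp: K_def)
    finally show ?thesis by (simp flip: poly_mapping_sum_singles)
  qed
  ultimately show ?thesis by blast
qed

lemma ex_expand_in_variable:
  assumes "f \<in> polys_in (insert v V)"
  shows "\<exists>n r. (\<forall>i. r i \<in> polys_in V) \<and> f = (\<Sum>i<n. r i * Var v ^ i)"
proof -
  have "lookup m v < Suc (Max ((\<lambda>m. lookup m v) ` keys f))" if "m \<in> keys f" for m
    using that by (auto simp: less_Suc_eq_le)
  thus ?thesis using expand_in_variable[OF assms] by blast
qed

text \<open>Eliminating the generators \<open>Z\<^sup>n\<^sup>-\<^sup>1, \<dots>, Z\<^sup>0\<close> one at a time from the relations \<open>Z\<^sup>i \<in> \<pp>M\<close>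
  is Nakayama's lemma for \<open>M = R[Z]/I\<close>; here \<open>\<pp>\<close> is the kernel of evaluation at \<open>a\<close> in \<open>R = k[V]\<close>.\<close>

lemma nakayama_elimination:
  fixes I :: "('v, 'k::comm_ring_1) mpol set"
  assumes Iadd: "\<And>p q. p \<in> I \<Longrightarrow> q \<in> I \<Longrightarrow> p + q \<in> I"
    and Imult: "\<And>p q. p \<in> I \<Longrightarrow> q \<in> polys_in V \<Longrightarrow> q * p \<in> I"
    and start: "\<And>i. i < n \<Longrightarrow> \<exists>p. (\<forall>l. p l \<in> polys_in V \<and> mp_eval (p l) a = 0) \<and>
           Z ^ i - (\<Sum>l<n. p l * Z ^ l) \<in> I"
    and j: "j \<le> n"
  shows "\<exists>r\<in>polys_in V. mp_eval r a = 1 \<and> (\<forall>i<n. \<exists>p. (\<forall>l. p l \<in> polys_in V \<and> mp_eval (p l) a = 0) \<and>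
           r * Z ^ i - (\<Sum>l<j. p l * Z ^ l) \<in> I)"
  using j
proof (induction j rule: inc_induct)
  case base
  show ?case using start by (intro bexI[of _ 1]) (auto intro: polys_in_1)
next
  case (step j)
  then obtain r where r: "r \<in> polys_in V" "mp_eval r a = 1" and
    ex: "\<And>i. i < n \<Longrightarrow> \<exists>p. (\<forall>l. p l \<in> polys_in V \<and> mp_eval (p l) a = 0) \<and>
           r * Z ^ i - (\<Sum>l<Suc j. p l * Z ^ l) \<in> I" by blast
  obtain p where p: "\<And>l. p l \<in> polys_in V" "\<And>l. mp_eval (p l) a = 0"
    and pI: "r * Z ^ j - (\<Sum>l<Suc j. p l * Z ^ l) \<in> I" using ex[of j] step.hyps by blast
  let ?r = "(r - p j) * r"
  show ?case
  proof (intro bexI[of _ ?r] conjI allI impI)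
    show "?r \<in> polys_in V" by (intro polys_in_mult polys_in_diff r p)
    show "mp_eval ?r a = 1" by (simp add: mp_eval_simps r p)
    fix i assume "i < n"
    then obtain q where q: "\<And>l. q l \<in> polys_in V" "\<And>l. mp_eval (q l) a = 0"
      and qI: "r * Z ^ i - (\<Sum>l<Suc j. q l * Z ^ l) \<in> I" using ex by blast
    let ?q = "\<lambda>l. (r - p j) * q l + q j * p l"
    have "(r - p j) * (r * Z ^ i - (\<Sum>l<Suc j. q l * Z ^ l)) +
        q j * (r * Z ^ j - (\<Sum>l<Suc j. p l * Z ^ l)) \<in> I"
      by (intro Iadd Imult qI pI polys_in_diff r p q)
    also have "(r - p j) * (r * Z ^ i - (\<Sum>l<Suc j. q l * Z ^ l)) +
        q j * (r * Z ^ j - (\<Sum>l<Suc j. p l * Z ^ l)) = ?r * Z ^ i - (\<Sum>l<j. ?q l * Z ^ l)"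
      by (simp add: algebra_simps sum.distrib sum_subtractf sum_distrib_left)
    finally show "\<exists>p'. (\<forall>l. p' l \<in> polys_in V \<and> mp_eval (p' l) a = 0) \<and>
        ?r * Z ^ i - (\<Sum>l<j. p' l * Z ^ l) \<in> I"
      by (intro exI[of _ ?q]) (auto intro!: polys_in_add polys_in_mult polys_in_diff r p q
          simp: mp_eval_simps p q)
  qed
qed

text \<open>The extension theorem of elimination. Specialising the variables of \<open>V\<close> at
  \<open>a\<close> turns \<open>I\<close> into an ideal of univariate polynomials, and any root of
  its generator extends \<open>a\<close>. Only the unit ideal could fail; then the quotient by
  \<open>I\<close> is finite over k[V] by the monic relation, and Nakayama produces an element of
  \<open>I\<close> in k[V] with value 1 at \<open>a\<close>.\<close>

lemma extend_common_zero:
  fixes I :: "('v, 'k::field) mpol set"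
  assumes alg_closed: "\<And>p :: 'k poly. degree p \<ge> 1 \<Longrightarrow> \<exists>x. poly p x = 0"
    and v: "v \<notin> V"
    and I0: "0 \<in> I"
    and Iadd: "\<And>p q. p \<in> I \<Longrightarrow> q \<in> I \<Longrightarrow> p + q \<in> I"
    and Imult: "\<And>p q. p \<in> I \<Longrightarrow> q \<in> polys_in (insert v V) \<Longrightarrow> q * p \<in> I"
    and IV: "I \<subseteq> polys_in (insert v V)"
    and monic: "\<And>i. g i \<in> polys_in V" "Var v ^ n - (\<Sum>i<n. g i * Var v ^ i) \<in> I"
    and zero: "\<And>f. f \<in> I \<Longrightarrow> f \<in> polys_in V \<Longrightarrow> mp_eval f a = 0"
  shows "\<exists>c. \<forall>f\<in>I. mp_eval f (a(v := c)) = 0"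
proof -
  define h :: "'k \<Rightarrow> 'k poly" where "h = (\<lambda>c. [:c:])"
  have h: "comm_ring_hom h" unfolding h_def by unfold_locales simp_all
  define E where "E = msub h ((\<lambda>w. [:a w:])(v := [:0, 1:]))"
  interpret E: comm_ring_hom E unfolding E_def by (rule comm_ring_hom_msub[OF h])
  have pE: "poly (E f) c = mp_eval f (a(v := c))" for f c
  proof -
    interpret ev: comm_ring_hom "\<lambda>p. poly p c" by unfold_locales simp_all
    have "poly (E f) c = msub (\<lambda>d. poly (h d) c) (\<lambda>w. poly (((\<lambda>w. [:a w:])(v := [:0, 1:])) w) c) f"
      unfolding E_def by (rule hom_msub[OF _ h]) unfold_locales
    also have "(\<lambda>d. poly (h d) c) = id" by (auto simp: h_def)
    also have "(\<lambda>w. poly (((\<lambda>w. [:a w:])(v := [:0, 1:])) w) c) = a(v := c)" by auto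
    finally show ?thesis unfolding mp_eval_msub .
  qed
  have EV: "E f = [:mp_eval f a:]" if "f \<in> polys_in V" for f
  proof -
    interpret hm: comm_ring_hom h by (rule h)
    have "E f = msub h (\<lambda>w. h (a w)) f"
      unfolding E_def using v that by (intro msub_cong_polys_in) (auto simp: h_def)
    also have "\<dots> = h (mp_eval f a)" using hom_msub[OF h comm_ring_hom_id, of a f]
      by (simp add: mp_eval_msub id_def)
    finally show ?thesis by (simp add: h_def)
  qed
  have EZ: "E (Var v) = [:0, 1:]" by (simp add: E_def h)
  have EC: "E (Cst c) = [:c:]" for c by (simp add: E_def h) (simp add: h_def)
  have lift: "\<exists>q\<in>polys_in (insert v V). E q = p" for p
  proof (induction p)
    case 0 show ?case by (intro bexI[of _ 0]) auto
  next
    case (pCons c p)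
    then obtain q where q: "q \<in> polys_in (insert v V)" "E q = p" by blast
    have "E (Cst c + Var v * q) = [:c:] + [:0, 1:] * p"
      by (simp add: E.hom_add E.hom_mult q EZ EC)
    thus ?case using q by (intro bexI[of _ "Cst c + Var v * q"])
        (auto intro!: polys_in_add polys_in_mult polys_in_Var polys_in_Cst)
  qed
  show ?thesis
  proof (cases "\<forall>f\<in>I. E f = 0")
    case True
    thus ?thesis using pE by (metis poly_0)
  next
    case False
    define d where "d = (LEAST d. \<exists>f\<in>I. E f \<noteq> 0 \<and> degree (E f) = d)"
    obtain f0 where f0: "f0 \<in> I" "E f0 \<noteq> 0" "degree (E f0) = d"
      using LeastI_ex[of "\<lambda>d. \<exists>f\<in>I. E f \<noteq> 0 \<and> degree (E f) = d"] False unfolding d_def by blast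
    have dvd: "E f0 dvd E f" if f: "f \<in> I" for f
    proof -
      obtain q where q: "q \<in> polys_in (insert v V)" "E q = - (E f div E f0)" using lift by blast
      have fI: "f + q * f0 \<in> I" by (intro Iadd Imult f f0 q)
      have Ef: "E (f + q * f0) = E f mod E f0"
        by (simp add: E.hom_add E.hom_mult q minus_div_mult_eq_mod[symmetric])
      have "E f mod E f0 = 0"
      proof (rule ccontr)
        assume nz: "E f mod E f0 \<noteq> 0"
        hence "d \<le> degree (E f mod E f0)" unfolding d_def
          by (intro Least_le bexI[OF _ fI]) (simp add: Ef)
        moreover have "degree (E f mod E f0) < degree (E f0)" using degree_mod_less[OF f0(2)] nz by blast
        ultimately show False using f0(3) by simp
      qed
      thus ?thesis by auto
    qed
    show ?thesis
    proof (cases "d \<ge> 1")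
      case True
      then obtain c where "poly (E f0) c = 0" using alg_closed f0(3) by blast
      hence "poly (E f) c = 0" if "f \<in> I" for f using dvd[OF that] by (auto elim!: dvdE)
      thus ?thesis using pE by auto
    next
      case False
      then obtain e where e: "E f0 = [:e:]" "e \<noteq> 0" using f0 by (metis degree_eq_zeroE less_one
            not_le pCons_0_0)
      \<comment> \<open>As 1 - f specialises to zero, its coefficients in k[V] all vanish at
        \<open>a\<close>. Modulo \<open>I\<close>, the element 1 thus lies in the maximal ideal of
        \<open>a\<close> times the quotient ring.\<close>
      define f where "f = Cst (inverse e) * f0"
      have fI: "f \<in> I" unfolding f_def by (intro Imult f0 polys_in_Cst)
      have Ef: "E f = 1" using e by (simp add: f_def E.hom_mult EC)
      have "1 - f \<in> polys_in (insert v V)" using fI IV by (auto intro!: polys_in_diff polys_in_1)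
      then obtain N s where s: "\<And>i. s i \<in> polys_in V" "1 - f = (\<Sum>i<N. s i * Var v ^ i)"
        using ex_expand_in_variable by metis
      have "E (1 - f) = 0" using Ef by (simp add: E.hom_minus)
      hence "(\<Sum>i<N. monom (mp_eval (s i) a) i) = 0"
        by (simp add: s(2) E.hom_sum E.hom_mult E.hom_power EV[OF s(1)] EZ monom_altdef)
      hence cf: "coeff (\<Sum>i<N. monom (mp_eval (s i) a) i) i = 0" for i by simp
      have sa: "mp_eval (s i) a = 0" if "i < N" for i
        using cf[of i] that by (simp add: coeff_sum sum.delta)
      \<comment> \<open>Membership in the maximal ideal of \<open>a\<close> times the quotient
        module, which the powers of \<open>Var v\<close> below \<open>n\<close> generate over k[V].
        Once all powers of \<open>Var v\<close> satisfy it, \<open>nakayama_elimination\<close>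
        applies.\<close>
      define Q where "Q x \<longleftrightarrow> (\<exists>p. (\<forall>l. p l \<in> polys_in V \<and> mp_eval (p l) a = 0) \<and>
           x - (\<Sum>l<n. p l * Var v ^ l) \<in> I)" for x
      have Qadd: "Q (x + y)" if xy: "Q x" "Q y" for x y
      proof -
        obtain p q where p: "\<And>l. p l \<in> polys_in V \<and> mp_eval (p l) a = 0" "x - (\<Sum>l<n. p l * Var v ^ l) \<in> I"
          and q: "\<And>l. q l \<in> polys_in V \<and> mp_eval (q l) a = 0" "y - (\<Sum>l<n. q l * Var v ^ l) \<in> I"
          using xy unfolding Q_def by blast
        have "x + y - (\<Sum>l<n. (p l + q l) * Var v ^ l) \<in> I"
          using Iadd[OF p(2) q(2)] by (simp add: algebra_simps sum.distrib)
        thus ?thesis unfolding Q_def using p q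
          by (intro exI[of _ "\<lambda>l. p l + q l"]) (auto intro: polys_in_add simp: mp_eval_simps)
      qed
      have Q0: "Q 0" unfolding Q_def using I0 by (intro exI[of _ "\<lambda>_. 0"]) auto
      have Qsum: "(\<And>i. i \<in> A \<Longrightarrow> Q (x i)) \<Longrightarrow> Q (sum x A)" for A and x :: "nat \<Rightarrow> ('v,'k) mpol"
        by (induction A rule: infinite_finite_induct) (auto intro: Q0 Qadd)
      have Qmono: "Q (t * Var v ^ i)" if t: "t \<in> polys_in V" "mp_eval t a = 0" for t i
        using t
      proof (induction i arbitrary: t rule: less_induct)
        case (less i)
        show ?case
        proof (cases "i < n")
          case True
          thus ?thesis unfolding Q_def using less.prems I0
            by (intro exI[of _ "\<lambda>l. if l = i then t else 0"])
              (auto simp: if_distrib if_distribR sum.delta cong: if_cong)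
        next
          case False
          then obtain k where k: "i = k + n" by (metis le_add_diff_inverse2 not_le)
          have "Q (\<Sum>l<n. (t * g l) * Var v ^ (k + l))"
          proof (intro Qsum)
            fix l assume "l \<in> {..<n}"
            thus "Q ((t * g l) * Var v ^ (k + l))" using less.prems k
              by (intro less.IH) (auto intro!: polys_in_mult monic simp: mp_eval_simps)
          qed
          moreover have "Q ((t * Var v ^ k) * (Var v ^ n - (\<Sum>i<n. g i * Var v ^ i)))"
          proof -
            have "t \<in> polys_in (insert v V)" using less.prems polys_in_mono[of V "insert v V"] by auto
            hence "(t * Var v ^ k) * (Var v ^ n - (\<Sum>i<n. g i * Var v ^ i)) \<in> I"
              by (intro Imult monic polys_in_mult polys_in_power polys_in_Var) auto
            thus ?thesis unfolding Q_def by (intro exI[of _ "\<lambda>_. 0"]) auto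
          qed
          ultimately have "Q ((\<Sum>l<n. (t * g l) * Var v ^ (k + l)) +
             (t * Var v ^ k) * (Var v ^ n - (\<Sum>i<n. g i * Var v ^ i)))" by (rule Qadd)
          thus ?thesis by (simp add: k power_add algebra_simps sum_distrib_left)
        qed
      qed
      have Q: "Q (Var v ^ i)" for i
      proof -
        have "Q (\<Sum>l<N. s l * Var v ^ (l + i))" by (intro Qsum Qmono s sa) auto
        moreover have "Q (Var v ^ i * f)"
        proof -
          have "Var v ^ i * f \<in> I" by (intro Imult fI polys_in_power polys_in_Var) auto
          thus ?thesis unfolding Q_def by (intro exI[of _ "\<lambda>_. 0"]) auto
        qed
        ultimately have "Q ((\<Sum>l<N. s l * Var v ^ (l + i)) + Var v ^ i * f)" by (rule Qadd)
        also have "(\<Sum>l<N. s l * Var v ^ (l + i)) = Var v ^ i * (1 - f)"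
          unfolding s(2) by (simp add: sum_distrib_left power_add ac_simps)
        finally show ?thesis by (simp add: algebra_simps)
      qed
      show ?thesis
      proof (cases "n = 0")
        case True
        hence "1 \<in> I" using monic(2) by simp
        thus ?thesis using zero[of 1] polys_in_1 by auto
      next
        case False
        have "\<exists>r\<in>polys_in V. mp_eval r a = 1 \<and> (\<forall>i<n. \<exists>p. (\<forall>l. p l \<in> polys_in V \<and> mp_eval (p l) a = 0) \<and>
           r * Var v ^ i - (\<Sum>l<0. p l * Var v ^ l) \<in> I)"
        proof (rule nakayama_elimination)
          show "\<And>p q. p \<in> I \<Longrightarrow> q \<in> polys_in V \<Longrightarrow> q * p \<in> I"
            using Imult polys_in_mono[of V "insert v V"] by blast
          show "\<exists>p. (\<forall>l. p l \<in> polys_in V \<and> mp_eval (p l) a = 0) \<and>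
            Var v ^ i - (\<Sum>l<n. p l * Var v ^ l) \<in> I" for i using Q[of i] unfolding Q_def .
        qed (auto intro: Iadd)
        then obtain r where "r \<in> polys_in V" "mp_eval r a = 1" "r \<in> I" using False by force
        thus ?thesis using zero by fastforce
      qed
    qed
  qed
qed

text \<open>A form that is nonzero at the coordinate point of \<open>v\<close> contains the pure
  power of \<open>v\<close>, so a scalar multiple is monic in \<open>v\<close>. For homogeneous
  ideals this supplies the monic relation of the extension step without a change of
  coordinates.\<close>

lemma homog_expand_in_variable:
  fixes f :: "('v, 'k::field) mpol"
  assumes f: "f \<in> polys_in (insert v V)" and h: "homog n f"
    and nz: "mp_eval f ((\<lambda>_. 0)(v := 1)) \<noteq> 0"
  shows "\<exists>c g. c \<noteq> 0 \<and> (\<forall>i. g i \<in> polys_in V) \<and> Cst c * f = Var v ^ n - (\<Sum>i<n. g i * Var v ^ i)"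
proof -
  define b where "b = lookup f (single v n)"
  define f' where "f' = f - Cst b * Var v ^ n"
  have lf': "lookup f' m = (if m = single v n then 0 else lookup f m)" for m
    by (auto simp: f'_def lookup_minus b_def Var_power Cst_def mult_single lookup_single when_def)
  have kf': "keys f' = keys f - {single v n}" by (auto simp: in_keys_iff lf' split: if_splits)
  have lt: "lookup m v < n" if m: "m \<in> keys f'" for m
  proof -
    have n: "mon_deg m = n" using m h by (auto simp: kf' homog_def)
    have "lookup m v \<le> mon_deg m"
      by (cases "v \<in> keys m") (auto simp: mon_deg_def in_keys_iff intro!: member_le_sum)
    moreover have "lookup m v \<noteq> n"
    proof
      assume a: "lookup m v = n"
      have "mon_deg m = lookup m v + (\<Sum>w\<in>keys m - {v}. lookup m w)"
        by (subst mon_deg_superset[of "insert v (keys m)"])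
          (auto simp: sum.insert_remove)
      hence "\<And>w. w \<in> keys m - {v} \<Longrightarrow> lookup m w = 0" using a n by simp
      hence "lookup m w = 0" if "w \<noteq> v" for w using that by (cases "w \<in> keys m") (auto simp: in_keys_iff)
      hence "m = single v n" using a
        by (intro poly_mapping_eqI) (auto simp: lookup_single when_def)
      thus False using m kf' by auto
    qed
    ultimately show ?thesis using n by simp
  qed
  have f'V: "f' \<in> polys_in (insert v V)" using f by (auto simp: polys_in_def kf')
  obtain r where r: "\<And>i. r i \<in> polys_in V" "f' = (\<Sum>i<n. r i * Var v ^ i)"
    using expand_in_variable[OF f'V lt] by blast
  have "mp_eval f' ((\<lambda>_. 0)(v := 1)) = 0"
    unfolding mp_eval_msub msub_def
  proof (intro sum.neutral ballI)
    fix m assume m: "m \<in> keys f'"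
    have "mon_deg m = n" using m h by (auto simp: kf' homog_def)
    hence "\<not> keys m \<subseteq> {v}" using lt[OF m] mon_deg_superset[of "{v}" m] by auto
    hence "\<exists>w\<in>keys m. w \<noteq> v" by blast
    hence "mon_eval ((\<lambda>_. 0)(v := 1)) m = (0::'k)"
      unfolding mon_eval_def by (intro prod_zero) (auto simp: in_keys_iff)
    thus "id (lookup f' m) * mon_eval ((\<lambda>_. 0)(v := 1)) m = 0" by simp
  qed
  hence "b \<noteq> 0" using nz by (auto simp: f'_def mp_eval_simps)
  moreover have "Cst (inverse b) * f = Var v ^ n - (\<Sum>i<n. (- Cst (inverse b) * r i) * Var v ^ i)"
  proof -
    have "f = Cst b * Var v ^ n + (\<Sum>i<n. r i * Var v ^ i)" by (simp add: f'_def flip: r(2))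
    hence "Cst (inverse b) * f = Cst (inverse b * b) * Var v ^ n + Cst (inverse b) * (\<Sum>i<n. r i * Var v ^ i)"
      by (simp add: Cst_mult algebra_simps)
    thus ?thesis using \<open>b \<noteq> 0\<close> by (simp add: sum_distrib_left sum_negf mult.assoc)
  qed
  ultimately show ?thesis
    by (intro exI[of _ "inverse b"] exI[of _ "\<lambda>i. - Cst (inverse b) * r i"])
      (auto intro!: polys_in_mult polys_in_uminus polys_in_Cst r)
qed

lemma polys_in_hcomp: "p \<in> polys_in V \<Longrightarrow> hcomp n p \<in> polys_in V"
  by (auto simp: polys_in_def keys_hcomp)

lemma ex_hcomp_nonzero:
  assumes "mp_eval f x \<noteq> 0"
  shows "\<exists>n. mp_eval (hcomp n f) x \<noteq> 0"
proof (rule ccontr)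
  assume "\<nexists>n. mp_eval (hcomp n f) x \<noteq> 0"
  moreover obtain N where "(\<Sum>n<N. hcomp n f) = f" using ex_sum_hcomp by blast
  ultimately have "mp_eval f x = 0" by (metis mp_eval_sum sum.neutral)
  with assms show False by simp
qed

lemma homog_univariate:
  assumes "f \<in> polys_in {v}" "homog n f"
  shows "f = Cst (lookup f (single v n)) * Var v ^ n"
proof -
  have "m = single v n" if "m \<in> keys f" for m
  proof -
    have k: "keys m \<subseteq> {v}" "mon_deg m = n" using that assms by (auto simp: polys_in_def homog_def)
    hence "lookup m v = n" using mon_deg_superset[of "{v}" m] by simp
    thus ?thesis using k
      by (intro poly_mapping_eqI) (auto simp: lookup_single when_def in_keys_iff subset_iff)
  qed
  thus ?thesis unfolding Var_power
    by (intro poly_mapping_eqI) (auto simp: Cst_def mult_single lookup_single when_def in_keys_iff)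
qed

text \<open>Eliminate \<open>k\<close>, then \<open>j\<close>: a nonzero common zero of an
  elimination ideal would extend to one of \<open>I\<close>, so each elimination ideal still has
  only the trivial zero. In one variable a form is a multiple of a power of that variable.\<close>

lemma variable_power_in_ideal:
  fixes I :: "('v, 'k::field) mpol set"
  assumes alg_closed: "\<And>p :: 'k poly. degree p \<ge> 1 \<Longrightarrow> \<exists>x. poly p x = 0"
    and UNIV: "UNIV = {i, j, k}" and dist: "i \<noteq> j" "i \<noteq> k" "j \<noteq> k"
    and I0: "0 \<in> I"
    and Iadd: "\<And>p q. p \<in> I \<Longrightarrow> q \<in> I \<Longrightarrow> p + q \<in> I"
    and Imult: "\<And>p q. p \<in> I \<Longrightarrow> q * p \<in> I"
    and Ihc: "\<And>p n. p \<in> I \<Longrightarrow> hcomp n p \<in> I"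
    and zero: "\<And>x. (\<forall>f\<in>I. mp_eval f x = 0) \<Longrightarrow> \<forall>v. x v = 0"
  shows "\<exists>N. Var i ^ N \<in> I"
proof -
  define e :: "'v \<Rightarrow> 'v \<Rightarrow> 'k" where "e = (\<lambda>v. (\<lambda>_. 0)(v := 1))"
  have U: "insert k {i, j} = UNIV" "insert j {i} = {i, j}" using UNIV by auto
  define I2 where "I2 = I \<inter> polys_in {i, j}"
  have "\<not> (\<forall>f\<in>I. mp_eval f (e k) = 0)"
  proof
    assume "\<forall>f\<in>I. mp_eval f (e k) = 0"
    from zero[OF this] have "e k k = 0" by blast
    thus False by (simp add: e_def)
  qed
  then obtain f n where f: "f \<in> I" "mp_eval (hcomp n f) (e k) \<noteq> 0" using ex_hcomp_nonzero by blast
  have "hcomp n f \<in> polys_in (insert k {i, j})" by (simp add: U)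
  from homog_expand_in_variable[OF this homog_hcomp f(2)[unfolded e_def]]
  obtain c g where g: "\<And>l. g l \<in> polys_in {i, j}"
     "Cst c * hcomp n f = Var k ^ n - (\<Sum>l<n. g l * Var k ^ l)" by blast
  have g': "Var k ^ n - (\<Sum>l<n. g l * Var k ^ l) \<in> I"
    unfolding g(2)[symmetric] by (intro Imult Ihc f)
  have step1: "\<exists>f\<in>I2. mp_eval f a \<noteq> 0" if a: "a i \<noteq> 0 \<or> a j \<noteq> 0" for a
  proof (rule ccontr)
    assume "\<not> (\<exists>f\<in>I2. mp_eval f a \<noteq> 0)"
    hence "\<exists>c. \<forall>f\<in>I. mp_eval f (a(k := c)) = 0"
      using dist by (intro extend_common_zero[OF alg_closed, of k "{i, j}" I g n])
        (auto simp: U I2_def intro: I0 Iadd Imult g g')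
    then obtain c where "\<forall>v. (a(k := c)) v = 0" using zero by blast
    hence "(a(k := c)) i = 0" "(a(k := c)) j = 0" by blast+
    thus False using a dist by simp
  qed
  obtain f2 n2 where f2: "f2 \<in> I2" "mp_eval (hcomp n2 f2) (e j) \<noteq> 0"
    using step1[of "e j"] ex_hcomp_nonzero unfolding e_def by (metis fun_upd_same zero_neq_one)
  have h2: "hcomp n2 f2 \<in> I2" using f2 by (auto simp: I2_def intro: Ihc polys_in_hcomp)
  have "hcomp n2 f2 \<in> polys_in (insert j {i})" using h2 by (simp add: U I2_def)
  from homog_expand_in_variable[OF this homog_hcomp f2(2)[unfolded e_def]]
  obtain c2 g2 where g2: "\<And>l. g2 l \<in> polys_in {i}"
     "Cst c2 * hcomp n2 f2 = Var j ^ n2 - (\<Sum>l<n2. g2 l * Var j ^ l)" by blast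
  have g2': "Var j ^ n2 - (\<Sum>l<n2. g2 l * Var j ^ l) \<in> I2"
    unfolding g2(2)[symmetric] using h2 by (auto simp: I2_def intro!: Imult polys_in_mult polys_in_Cst)
  have "\<exists>f\<in>I2 \<inter> polys_in {i}. mp_eval f (e i) \<noteq> 0"
  proof (rule ccontr)
    assume nz: "\<not> (\<exists>f\<in>I2 \<inter> polys_in {i}. mp_eval f (e i) \<noteq> 0)"
    have "\<exists>c. \<forall>f\<in>I2. mp_eval f ((e i)(j := c)) = 0"
    proof (rule extend_common_zero[OF alg_closed, of j "{i}" I2 g2 n2])
      show "I2 \<subseteq> polys_in (insert j {i})" by (auto simp: U I2_def)
      show "0 \<in> I2" by (simp add: I2_def I0)
      show "p + q \<in> I2" if "p \<in> I2" "q \<in> I2" for p q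
        using that by (simp add: I2_def Iadd polys_in_add)
      show "q * p \<in> I2" if "p \<in> I2" "q \<in> polys_in (insert j {i})" for p q
        using that by (simp add: I2_def Imult polys_in_mult U)
      show "mp_eval f (e i) = 0" if "f \<in> I2" "f \<in> polys_in {i}" for f using that nz by blast
    qed (use dist in \<open>auto intro: g2 g2'\<close>)
    then obtain c where "\<forall>f\<in>I2. mp_eval f ((e i)(j := c)) = 0" by blast
    moreover have "((e i)(j := c)) i \<noteq> 0" using dist by (simp add: e_def)
    ultimately show False using step1 by blast
  qed
  then obtain f1 where f1: "f1 \<in> I" "f1 \<in> polys_in {i}" "mp_eval f1 (e i) \<noteq> 0"
    unfolding I2_def by blast
  obtain n1 where n1: "mp_eval (hcomp n1 f1) (e i) \<noteq> 0" using ex_hcomp_nonzero[OF f1(3)] ..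
  define b where "b = lookup (hcomp n1 f1) (single i n1)"
  have eq: "hcomp n1 f1 = Cst b * Var i ^ n1"
    unfolding b_def using f1 by (intro homog_univariate homog_hcomp polys_in_hcomp)
  hence "b \<noteq> 0" using n1 by auto
  hence "Var i ^ n1 = Cst (inverse b) * hcomp n1 f1"
    by (simp add: eq flip: mult.assoc Cst_mult)
  hence "Var i ^ n1 \<in> I" using Imult[OF Ihc[OF f1(1)]] by simp
  thus ?thesis ..
qed

lemma UNIV_3: "(UNIV :: 3 set) = {0, 1, 2}"
proof -
  have "card {0, 1, 2 :: 3} = CARD(3)" by simp
  thus ?thesis by (intro card_subset_eq[symmetric]) auto
qed

lemma sum_3: "(\<Sum>i\<in>(UNIV :: 3 set). f i) = f 0 + f 1 + f 2"
  unfolding UNIV_3 by (simp add: add.assoc)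

lemma forall_3: "(\<forall>i::3. P i) \<longleftrightarrow> P 0 \<and> P 1 \<and> P 2"
proof -
  have "(\<forall>i::3. P i) \<longleftrightarrow> (\<forall>i\<in>{0, 1, 2}. P i)" by (simp flip: UNIV_3)
  thus ?thesis by simp
qed

text \<open>Each variable has a power in the ideal, and a monomial whose degree is at least the sum
  of these exponents is divisible by one of these powers. Homogeneous components make the
  coefficients forms; where \<open>d i\<close> exceeds the degree of \<open>m\<close> the
  coefficient is chosen to be zero, so truncated subtraction does no harm.\<close>

theorem projective_nullstellensatz:
  fixes h :: "'i \<Rightarrow> 'k::field pol3"
  assumes alg_closed: "\<And>p :: 'k poly. degree p \<ge> 1 \<Longrightarrow> \<exists>x. poly p x = 0"
    and K: "finite K" and hom: "\<And>i. i \<in> K \<Longrightarrow> homog (d i) (h i)"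
    and zero: "\<And>x. (\<forall>i\<in>K. mp_eval (h i) x = 0) \<Longrightarrow> \<forall>v. x v = 0"
  shows "\<exists>N. \<forall>m. mon_deg m \<ge> N \<longrightarrow> (\<exists>c. (\<forall>i\<in>K. homog (mon_deg m - d i) (c i)) \<and>
           single m 1 = (\<Sum>i\<in>K. c i * h i))"
proof -
  define I where "I = {p. \<exists>c. p = (\<Sum>i\<in>K. c i * h i)}"
  have I0: "0 \<in> I" unfolding I_def by (auto intro!: exI[of _ "\<lambda>_. 0"])
  have Iadd: "p + q \<in> I" if pq: "p \<in> I" "q \<in> I" for p q
  proof -
    obtain c c' where "p = (\<Sum>i\<in>K. c i * h i)" "q = (\<Sum>i\<in>K. c' i * h i)" using pq by (auto simp: I_def)
    hence "p + q = (\<Sum>i\<in>K. (c i + c' i) * h i)" by (simp add: algebra_simps sum.distrib)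
    thus ?thesis unfolding I_def by (intro CollectI exI)
  qed
  have Imult: "q * p \<in> I" if p: "p \<in> I" for p q
  proof -
    obtain c where "p = (\<Sum>i\<in>K. c i * h i)" using p by (auto simp: I_def)
    hence "q * p = (\<Sum>i\<in>K. (q * c i) * h i)" by (simp add: sum_distrib_left mult.assoc)
    thus ?thesis unfolding I_def by (intro CollectI exI)
  qed
  have hcI: "\<exists>c. (\<forall>i\<in>K. homog (n - d i) (c i)) \<and> hcomp n p = (\<Sum>i\<in>K. c i * h i)"
    if p: "p \<in> I" for p n
  proof -
    obtain c where "p = (\<Sum>i\<in>K. c i * h i)" using p by (auto simp: I_def)
    hence "hcomp n p = (\<Sum>i\<in>K. (if d i \<le> n then hcomp (n - d i) (c i) else 0) * h i)"
      by (auto simp: hcomp_sum hcomp_mult_homog[OF hom] intro!: sum.cong)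
    thus ?thesis
      by (intro exI[of _ "\<lambda>i. if d i \<le> n then hcomp (n - d i) (c i) else 0"]) (auto simp: homog_hcomp)
  qed
  have Ihc: "hcomp n p \<in> I" if p: "p \<in> I" for p n
    using hcI[OF p] unfolding I_def by blast
  have hI: "h i \<in> I" if "i \<in> K" for i
  proof -
    have "(\<Sum>j\<in>K. (if j = i then 1 else 0) * h j) = (\<Sum>j\<in>K. if j = i then h j else 0)"
      by (intro sum.cong) auto
    hence "h i = (\<Sum>j\<in>K. (if j = i then 1 else 0) * h j)" using that K by (simp add: sum.delta)
    thus ?thesis unfolding I_def by (intro CollectI exI)
  qed
  have zI: "\<forall>v. x v = 0" if all: "\<forall>f\<in>I. mp_eval f x = 0" for x :: "3 \<Rightarrow> 'k"
  proof -
    have "\<forall>i\<in>K. mp_eval (h i) x = 0" by (intro ballI bspec[OF all] hI)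
    thus ?thesis by (rule zero)
  qed
  note vp = variable_power_in_ideal[OF alg_closed _ _ _ _ I0 Iadd Imult Ihc zI]
  have "\<exists>N. Var i ^ N \<in> I" for i :: 3
  proof -
    have "\<exists>N. Var (0::3) ^ N \<in> I" using UNIV_3 by (intro vp[of 0 1 2]) auto
    moreover have "\<exists>N. Var (1::3) ^ N \<in> I" using UNIV_3 by (intro vp[of 1 0 2]) auto
    moreover have "\<exists>N. Var (2::3) ^ N \<in> I" using UNIV_3 by (intro vp[of 2 0 1]) auto
    ultimately have "\<forall>i::3. \<exists>N. Var i ^ N \<in> I" unfolding forall_3 by blast
    thus ?thesis by blast
  qed
  then obtain N where N: "\<And>i. Var i ^ N i \<in> I" by metis
  show ?thesis
  proof (intro exI[of _ "\<Sum>i\<in>UNIV. N i"] allI impI)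
    fix m :: "3 \<Rightarrow>\<^sub>0 nat" assume m: "mon_deg m \<ge> (\<Sum>i\<in>UNIV. N i)"
    have "\<exists>i. lookup m i \<ge> N i"
    proof (rule ccontr)
      assume "\<not> (\<exists>i. lookup m i \<ge> N i)"
      hence "(\<Sum>i\<in>UNIV. lookup m i) < (\<Sum>i\<in>UNIV. N i)" by (intro sum_strict_mono) (auto simp: not_le)
      thus False using m mon_deg_superset[of UNIV m] by simp
    qed
    then obtain i where i: "lookup m i \<ge> N i" by blast
    have "m = (m - single i (N i)) + single i (N i)"
      using i by (intro poly_mapping_eqI) (auto simp: lookup_add lookup_minus lookup_single when_def)
    hence "single m 1 = single (m - single i (N i)) 1 * single (single i (N i)) (1::'k)"
      by (simp add: mult_single)
    also have "single (single i (N i)) (1::'k) = Var i ^ N i"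
      by (simp add: Var_power)
    finally have "single m 1 \<in> I" using Imult N by simp
    from hcI[OF this, of "mon_deg m"]
    show "\<exists>c. (\<forall>i\<in>K. homog (mon_deg m - d i) (c i)) \<and> single m 1 = (\<Sum>i\<in>K. c i * h i)"
      by (simp add: hcomp_homog[OF homog_single[OF refl]])
  qed
qed


section \<open>Divisibility in three variables\<close>

text \<open>\<open>nest\<close> identifies \<open>k[x,y,z]\<close> with \<open>k[y][x][z]\<close>, where \<open>x, y, z\<close> are the variables \<open>0, 1, 2\<close>;
  the outermost polynomial variable is \<open>z\<close>.\<close>

definition nest :: "'k::comm_ring_1 pol3 \<Rightarrow> 'k poly poly poly" where
  "nest = msub (\<lambda>c. [:[:[:c:]:]:])
     (\<lambda>v. if v = 0 then [:[:0, 1:]:] else if v = 1 then [:[:[:0, 1:]:]:] else [:0, 1:])"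

lemma comm_ring_hom_poly_map_poly:
  assumes "comm_ring_hom h"
  shows "comm_ring_hom (\<lambda>p. poly (map_poly h p) a)"
proof -
  interpret comm_ring_hom h by fact
  interpret m: map_poly_comm_ring_hom h ..
  show ?thesis by unfold_locales (simp_all add: m.hom_add m.hom_mult)
qed

lemma comm_ring_hom_nest_const: "comm_ring_hom (\<lambda>c::'k::comm_ring_1. [:[:[:c:]:]:])"
  by unfold_locales simp_all

lemma comm_ring_hom_nest: "comm_ring_hom nest"
  unfolding nest_def by (rule comm_ring_hom_msub[OF comm_ring_hom_nest_const])

lemma nest_Cst: "nest (Cst c) = [:[:[:c:]:]:]"
  and nest_Var0: "nest (Var 0) = [:[:0, 1:]:]"
  and nest_Var1: "nest (Var 1) = [:[:[:0, 1:]:]:]"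
  and nest_Var2: "nest (Var 2) = [:0, 1:]"
  by (simp_all add: nest_def comm_ring_hom_nest_const)

definition unnest :: "'k::comm_ring_1 poly poly poly \<Rightarrow> 'k pol3" where
  "unnest q = poly (map_poly (\<lambda>r. poly (map_poly (\<lambda>s. poly (map_poly Cst s) (Var 1)) r) (Var 0)) q) (Var 2)"

lemma comm_ring_hom_unnest: "comm_ring_hom unnest"
  unfolding unnest_def by (intro comm_ring_hom_poly_map_poly comm_ring_hom_Cst)

lemma comm_ring_hom_comp:
  assumes "comm_ring_hom f" "comm_ring_hom g" shows "comm_ring_hom (\<lambda>x. f (g x))"
proof -
  interpret f: comm_ring_hom f by fact
  interpret g: comm_ring_hom g by fact
  show ?thesis by unfold_locales (simp_all add: f.hom_add g.hom_add f.hom_mult g.hom_mult)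
qed

lemma mpol_hom_eqI:
  assumes "comm_ring_hom F" "comm_ring_hom G" "\<And>c. F (Cst c) = G (Cst c)" "\<And>v. F (Var v) = G (Var v)"
  shows "F p = G p"
  using assms(3,4) hom_eq_msub[OF assms(1), of p] hom_eq_msub[OF assms(2), of p] by simp

lemma poly_hom_eqI:
  assumes "comm_ring_hom F" "comm_ring_hom G" "\<And>c. F [:c:] = G [:c:]" "F (pCons 0 1) = G (pCons 0 1)"
  shows "F p = G p"
proof -
  interpret F: comm_ring_hom F by fact
  interpret G: comm_ring_hom G by fact
  show ?thesis
  proof (induction p)
    case (pCons a p)
    have "pCons a p = [:a:] + pCons 0 1 * p" by simp
    thus ?case by (simp only: F.hom_add G.hom_add F.hom_mult G.hom_mult assms pCons)
  qed (simp add: F.hom_zero G.hom_zero)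
qed

lemma map_poly_pCons': "f 0 = 0 \<Longrightarrow> map_poly f (pCons c p) = pCons (f c) (map_poly f p)"
  by (rule poly_eqI) (simp add: coeff_map_poly coeff_pCons split: nat.split)

lemma exhaust_3: "(i::3) = 0 \<or> i = 1 \<or> i = 2"
  using UNIV_I[of i] unfolding UNIV_3 by blast

lemma
  shows unnest_const: "unnest [:[:[:c:]:]:] = Cst c"
    and unnest_y: "unnest [:[:pCons 0 1:]:] = Var 1"
    and unnest_x: "unnest [:pCons 0 1:] = Var 0"
    and unnest_z: "unnest (pCons 0 1) = Var 2"
  by (simp_all add: unnest_def map_poly_pCons')

lemma unnest_nest: "unnest (nest p) = p"
proof -
  have "unnest (nest p) = (\<lambda>x. x) p"
  proof (rule mpol_hom_eqI[of "\<lambda>p. unnest (nest p)" "\<lambda>x. x"])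
    show "comm_ring_hom (\<lambda>p::'a pol3. unnest (nest p))"
      by (rule comm_ring_hom_comp[OF comm_ring_hom_unnest comm_ring_hom_nest])
    show "comm_ring_hom (\<lambda>x::'a pol3. x)" using comm_ring_hom_id by (simp add: id_def)
    show "unnest (nest (Cst c)) = Cst c" for c :: 'a by (simp add: nest_Cst unnest_const)
    show "unnest (nest (Var v)) = (Var v :: 'a pol3)" for v
      using exhaust_3[of v] by (auto simp: nest_Var0 nest_Var1 nest_Var2 unnest_x unnest_y unnest_z)
  qed
  thus ?thesis .
qed

lemma comm_ring_hom_const_poly: "comm_ring_hom (\<lambda>c::'a::comm_ring_1. [:c:])"
  by unfold_locales simp_all

lemma nest_unnest: "nest (unnest q) = q"
proof -
  have hom: "comm_ring_hom (\<lambda>q::'a poly poly poly. nest (unnest q))"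
    by (rule comm_ring_hom_comp[OF comm_ring_hom_nest comm_ring_hom_unnest])
  note c = comm_ring_hom_const_poly
  note cc = comm_ring_hom_comp[OF c c]
  have 1: "nest (unnest [:[:s:]:]) = [:[:s:]:]" for s :: "'a poly"
    by (rule poly_hom_eqI[OF comm_ring_hom_comp[OF hom cc] cc])
      (simp_all add: unnest_const nest_Cst unnest_y nest_Var1)
  have 2: "nest (unnest [:r:]) = [:r:]" for r :: "'a poly poly"
    by (rule poly_hom_eqI[OF comm_ring_hom_comp[OF hom c] c])
      (simp_all add: 1 unnest_x nest_Var0)
  have id: "comm_ring_hom (\<lambda>x::'a poly poly poly. x)" using comm_ring_hom_id by (simp add: id_def)
  show ?thesis
    by (rule poly_hom_eqI[OF hom id]) (simp_all add: 2 unnest_z nest_Var2)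
qed

lemma nest_dvd_iff: "nest a dvd nest b \<longleftrightarrow> a dvd b"
proof -
  interpret n: comm_ring_hom nest by (rule comm_ring_hom_nest)
  interpret u: comm_ring_hom unnest by (rule comm_ring_hom_unnest)
  show ?thesis using n.hom_mult u.hom_mult nest_unnest unnest_nest unfolding dvd_def by metis
qed

lemma nest_eq_0_iff: "nest a = 0 \<longleftrightarrow> a = 0"
proof -
  interpret n: comm_ring_hom nest by (rule comm_ring_hom_nest)
  interpret u: comm_ring_hom unnest by (rule comm_ring_hom_unnest)
  show ?thesis using unnest_nest[of a] by (auto simp: n.hom_zero u.hom_zero)
qed

lemma prime_elem_nest_iff: "prime_elem (nest p) \<longleftrightarrow> prime_elem p"
proof -
  interpret n: comm_ring_hom nest by (rule comm_ring_hom_nest)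
  have 1: "nest p dvd 1 \<longleftrightarrow> p dvd 1" for p :: "'a pol3" using nest_dvd_iff[of p 1] by (simp add: n.hom_one)
  have "(\<forall>a b. nest p dvd a * b \<longrightarrow> nest p dvd a \<or> nest p dvd b) \<longleftrightarrow>
     (\<forall>a b. p dvd a * b \<longrightarrow> p dvd a \<or> p dvd b)"
  proof
    assume *: "\<forall>a b. nest p dvd a * b \<longrightarrow> nest p dvd a \<or> nest p dvd b"
    show "\<forall>a b. p dvd a * b \<longrightarrow> p dvd a \<or> p dvd b"
    proof (intro allI impI)
      fix a b assume "p dvd a * b"
      hence "nest p dvd nest a * nest b" by (simp add: nest_dvd_iff flip: n.hom_mult)
      thus "p dvd a \<or> p dvd b" using * by (simp flip: nest_dvd_iff)
    qed
  next
    assume *: "\<forall>a b. p dvd a * b \<longrightarrow> p dvd a \<or> p dvd b"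
    show "\<forall>a b. nest p dvd a * b \<longrightarrow> nest p dvd a \<or> nest p dvd b"
    proof (intro allI impI)
      fix a b assume "nest p dvd a * b"
      hence "nest p dvd nest (unnest a * unnest b)" by (simp add: n.hom_mult nest_unnest)
      hence "p dvd unnest a \<or> p dvd unnest b" using * by (simp add: nest_dvd_iff)
      thus "nest p dvd a \<or> nest p dvd b" by (simp add: nest_unnest flip: nest_dvd_iff)
    qed
  qed
  thus ?thesis by (simp add: prime_elem_def nest_eq_0_iff 1)
qed

text \<open>Prime factors are transported along \<open>nest\<close> from the iterated univariate
  polynomial ring, which is factorial.\<close>

lemma ex_prime_factor:
  fixes p :: "'k::field pol3"
  assumes "p \<noteq> 0" "\<not> p dvd 1"
  shows "\<exists>q. prime_elem q \<and> q dvd p"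
proof -
  interpret n: comm_ring_hom nest by (rule comm_ring_hom_nest)
  have "nest p \<noteq> 0" "\<not> nest p dvd 1" using assms nest_dvd_iff[of p 1] by (simp_all add: n.hom_one nest_eq_0_iff)
  then obtain F where F: "mset_factors F (nest p)" using mset_factors_exist by blast
  then obtain q where q: "q \<in># F" by (auto simp: mset_factors_def)
  have "prime_elem q" using F q by (auto simp: mset_factors_def)
  moreover have "q dvd nest p" using F q by (auto simp: mset_factors_def dvd_prod_mset)
  ultimately have "prime_elem (unnest q)" "unnest q dvd p"
    using prime_elem_nest_iff[of "unnest q"] nest_dvd_iff[of "unnest q" p] by (simp_all add: nest_unnest)
  thus ?thesis by (intro exI[of _ "unnest q"] conjI)
qed

lemma nest_mp_pderiv2: "nest (mp_pderiv 2 p) = pderiv (nest p)"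
proof -
  interpret n: comm_ring_hom nest by (rule comm_ring_hom_nest)
  have V: "nest (mp_pderiv 2 (Var v)) = pderiv (nest (Var v :: 'a pol3))" for v
    using exhaust_3[of v] by (auto simp: mp_pderiv_Var nest_Var0 nest_Var1 nest_Var2 pderiv_pCons n.hom_zero n.hom_one)
  show ?thesis
    by (induction p rule: mpol_induct)
      (simp_all add: V nest_Cst pderiv_pCons n.hom_zero mp_pderiv_add mp_pderiv_mult n.hom_add
        n.hom_mult pderiv_add pderiv_mult algebra_simps)
qed

lemma degree_nest_ge_1: "mp_pderiv 2 (J :: 'k::idom pol3) \<noteq> 0 \<Longrightarrow> degree (nest J) \<ge> 1"
  using nest_mp_pderiv2[of J] nest_eq_0_iff[of "mp_pderiv 2 J"]
  by (cases "degree (nest J)") (auto elim!: degree_eq_zeroE simp: pderiv_pCons)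

section \<open>Elimination of the last variable and vanishing on a prime curve\<close>

definition ev2 :: "'k::comm_ring_1 \<Rightarrow> 'k \<Rightarrow> 'k poly poly \<Rightarrow> 'k" where
  "ev2 x y r = poly (poly r [:x:]) y"

lemma comm_ring_hom_ev2: "comm_ring_hom (ev2 x y)"
  unfolding ev2_def by unfold_locales simp_all

lemma mp_eval_nest: "mp_eval p x = poly (map_poly (ev2 (x 0) (x 1)) (nest p)) (x 2)"
proof -
  interpret e: comm_ring_hom "ev2 (x 0) (x 1)" by (rule comm_ring_hom_ev2)
  show ?thesis
  proof (rule mpol_hom_eqI[of "\<lambda>p. mp_eval p x" "\<lambda>p. poly (map_poly (ev2 (x 0) (x 1)) (nest p)) (x 2)"])
    show "comm_ring_hom (\<lambda>p. poly (map_poly (ev2 (x 0) (x 1)) (nest p)) (x 2))"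
      using comm_ring_hom_comp[OF comm_ring_hom_poly_map_poly[OF comm_ring_hom_ev2] comm_ring_hom_nest] .
    show "mp_eval (Cst c) x = poly (map_poly (ev2 (x 0) (x 1)) (nest (Cst c))) (x 2)" for c
      by (simp add: nest_Cst map_poly_pCons' ev2_def)
    show "mp_eval (Var v) x = poly (map_poly (ev2 (x 0) (x 1)) (nest (Var v))) (x 2)" for v
      using exhaust_3[of v] by (auto simp: nest_Var0 nest_Var1 nest_Var2 map_poly_pCons' ev2_def)
  qed (rule comm_ring_hom_mp_eval)
qed

text \<open>By pseudo-division, an element \<open>R\<close> of least degree in the ideal of
  \<open>j\<close> and \<open>k\<close> divides constant multiples of both. If \<open>R\<close> had
  positive degree, the prime \<open>j\<close> would divide \<open>R\<close>, hence a constant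
  multiple of \<open>k\<close>, hence \<open>k\<close> itself.\<close>

lemma eliminate_prime:
  fixes j k :: "'a::idom poly"
  assumes j: "prime_elem j" "degree j \<ge> 1" and k: "\<not> j dvd k"
  shows "\<exists>u v r. r \<noteq> 0 \<and> u * j + v * k = [:r:]"
proof -
  define I where "I = {u * j + v * k |u v. True}"
  have jI: "j \<in> I" unfolding I_def by (rule CollectI, rule exI[of _ 1], rule exI[of _ 0]) simp
  have kI: "k \<in> I" unfolding I_def by (rule CollectI, rule exI[of _ 0], rule exI[of _ 1]) simp
  have I_sub: "p - a * q \<in> I" if pq: "p \<in> I" "q \<in> I" for p q a
  proof -
    obtain u v u' v' where "p = u * j + v * k" "q = u' * j + v' * k" using pq by (auto simp: I_def)
    hence "p - a * q = (u - a * u') * j + (v - a * v') * k" by (simp add: algebra_simps)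
    thus ?thesis unfolding I_def by blast
  qed
  have I_smult: "Polynomial.smult c p \<in> I" if "p \<in> I" for c p
    using I_sub[OF I_sub[OF that that, of 1] that, of "[:- c:]"] by simp
  have j0: "j \<noteq> 0" using j by (auto simp: prime_elem_def)
  define d where "d = (LEAST d. \<exists>p\<in>I. p \<noteq> 0 \<and> degree p = d)"
  have "\<exists>p\<in>I. p \<noteq> 0 \<and> degree p = d"
    unfolding d_def by (rule LeastI_ex) (use jI j0 in blast)
  then obtain R where R: "R \<in> I" "R \<noteq> 0" "degree R = d" by blast
  have dvd: "\<exists>c. c \<noteq> 0 \<and> R dvd Polynomial.smult c p" if p: "p \<in> I" for p
  proof -
    obtain q r where qr: "pseudo_divmod p R = (q, r)" by force
    define c where "c = coeff R (degree R) ^ (Suc (degree p) - degree R)"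
    have eq: "Polynomial.smult c p = R * q + r" and deg: "r = 0 \<or> degree r < degree R"
      using pseudo_divmod[OF R(2) qr] by (auto simp: c_def)
    have "r = Polynomial.smult c p - q * R" using eq by (simp add: ac_simps)
    hence rI: "r \<in> I" using I_sub[OF I_smult[OF p] R(1)] by simp
    have "r = 0"
    proof (rule ccontr)
      assume "r \<noteq> 0"
      hence "d \<le> degree r" unfolding d_def using rI by (intro Least_le) blast
      thus False using deg R(3) \<open>r \<noteq> 0\<close> by simp
    qed
    moreover have "c \<noteq> 0" using R(2) by (simp add: c_def)
    ultimately show ?thesis using eq by (intro exI[of _ c]) auto
  qed
  have "d = 0"
  proof (rule ccontr)
    assume d: "d \<noteq> 0"
    obtain c where c: "c \<noteq> 0" "R dvd Polynomial.smult c j" using dvd[OF jI] by blast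
    from c(2) obtain s where s: "Polynomial.smult c j = R * s" unfolding dvd_def by blast
    have "j dvd R * s" using s by (metis dvd_smult dvd_refl)
    hence "j dvd R \<or> j dvd s" using j(1) by (simp add: prime_elem_dvd_mult_iff)
    moreover have "\<not> j dvd s"
    proof
      assume "j dvd s"
      then obtain s' where "s = j * s'" unfolding dvd_def by blast
      hence "j * [:c:] = j * (R * s')" using s by (simp add: ac_simps)
      hence "[:c:] = R * s'" using j0 by (simp only: mult_cancel_left) simp
      hence "R dvd [:c:]" by (metis dvd_triv_left)
      hence "degree R \<le> 0" using dvd_imp_degree_le[of R "[:c:]"] c by simp
      thus False using d R by simp
    qed
    ultimately have jR: "j dvd R" by blast
    obtain c' where c': "c' \<noteq> 0" "R dvd Polynomial.smult c' k" using dvd[OF kI] by blast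
    have "j dvd [:c':] * k" using dvd_trans[OF jR c'(2)] by simp
    hence "j dvd [:c':] \<or> j dvd k" using j(1) by (simp only: prime_elem_dvd_mult_iff)
    hence "j dvd [:c':]" using k by blast
    hence "degree j \<le> 0" using dvd_imp_degree_le[of j "[:c':]"] c' by simp
    thus False using j by simp
  qed
  then obtain r where r: "R = [:r:]" using R(3) degree_eq_zeroE by blast
  moreover obtain u v where "R = u * j + v * k" using R(1) by (auto simp: I_def)
  ultimately show ?thesis using R(2) by (intro exI[of _ u] exI[of _ v] exI[of _ r]) auto
qed

lemma ex_ev2_nonzero:
  fixes r :: "'k::field_char_0 poly poly"
  assumes "r \<noteq> 0"
  shows "\<exists>x y. x \<noteq> 0 \<and> ev2 x y r \<noteq> 0"
proof -
  have inj: "inj (\<lambda>x::'k. [:x:])" by (auto intro: injI)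
  \<comment> \<open>The factor \<open>[:0, 1:]\<close> excludes \<open>x = 0\<close>, which keeps
    the point built from \<open>x\<close> away from the origin.\<close>
  have "finite {x. poly ([:0, 1:] * r) [:x:] = 0}"
    using poly_roots_finite[of "[:0, 1:] * r"] assms finite_vimageI[OF _ inj, of "{s. poly ([:0, 1:] * r) s = 0}"]
    by (simp add: vimage_def)
  then obtain x where x: "poly ([:0, 1:] * r) [:x:] \<noteq> 0"
    using infinite_UNIV_char_0 by (metis (mono_tags, lifting) UNIV_eq_I mem_Collect_eq)
  hence "finite {y. poly (poly r [:x:]) y = 0}" by (intro poly_roots_finite) auto
  then obtain y where "poly (poly r [:x:]) y \<noteq> 0"
    using infinite_UNIV_char_0 by (metis (mono_tags, lifting) UNIV_eq_I mem_Collect_eq)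
  thus ?thesis using x by (auto simp: ev2_def)
qed

text \<open>If \<open>J\<close> does not divide \<open>h\<close>, the ideal of both contains a
  nonzero polynomial r in the first two variables. Over a pair (a, b) at which neither r nor the
  leading coefficient of \<open>J\<close> in the third variable vanishes, \<open>J\<close> has a
  zero; \<open>h\<close> vanishes there, and therefore r does, a contradiction.\<close>

lemma prime_nullstellensatz:
  fixes J h :: "'k::field_char_0 pol3"
  assumes alg_closed: "\<And>p :: 'k poly. degree p \<ge> 1 \<Longrightarrow> \<exists>x. poly p x = 0"
    and J: "prime_elem J" "mp_pderiv 2 J \<noteq> 0"
    and van: "\<And>x. \<exists>i. x i \<noteq> 0 \<Longrightarrow> mp_eval J x = 0 \<Longrightarrow> mp_eval h x = 0"
  shows "J dvd h"
proof (rule ccontr)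
  assume "\<not> J dvd h"
  hence nd: "\<not> nest J dvd nest h" by (simp add: nest_dvd_iff)
  have deg: "degree (nest J) \<ge> 1" using J(2) by (rule degree_nest_ge_1)
  obtain u v r where r: "r \<noteq> 0" "u * nest J + v * nest h = [:r:]"
    using eliminate_prime[OF prime_elem_nest_iff[THEN iffD2, OF J(1)] deg nd] by blast
  have "lead_coeff (nest J) \<noteq> 0" using deg by auto
  then obtain a b where ab: "a \<noteq> 0" "ev2 a b (r * lead_coeff (nest J)) \<noteq> 0"
    using r(1) ex_ev2_nonzero[of "r * lead_coeff (nest J)"] by auto
  interpret e: comm_ring_hom "ev2 a b" by (rule comm_ring_hom_ev2)
  interpret m: map_poly_comm_ring_hom "ev2 a b" ..
  have nz: "ev2 a b r \<noteq> 0" "ev2 a b (lead_coeff (nest J)) \<noteq> 0" using ab(2) by (auto simp: e.hom_mult)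
  have "coeff (map_poly (ev2 a b) (nest J)) (degree (nest J)) \<noteq> 0" using nz by (simp add: coeff_map_poly)
  hence "degree (map_poly (ev2 a b) (nest J)) \<ge> 1" using deg le_degree by (metis order_trans)
  then obtain c where c: "poly (map_poly (ev2 a b) (nest J)) c = 0" using alg_closed by blast
  define x :: "3 \<Rightarrow> 'k" where "x = (\<lambda>i. if i = 0 then a else if i = 1 then b else c)"
  have x: "x 0 = a" "x 1 = b" "x 2 = c" by (simp_all add: x_def)
  have "mp_eval J x = 0" using c by (simp add: mp_eval_nest x)
  moreover have "\<exists>i. x i \<noteq> 0" using x(1) ab(1) by (intro exI[of _ 0]) simp
  ultimately have "mp_eval h x = 0" by (intro van)
  hence "poly (map_poly (ev2 a b) (nest h)) c = 0" by (simp add: mp_eval_nest x)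
  hence "poly (map_poly (ev2 a b) [:r:]) c = 0"
    using c by (simp add: m.hom_add m.hom_mult flip: r(2))
  thus False using nz by (simp add: map_poly_pCons')
qed


section \<open>Plane curves\<close>

lemma mon_eval_axis: "mon_eval ((\<lambda>_. 0)(v := 1)) m = (if keys m \<subseteq> {v} then 1 else (0::'r::comm_ring_1))"
proof (cases "keys m \<subseteq> {v}")
  case True
  thus ?thesis by (simp add: mon_eval_superset[of "{v}"])
next
  case False
  then obtain w where "w \<in> keys m" "w \<noteq> v" by blast
  hence "mon_eval ((\<lambda>_. 0)(v := 1)) m = (0::'r)"
    unfolding mon_eval_def by (intro prod_zero) (auto simp: in_keys_iff zero_power intro!: bexI[of _ w])
  thus ?thesis using False by simp
qed

lemma mon_eq_single:
  assumes "keys m \<subseteq> {v}" shows "m = single v (mon_deg m)"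
proof (rule poly_mapping_eqI)
  fix w
  have "mon_deg m = lookup m v" using mon_deg_superset[of "{v}" m] assms by simp
  moreover have "lookup m w = 0" if "w \<noteq> v"
    using that assms not_in_keys_iff_lookup_eq_zero by fastforce
  ultimately show "lookup m w = lookup (single v (mon_deg m)) w"
    by (cases "w = v") (simp_all add: lookup_single)
qed

lemma mp_eval_axis:
  assumes "homog n p"
  shows "mp_eval p ((\<lambda>_. 0)(v := 1)) = lookup p (single v n)"
proof -
  have "mp_eval p ((\<lambda>_. 0)(v := 1)) = (\<Sum>m\<in>keys p. if m = single v n then lookup p m else 0)"
    unfolding mp_eval_msub msub_def mon_eval_axis
  proof (intro sum.cong refl)
    fix m assume m: "m \<in> keys p"
    have "keys m \<subseteq> {v} \<longleftrightarrow> m = single v n"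
      using m assms mon_eq_single[of m v] by (auto simp: homog_def split: if_splits)
    thus "id (lookup p m) * (if keys m \<subseteq> {v} then 1 else 0) = (if m = single v n then lookup p m else 0)"
      by simp
  qed
  thus ?thesis by (simp add: sum.delta in_keys_iff)
qed

lemma mp_eval_origin:
  assumes "homog n p" "n \<ge> 1"
  shows "mp_eval p (\<lambda>_. 0) = 0"
  unfolding mp_eval_msub msub_def
proof (intro sum.neutral ballI)
  fix m assume "m \<in> keys p"
  hence "mon_deg m \<noteq> 0" using assms by (auto simp: homog_def)
  then obtain v where "v \<in> keys m" by (auto simp: mon_deg_def)
  hence "mon_eval (\<lambda>_. 0) m = (0::'b)"
    unfolding mon_eval_def by (intro prod_zero) (auto simp: in_keys_iff zero_power intro!: bexI[of _ v])
  thus "id (lookup p m) * mon_eval (\<lambda>_. 0) m = 0" by simp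
qed

lemma homog_0_eq_Cst: "homog 0 p \<Longrightarrow> p = Cst (lookup p 0)"
proof -
  assume h: "homog 0 p"
  have "m = 0" if "m \<in> keys p" for m
  proof (rule poly_mapping_eqI)
    fix v
    have "mon_deg m = 0" using h that by (simp add: homog_def)
    thus "lookup m v = lookup 0 v" by (cases "v \<in> keys m") (auto simp: mon_deg_def in_keys_iff)
  qed
  thus ?thesis
    by (intro poly_mapping_eqI) (auto simp: Cst_def lookup_single when_def in_keys_iff)
qed

section \<open>Factors of forms\<close>

lemma monom_factor:
  fixes p q :: "'a::idom poly"
  assumes pq: "p * q = monom c e" and c: "c \<noteq> 0"
  shows "\<exists>a i. p = monom a i"
proof -
  have nz: "p \<noteq> 0" "q \<noteq> 0" using assms by auto
  obtain p' where p': "p = [:- 0, 1:] ^ Polynomial.order 0 p * p'" "\<not> [:- 0, 1:] dvd p'"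
    using order_decomp[OF nz(1)] by blast
  obtain q' where q': "q = [:- 0, 1:] ^ Polynomial.order 0 q * q'" "\<not> [:- 0, 1:] dvd q'"
    using order_decomp[OF nz(2)] by blast
  define i j where "i = Polynomial.order 0 p" and "j = Polynomial.order 0 q"
  have p: "p = monom 1 i * p'" and q: "q = monom 1 j * q'"
    using p'(1) q'(1) by (simp_all add: i_def j_def monom_altdef)
  have p0: "coeff p' 0 \<noteq> 0" and q0: "coeff q' 0 \<noteq> 0"
    using p'(2) q'(2) by (simp_all only: dvd_iff_poly_eq_0 poly_0_coeff_0 minus_zero add.inverse_inverse) simp_all
  have eq: "monom 1 (i + j) * (p' * q') = monom c e"
    using pq by (simp add: p q mult_monom ac_simps)
  have "coeff (monom 1 (i + j) * (p' * q')) (i + j) = coeff (p' * q') 0"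
    by (simp add: coeff_monom_mult)
  hence "coeff (monom c e) (i + j) \<noteq> 0" using p0 q0 by (simp add: eq coeff_mult)
  hence ij: "e = i + j" by (simp add: coeff_monom split: if_splits)
  have nz': "p' \<noteq> 0" "q' \<noteq> 0" using p0 q0 by auto
  have "degree (monom 1 (i + j) * (p' * q')) = (i + j) + (degree p' + degree q')"
    using nz' by (simp add: degree_mult_eq degree_monom_eq)
  hence "degree p' = 0" using eq c ij by (simp add: degree_monom_eq)
  then obtain a where "p' = [:a:]" using degree_eq_zeroE by blast
  hence "p = monom a i" by (simp add: p smult_monom)
  thus ?thesis by blast
qed

lemma prod_monom: "(\<Prod>v\<in>A. monom (f v) (g v)) = monom (prod f A :: 'a::comm_semiring_1) (sum g A)"
  by (induction A rule: infinite_finite_induct) (simp_all add: mult_monom)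

text \<open>The substitution v -> v t with a new variable t: the coefficient of t^n is the component
  of degree n, so forms are the polynomials whose image is a monomial in t. Factors of such a
  monomial are monomials, hence factors of forms are forms.\<close>

definition hpoly :: "('v, 'k::comm_ring_1) mpol \<Rightarrow> ('v, 'k) mpol poly" where
  "hpoly = msub (\<lambda>c. [:Cst c:]) (\<lambda>v. monom (Var v) 1)"

lemma comm_ring_hom_hpoly: "comm_ring_hom hpoly"
  unfolding hpoly_def
  by (rule comm_ring_hom_msub[OF comm_ring_hom_comp[OF comm_ring_hom_const_poly comm_ring_hom_Cst]])

lemma coeff_hpoly: "coeff (hpoly p) n = hcomp n p"
proof -
  have pw: "monom (Var v :: ('a, 'b) mpol) 1 ^ k = monom (Var v ^ k) k" for v :: 'a and k
    by (simp add: monom_power)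
  have "[:Cst c:] * mon_eval (\<lambda>v. monom (Var v) 1) m = monom (single m c) (mon_deg m)"
    for m :: "'a \<Rightarrow>\<^sub>0 nat" and c :: 'b
    unfolding mon_eval_def pw prod_monom mon_deg_def single_eq_Cst_mult[of m c] by (simp add: smult_monom)
  hence "coeff (hpoly p) n = (\<Sum>m\<in>keys p. if mon_deg m = n then single m (lookup p m) else 0)"
    by (simp add: hpoly_def msub_def coeff_sum)
  thus ?thesis by (simp add: hcomp_def sum.If_cases Int_def)
qed

lemma homog_factor_left:
  fixes p q :: "'k::field pol3"
  assumes pq: "homog e (p * q)" "p * q \<noteq> 0"
  shows "\<exists>a. homog a p"
proof -
  interpret comm_ring_hom "hpoly :: 'k pol3 \<Rightarrow> _" by (rule comm_ring_hom_hpoly)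
  have "hpoly (p * q) = monom (p * q) e"
    by (rule poly_eqI) (simp add: coeff_hpoly hcomp_homog[OF pq(1)] coeff_monom)
  hence "hpoly p * hpoly q = monom (p * q) e" by (simp add: hom_mult)
  then obtain a i where ai: "hpoly p = monom a i" using monom_factor pq(2) by blast
  obtain N where N: "(\<Sum>n<N. hcomp n p) = p" using ex_sum_hcomp by blast
  have "homog i (\<Sum>n<N. hcomp n p)"
  proof (intro homog_sum)
    fix n
    have "(if i = n then a else 0) = hcomp n p" using coeff_hpoly[of p n] by (simp add: ai coeff_monom)
    thus "homog i (hcomp n p)" using homog_hcomp[of n p] by (cases "i = n") auto
  qed
  thus ?thesis using N by auto
qed

lemma homog_unique: "homog a p \<Longrightarrow> homog b p \<Longrightarrow> p \<noteq> 0 \<Longrightarrow> a = b"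
proof -
  assume h: "homog a p" "homog b p" "p \<noteq> 0"
  then obtain m where "m \<in> keys p" using keys_eq_empty by fastforce
  thus ?thesis using h by (auto simp: homog_def)
qed

text \<open>Either (1 : 0 : 0) is a zero, or a multiple of \<open>p\<close> is monic in the first
  variable and restricts to a univariate polynomial of degree \<open>n\<close> on the points (t, 1,
  0).\<close>

lemma ex_zero_on_line:
  fixes p :: "'k::field pol3"
  assumes alg_closed: "\<And>p :: 'k poly. degree p \<ge> 1 \<Longrightarrow> \<exists>x. poly p x = 0"
    and p: "homog n p" "n \<ge> 1"
  shows "\<exists>x. (\<exists>i. x i \<noteq> 0) \<and> x 2 = 0 \<and> mp_eval p x = 0"
proof (cases "mp_eval p ((\<lambda>_. 0)(0 := 1)) = 0")
  case True
  thus ?thesis by (intro exI[of _ "(\<lambda>_. 0)(0 := 1)"]) auto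
next
  case False
  have "insert 0 {1, 2} = (UNIV :: 3 set)" using UNIV_3 by simp
  hence "p \<in> polys_in (insert 0 {1, 2})" by simp
  from homog_expand_in_variable[OF this p(1) False]
  obtain c g where g: "c \<noteq> 0" "\<And>i. g i \<in> polys_in {1, 2}"
    "Cst c * p = Var 0 ^ n - (\<Sum>i<n. g i * Var 0 ^ i)" by blast
  define y where "y = ((\<lambda>_. 0)(1 := 1) :: 3 \<Rightarrow> 'k)"
  define q where "q = monom 1 n - (\<Sum>i<n. monom (mp_eval (g i) y) i)"
  have "degree (\<Sum>i<n. monom (mp_eval (g i) y) i) < n"
    using p(2) by (intro degree_sum_less) (auto intro: le_less_trans[OF degree_monom_le])
  hence "coeff q n = 1" by (simp add: q_def coeff_eq_0)
  hence "degree q \<ge> 1" using p(2) le_degree[of q n] by auto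
  then obtain t where t: "poly q t = 0" using alg_closed by blast
  have "mp_eval (g i) (y(0 := t)) = mp_eval (g i) y" for i
    unfolding mp_eval_msub by (rule msub_cong_polys_in[OF g(2)]) auto
  hence "mp_eval (Cst c * p) (y(0 := t)) = poly q t"
    by (simp add: g(3) mp_eval_simps q_def poly_sum poly_monom)
  hence "mp_eval p (y(0 := t)) = 0" using t g(1) by (simp add: mp_eval_simps)
  thus ?thesis by (intro exI[of _ "y(0 := t)"]) (auto simp: y_def intro!: exI[of _ 1])
qed

lemma nest_polys_in:
  assumes "p \<in> polys_in {0, 1}"
  shows "\<exists>r. nest p = [:r:]"
proof -
  define h where "h = (\<lambda>c::'a. [:[:c:]:])"
  have h: "comm_ring_hom h" unfolding h_def by unfold_locales simp_all
  define s where "s = (\<lambda>v::3. if v = 0 then [:0, 1:] else [:[:0, 1::'a:]:])"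
  have "nest p = msub (\<lambda>c. [:h c:]) (\<lambda>v. [:s v:]) p"
    unfolding nest_def h_def by (rule msub_cong_polys_in[OF assms]) (auto simp: s_def)
  also have "\<dots> = [:msub h s p:]" by (rule hom_msub[OF comm_ring_hom_const_poly h, symmetric])
  finally show ?thesis by blast
qed

text \<open>Two relations \<open>x\<^sup>N \<equiv> bB\<close> and \<open>y\<^sup>N \<equiv> b'B\<close> modulo a form \<open>A\<close> monic in \<open>z\<close> are incompatible: as
  \<open>x\<^sup>N, y\<^sup>N\<close> is a regular sequence on the free \<open>k[x,y]\<close>-module \<open>k[x,y,z]/(A)\<close>, \<open>x\<^sup>N\<close> would divide \<open>b\<close>,
  making \<open>B\<close> invertible modulo \<open>A\<close>.\<close>

lemma common_zero_monic:
  fixes A B :: "'k::field pol3"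
  assumes alg_closed: "\<And>p :: 'k poly. degree p \<ge> 1 \<Longrightarrow> \<exists>x. poly p x = 0"
    and A: "homog a A" "a \<ge> 1" "mp_eval A ((\<lambda>_. 0)(2 := 1)) \<noteq> 0"
    and B: "homog b B" "b \<ge> 1"
    and cancel: "\<And>h. A dvd B * h \<Longrightarrow> A dvd h"
  shows "\<exists>x. (\<exists>i. x i \<noteq> 0) \<and> mp_eval A x = 0 \<and> mp_eval B x = 0"
proof (rule ccontr)
  assume nz: "\<not> ?thesis"
  interpret n: comm_ring_hom "nest :: 'k pol3 \<Rightarrow> _" by (rule comm_ring_hom_nest)
  have "\<exists>N. \<forall>m. mon_deg m \<ge> N \<longrightarrow>
      (\<exists>c. (\<forall>i\<in>UNIV. homog (mon_deg m - (if i then a else b)) (c i)) \<and>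
           single m (1::'k) = (\<Sum>i\<in>UNIV. c i * (if i then A else B)))"
  proof (rule projective_nullstellensatz[OF alg_closed])
    show "homog (if i then a else b) (if i then A else B)" for i using A B by auto
    show "\<forall>v. x v = 0" if "\<forall>i\<in>UNIV. mp_eval (if i then A else B) x = 0" for x
    proof -
      have "mp_eval A x = 0" "mp_eval B x = 0" using that[THEN bspec, of True] that[THEN bspec, of False] by auto
      thus ?thesis using nz by blast
    qed
  qed auto
  then obtain N where N: "\<And>m. mon_deg m \<ge> N \<Longrightarrow> \<exists>c. single m (1::'k) = (\<Sum>i\<in>UNIV. c i * (if i then A else B))"
    by blast
  have ex: "\<exists>s t. Var v ^ N = s * A + t * B" for v :: 3
  proof -
    obtain c where "single (single v N) (1::'k) = (\<Sum>i\<in>UNIV. c i * (if i then A else B))"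
      using N[of "single v N"] by auto
    hence "Var v ^ N = c True * A + c False * B"
      by (simp add: UNIV_bool Var_power)
    thus ?thesis by blast
  qed
  obtain s0 t0 where x: "Var 0 ^ N = s0 * A + t0 * B" using ex by blast
  obtain s1 t1 where y: "Var 1 ^ N = s1 * A + t1 * B" using ex by blast
  have "insert 2 {0, 1} = (UNIV :: 3 set)" unfolding UNIV_3 by auto
  hence "A \<in> polys_in (insert 2 {0, 1})" by simp
  from homog_expand_in_variable[OF this A(1,3)]
  obtain c g where g: "c \<noteq> 0" "\<And>i. g i \<in> polys_in {0, 1}"
    "Cst c * A = Var 2 ^ a - (\<Sum>i<a. g i * Var 2 ^ i)" by blast
  obtain r where r: "\<And>i. nest (g i) = [:r i:]" using nest_polys_in[OF g(2)] by metis
  define \<alpha> where "\<alpha> = nest (Cst c * A)"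
  have \<alpha>: "\<alpha> = monom 1 a - (\<Sum>i<a. monom (r i) i)"
    unfolding \<alpha>_def g(3)
    by (simp add: n.hom_minus n.hom_sum n.hom_mult n.hom_power r nest_Var2 monom_altdef)
  have "degree (\<Sum>i<a. monom (r i) i) < a"
    using A(2) by (intro degree_sum_less) (auto intro: le_less_trans[OF degree_monom_le])
  hence "coeff \<alpha> a = 1" and "degree \<alpha> \<le> a"
    unfolding \<alpha> by (auto simp: coeff_eq_0 intro!: degree_diff_le degree_monom_le)
  hence deg: "degree \<alpha> = a" and lc: "lead_coeff \<alpha> = 1" using le_degree[of \<alpha> a] by auto
  have \<alpha>0: "\<alpha> \<noteq> 0" using lc by auto
  have mod: "\<exists>q s. p = \<alpha> * q + s \<and> (s = 0 \<or> degree s < a)" for p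
  proof -
    obtain q s where qs: "pseudo_divmod p \<alpha> = (q, s)" by force
    show ?thesis using pseudo_divmod[OF \<alpha>0 qs] lc deg by auto
  qed
  have small: "s = 0" if "\<alpha> dvd s" "s = 0 \<or> degree s < a" for s
    using that dvd_imp_degree_le[of \<alpha> s] deg by (cases "s = 0") auto
  have A\<alpha>: "A dvd p \<longleftrightarrow> \<alpha> dvd nest p" for p
  proof -
    have "A dvd p \<longleftrightarrow> Cst c * A dvd p"
    proof
      assume "A dvd p"
      then obtain q where "p = A * q" unfolding dvd_def by blast
      hence "p = (Cst c * A) * (Cst (inverse c) * q)"
        using g(1) by (simp add: ac_simps flip: Cst_mult)
      thus "Cst c * A dvd p" by (metis dvd_triv_left)
    qed (metis dvd_mult_right)
    thus ?thesis by (simp add: \<alpha>_def nest_dvd_iff)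
  qed
  \<comment> \<open>Crosswise multiplication of the two relations removes the powers on the left;
    \<open>cancel\<close> then removes \<open>B\<close>.\<close>
  have "A dvd B * (t0 * Var 1 ^ N - t1 * Var 0 ^ N)"
  proof -
    have "B * (t0 * Var 1 ^ N - t1 * Var 0 ^ N) = A * (s1 * Var 0 ^ N - s0 * Var 1 ^ N)"
      by (simp add: x y algebra_simps)
    thus ?thesis by simp
  qed
  hence d1: "\<alpha> dvd nest (t0 * Var 1 ^ N - t1 * Var 0 ^ N)" using cancel A\<alpha> by blast
  define X Y where "X = monom (1::'k poly) N" and "Y = monom (1::'k) N"
  have nX: "nest (Var 0 ^ N) = [:X:]" and nY: "nest (Var 1 ^ N) = [:[:Y:]:]"
    by (simp_all add: n.hom_power nest_Var0 nest_Var1 X_def Y_def monom_altdef poly_const_pow)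
  obtain q0 \<beta>0 where \<beta>0: "nest t0 = \<alpha> * q0 + \<beta>0" "\<beta>0 = 0 \<or> degree \<beta>0 < a" using mod by blast
  obtain q1 \<beta>1 where \<beta>1: "nest t1 = \<alpha> * q1 + \<beta>1" "\<beta>1 = 0 \<or> degree \<beta>1 < a" using mod by blast
  have "\<beta>0 * [:[:Y:]:] - \<beta>1 * [:X:] = 0"
  proof (rule small)
    have "nest (t0 * Var 1 ^ N - t1 * Var 0 ^ N) =
        \<alpha> * (q0 * [:[:Y:]:] - q1 * [:X:]) + (\<beta>0 * [:[:Y:]:] - \<beta>1 * [:X:])"
      unfolding n.hom_minus n.hom_mult nX nY \<beta>0(1) \<beta>1(1) by (simp only: algebra_simps)
    hence "\<beta>0 * [:[:Y:]:] - \<beta>1 * [:X:] =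
       nest (t0 * Var 1 ^ N - t1 * Var 0 ^ N) - \<alpha> * (q0 * [:[:Y:]:] - q1 * [:X:])" by simp
    thus "\<alpha> dvd \<beta>0 * [:[:Y:]:] - \<beta>1 * [:X:]" using d1 by simp
    have "degree (\<beta>0 * [:[:Y:]:]) < a" "degree (\<beta>1 * [:X:]) < a"
      using \<beta>0(2) \<beta>1(2) A(2) degree_mult_le[of \<beta>0 "[:[:Y:]:]"] degree_mult_le[of \<beta>1 "[:X:]"] by auto
    thus "\<beta>0 * [:[:Y:]:] - \<beta>1 * [:X:] = 0 \<or> degree (\<beta>0 * [:[:Y:]:] - \<beta>1 * [:X:]) < a"
      using degree_diff_less by blast
  qed
  hence eq: "\<beta>0 * [:[:Y:]:] = \<beta>1 * [:X:]" by simp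
  \<comment> \<open>\<open>X\<close> is a power of x and \<open>Y\<close> involves only y: comparing
    the coefficients of x^k for k < N shows that those of \<open>\<beta>0\<close> vanish.\<close>
  have "[:X:] dvd \<beta>0"
    unfolding const_poly_dvd_iff X_def monom_1_dvd_iff'
  proof (intro allI impI)
    fix i k assume k: "k < N"
    have "coeff (coeff (\<beta>0 * [:[:Y:]:]) i) k = coeff (coeff (\<beta>1 * [:X:]) i) k" by (simp only: eq)
    hence "Y * coeff (coeff \<beta>0 i) k = coeff (X * coeff \<beta>1 i) k" by simp
    also have "\<dots> = 0" using k by (simp add: X_def coeff_monom_mult)
    finally show "coeff (coeff \<beta>0 i) k = 0" by (simp add: Y_def)
  qed
  then obtain \<gamma> where \<gamma>: "\<beta>0 = [:X:] * \<gamma>" unfolding dvd_def by blast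
  obtain q2 \<delta> where \<delta>: "1 - \<gamma> * nest B = \<alpha> * q2 + \<delta>" "\<delta> = 0 \<or> degree \<delta> < a" using mod by blast
  \<comment> \<open>\<delta> is the remainder of 1 - \<gamma> B. By the relation for x^N, its
    multiple by x^N is divisible by \<alpha>, while its degree in z is too small for that unless it
    is zero.\<close>
  have "[:X:] * \<delta> = 0"
  proof (rule small)
    have "[:X:] = nest s0 * nest A + (\<alpha> * q0 + \<beta>0) * nest B"
      unfolding nX[symmetric] x by (simp add: n.hom_add n.hom_mult \<beta>0(1))
    moreover have "\<alpha> dvd nest A" using A\<alpha>[of A] by simp
    moreover define C where "C = [:X:]"
    moreover have "C * \<delta> = C - \<beta>0 * nest B - \<alpha> * (C * q2)"
    proof -
      have \<delta>': "\<delta> = 1 - \<gamma> * nest B - \<alpha> * q2" using \<delta>(1) by simp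
      show ?thesis unfolding \<delta>' \<gamma> C_def[symmetric] by (simp add: algebra_simps)
    qed
    ultimately have "[:X:] * \<delta> = nest s0 * nest A + \<alpha> * (q0 * nest B - [:X:] * q2)"
      unfolding C_def[symmetric] by (simp add: algebra_simps)
    thus "\<alpha> dvd [:X:] * \<delta>" using \<open>\<alpha> dvd nest A\<close> by simp
    show "[:X:] * \<delta> = 0 \<or> degree ([:X:] * \<delta>) < a"
      using \<delta>(2) degree_mult_le[of "[:X:]" \<delta>] by auto
  qed
  hence "\<delta> = 0" by (simp add: X_def)
  hence "\<alpha> dvd 1 - \<gamma> * nest B" using \<delta>(1) by simp
  hence "\<alpha> dvd nest (1 - unnest \<gamma> * B)" by (simp add: n.hom_minus n.hom_mult n.hom_one nest_unnest)
  hence "A dvd 1 - unnest \<gamma> * B" by (simp add: A\<alpha>)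
  then obtain w where "1 - unnest \<gamma> * B = A * w" unfolding dvd_def by blast
  \<comment> \<open>Forms of positive degree vanish at the origin, so the identity would read 1 = 0
    there.\<close>
  hence "mp_eval (1 - unnest \<gamma> * B) (\<lambda>_. 0) = mp_eval (A * w) (\<lambda>_. 0)" by simp
  thus False using mp_eval_origin[OF A(1,2)] mp_eval_origin[OF B] by (simp add: mp_eval_simps)
qed

text \<open>Unless (0 : 0 : 1) is a common zero, one of the two forms is monic in z up to a scalar.
  The cancellation property is available on either side, since a prime \<open>P\<close> not dividing
  \<open>B\<close> is coprime to it.\<close>

lemma common_zero_prime:
  fixes P B :: "'k::field pol3"
  assumes alg_closed: "\<And>p :: 'k poly. degree p \<ge> 1 \<Longrightarrow> \<exists>x. poly p x = 0"
    and P: "homog a P" "a \<ge> 1" "prime_elem P"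
    and B: "homog b B" "b \<ge> 1"
  shows "\<exists>x. (\<exists>i. x i \<noteq> 0) \<and> mp_eval P x = 0 \<and> mp_eval B x = 0"
proof (cases "P dvd B")
  case True
  obtain x where "\<exists>i. x i \<noteq> 0" "mp_eval P x = 0" using ex_zero_on_line[OF alg_closed P(1,2)] by blast
  thus ?thesis using True by (intro exI[of _ x]) (auto simp: dvd_def mp_eval_mult)
next
  case False
  have P0: "P \<noteq> 0" using P(3) by (auto simp: prime_elem_def)
  let ?e = "(\<lambda>_. 0)(2 := 1) :: 3 \<Rightarrow> 'k"
  consider "mp_eval P ?e = 0" "mp_eval B ?e = 0" | "mp_eval P ?e \<noteq> 0" | "mp_eval B ?e \<noteq> 0" by blast
  thus ?thesis
  proof cases
    case 1 thus ?thesis by (intro exI[of _ ?e]) (auto intro!: exI[of _ 2])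
  next
    case 2
    show ?thesis
    proof (rule common_zero_monic[OF alg_closed P(1,2) 2 B])
      show "P dvd h" if "P dvd B * h" for h using that P(3) False by (simp add: prime_elem_dvd_mult_iff)
    qed
  next
    case 3
    have "B dvd h" if Bh: "B dvd P * h" for h
    proof -
      obtain e where e: "P * h = B * e" using Bh unfolding dvd_def by blast
      hence "P dvd B * e" by (metis dvd_triv_left)
      hence "P dvd e" using P(3) False by (simp add: prime_elem_dvd_mult_iff)
      then obtain e' where "e = P * e'" unfolding dvd_def by blast
      hence "P * h = P * (B * e')" using e by (simp add: ac_simps)
      hence "h = B * e'" using P0 by simp
      thus ?thesis by simp
    qed
    from common_zero_monic[OF alg_closed B 3 P(1,2) this] show ?thesis by blast
  qed
qed

definition smooth_form :: "'k::comm_ring_1 pol3 \<Rightarrow> bool" where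
  "smooth_form J \<longleftrightarrow> (\<forall>x. (\<exists>i. x i \<noteq> 0) \<longrightarrow> mp_eval J x = 0 \<longrightarrow> (\<exists>j. mp_eval (mp_pderiv j J) x \<noteq> 0))"

text \<open>A prime factor and a nonconstant cofactor would meet, and by the product rule all
  derivatives of \<open>J\<close> vanish at a common zero. So the cofactor is a unit.\<close>

lemma smooth_form_prime:
  fixes J :: "'k::field pol3"
  assumes alg_closed: "\<And>p :: 'k poly. degree p \<ge> 1 \<Longrightarrow> \<exists>x. poly p x = 0"
    and J: "homog e J" "e \<ge> 1" "smooth_form J"
  shows "prime_elem J"
proof -
  have J0: "J \<noteq> 0"
  proof
    assume "J = 0"
    thus False using J(3)[unfolded smooth_form_def, rule_format, of "\<lambda>_. 1"] by simp
  qed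
  have J1: "\<not> J dvd 1"
  proof
    assume "J dvd 1"
    then obtain q where "1 = J * q" unfolding dvd_def by blast
    hence "mp_eval 1 (\<lambda>_. 0) = mp_eval (J * q) (\<lambda>_. 0)" by simp
    thus False using mp_eval_origin[OF J(1,2)] by (simp add: mp_eval_mult)
  qed
  from ex_prime_factor[OF J0 J1] obtain P where "prime_elem P \<and> P dvd J" ..
  hence P: "prime_elem P" "P dvd J" by (rule conjunct1, rule conjunct2)
  from P(2) obtain B where B: "J = P * B" unfolding dvd_def by blast
  have nz: "P \<noteq> 0" "B \<noteq> 0" using B J0 by auto
  obtain a where a: "homog a P" using homog_factor_left[of e P B] J(1) J0 B by auto
  obtain b where b: "homog b B" using homog_factor_left[of e B P] J(1) J0 B by (auto simp: mult.commute)
  have unit: "p dvd 1" if "homog 0 p" "p \<noteq> 0" for p :: "'k pol3"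
  proof -
    define c where "c = lookup p 0"
    have c: "p = Cst c" unfolding c_def by (rule homog_0_eq_Cst[OF that(1)])
    hence "c \<noteq> 0" using that by auto
    hence "1 = p * Cst (inverse c)" by (simp add: c flip: Cst_mult)
    thus ?thesis by (metis dvd_triv_left)
  qed
  have a1: "a \<ge> 1"
  proof (rule ccontr)
    assume "\<not> a \<ge> 1"
    hence "P dvd 1" using a unit[of P] nz by (cases a) auto
    thus False using P by (auto simp: prime_elem_def)
  qed
  have "b = 0"
  proof (rule ccontr)
    assume "b \<noteq> 0"
    hence "b \<ge> 1" by simp
    from common_zero_prime[OF alg_closed a a1 P(1) b this] obtain x where
      x: "\<exists>i. x i \<noteq> 0" "mp_eval P x = 0" "mp_eval B x = 0" by blast
    hence "mp_eval J x = 0" "\<And>j. mp_eval (mp_pderiv j J) x = 0"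
      by (simp_all add: B mp_pderiv_mult mp_eval_simps)
    thus False using J(3) x(1) unfolding smooth_form_def by blast
  qed
  hence "B dvd 1" using unit[of B] b nz by simp
  then obtain u where u: "1 = B * u" unfolding dvd_def by blast
  have PJ: "P dvd t \<longleftrightarrow> J dvd t" for t
  proof
    assume "P dvd t"
    then obtain s where "t = P * s" unfolding dvd_def by blast
    hence "t = J * (u * s)" using u by (simp add: B ac_simps)
    thus "J dvd t" by simp
  qed (use B in \<open>metis dvd_mult_left\<close>)
  show ?thesis
  proof (rule prime_elemI)
    show "J dvd s \<or> J dvd t" if "J dvd s * t" for s t
      using that P(1) unfolding PJ[symmetric] by (simp add: prime_elem_dvd_mult_iff)
  qed (fact J0 J1)+
qed

text \<open>In characteristic zero a vanishing derivative means that z does not occur in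
  \<open>J\<close>; the curve is then a cone with vertex (0 : 0 : 1), singular there in degree at
  least 2. This is what gives \<open>J\<close> positive degree in z, as elimination
  requires.\<close>

lemma smooth_form_pderiv2_nonzero:
  fixes J :: "'k::field_char_0 pol3"
  assumes J: "homog e J" "e \<ge> 2" "smooth_form J"
  shows "mp_pderiv 2 J \<noteq> 0"
proof
  assume 0: "mp_pderiv 2 J = 0"
  have z: "lookup J (m + single 2 1) = 0" for m
    using lookup_mp_pderiv[of 2 J m] by (simp add: 0 del: of_nat_Suc)
  let ?e = "(\<lambda>_. 0)(2 := 1) :: 3 \<Rightarrow> 'k"
  have "single 2 e = single 2 (e - 1) + single (2::3) 1" using J(2) by (simp flip: single_add)
  hence "mp_eval J ?e = 0" using mp_eval_axis[OF J(1)] z by metis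
  moreover have "mp_eval (mp_pderiv j J) ?e = 0" for j
  proof -
    have "mp_eval (mp_pderiv j J) ?e = lookup (mp_pderiv j J) (single 2 (e - 1))"
      by (rule mp_eval_axis[OF homog_mp_pderiv[OF J(1)]])
    moreover have "e - 1 = e - 2 + 1" using J(2) by simp
    hence "single 2 (e - 1) = single 2 (e - 2) + single (2::3) 1" by (metis single_add)
    hence "single 2 (e - 1) + single j 1 = (single 2 (e - 2) + single j 1) + single 2 1"
      by (simp add: ac_simps)
    ultimately show ?thesis using z by (simp add: lookup_mp_pderiv)
  qed
  moreover have "\<exists>i. ?e i \<noteq> 0" by (intro exI[of _ 2]) simp
  ultimately show False using J(3) unfolding smooth_form_def by blast
qed

text \<open>The passage from pointwise statements about the curve to congruences modulo
  \<open>J\<close>.\<close>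

lemma smooth_form_dvd:
  fixes J h :: "'k::field_char_0 pol3"
  assumes alg_closed: "\<And>p :: 'k poly. degree p \<ge> 1 \<Longrightarrow> \<exists>x. poly p x = 0"
    and J: "homog e J" "e \<ge> 2" "smooth_form J"
    and van: "\<And>x. \<exists>i. x i \<noteq> 0 \<Longrightarrow> mp_eval J x = 0 \<Longrightarrow> mp_eval h x = 0"
  shows "J dvd h"
proof (rule prime_nullstellensatz[OF alg_closed])
  show "prime_elem J" using J(2) by (intro smooth_form_prime[OF alg_closed J(1) _ J(3)]) simp_all
  show "mp_pderiv 2 J \<noteq> 0" by (rule smooth_form_pderiv2_nonzero[OF J])
  show "mp_eval h x = 0" if "\<exists>i. x i \<noteq> 0" "mp_eval J x = 0" for x using that by (rule van)
qed


section \<open>Irreducibility and openness\<close>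

lemma smooth_crit_iff: "smooth_crit f \<longleftrightarrow> smooth_form (jac f)"
  by (auto simp: smooth_crit_def smooth_form_def crit_def)

lemma homog_det3:
  assumes "\<And>i j. homog n (M i j)"
  shows "homog (3 * n) (det3 M)"
proof -
  have "homog (n + n + n) (M i j * M k l * M r s)" for i j k l r s
    by (intro homog_mult assms)
  moreover have "n + n + n = 3 * n" by simp
  ultimately have "homog (3 * n) (M i j * M k l * M r s)" for i j k l r s by metis
  thus ?thesis unfolding det3_def by (intro homog_add homog_diff)
qed

lemma homog_jac: "(\<And>i. homog d (f i)) \<Longrightarrow> homog (3 * (d - 1)) (jac f)"
  unfolding jac_def by (intro homog_det3 homog_mp_pderiv)

lemma irreducible_crit:
  fixes f :: "'k::field_char_0 endo"
  assumes alg_closed: "\<And>p :: 'k poly. degree p \<ge> 1 \<Longrightarrow> \<exists>x. poly p x = 0"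
    and J: "homog e (jac f)" "e \<ge> 2" "smooth_form (jac f)"
  shows "irreducible_P2 (crit f)"
  unfolding irreducible_P2_def
proof (intro allI impI)
  fix A B assume AB: "zclosed_P2 A" "zclosed_P2 B" "crit f \<subseteq> A \<union> B"
  have prime: "prime_elem (jac f)"
    using J(2) by (intro smooth_form_prime[OF alg_closed J(1) _ J(3)]) simp_all
  obtain P where P: "A = {x. (\<exists>i. x i \<noteq> 0) \<and> (\<forall>p\<in>P. mp_eval p x = 0)}"
    using AB(1) unfolding zclosed_P2_def by blast
  obtain Q where Q: "B = {x. (\<exists>i. x i \<noteq> 0) \<and> (\<forall>p\<in>Q. mp_eval p x = 0)}"
    using AB(2) unfolding zclosed_P2_def by blast
  show "crit f \<subseteq> A \<or> crit f \<subseteq> B"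
  proof (rule ccontr)
    assume "\<not> (crit f \<subseteq> A \<or> crit f \<subseteq> B)"
    then obtain x y where xy: "x \<in> crit f" "x \<notin> A" "y \<in> crit f" "y \<notin> B" by blast
    obtain p where p: "p \<in> P" "mp_eval p x \<noteq> 0" using xy(1,2) unfolding P crit_def by blast
    obtain q where q: "q \<in> Q" "mp_eval q y \<noteq> 0" using xy(3,4) unfolding Q crit_def by blast
    have "jac f dvd p * q"
    proof (rule smooth_form_dvd[OF alg_closed J])
      fix z :: "3 \<Rightarrow> 'k" assume "\<exists>i. z i \<noteq> 0" "mp_eval (jac f) z = 0"
      hence "z \<in> crit f" by (simp add: crit_def)
      hence "z \<in> A \<union> B" using AB(3) by blast
      hence "mp_eval p z = 0 \<or> mp_eval q z = 0" using p(1) q(1) unfolding P Q by blast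
      thus "mp_eval (p * q) z = 0" by (auto simp: mp_eval_mult)
    qed
    hence "jac f dvd p \<or> jac f dvd q" using prime by (simp add: prime_elem_dvd_mult_iff)
    thus False
    proof
      assume "jac f dvd p"
      then obtain s where "p = jac f * s" unfolding dvd_def by blast
      thus False using p(2) xy(1) by (simp add: mp_eval_mult crit_def)
    next
      assume "jac f dvd q"
      then obtain s where "q = jac f * s" unfolding dvd_def by blast
      thus False using q(2) xy(3) by (simp add: mp_eval_mult crit_def)
    qed
  qed
qed

lemma Ed_eq_smooth:
  assumes alg_closed: "\<And>p :: 'k::field_char_0 poly. degree p \<ge> 1 \<Longrightarrow> \<exists>x. poly p x = 0"
    and d: "d \<ge> 2"
  shows "Ed d = {f \<in> End2 d. smooth_form (jac f :: 'k pol3)}"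
proof -
  have "irreducible_P2 (crit f)" if f: "f \<in> End2 d" "smooth_form (jac f)" for f :: "'k endo"
  proof (rule irreducible_crit[OF alg_closed])
    show "homog (3 * (d - 1)) (jac f)" using f(1) by (intro homog_jac) (simp add: End2_def)
    show "3 * (d - 1) \<ge> 2" using d by simp
  qed (use f in auto)
  thus ?thesis unfolding Ed_def smooth_crit_iff by blast
qed

section \<open>Polynomial dependence on the coefficients of a map\<close>

lemma finite_mon_le: "finite {a :: 'v::finite \<Rightarrow>\<^sub>0 nat. \<forall>v. lookup a v \<le> e v}"
proof (rule finite_imageD)
  show "inj_on lookup {a :: 'v \<Rightarrow>\<^sub>0 nat. \<forall>v. lookup a v \<le> e v}"
    by (auto intro!: inj_onI poly_mapping_eqI)
  have "lookup ` {a :: 'v \<Rightarrow>\<^sub>0 nat. \<forall>v. lookup a v \<le> e v} \<subseteq> PiE UNIV (\<lambda>v. {..e v})" by auto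
  moreover have "finite (PiE UNIV (\<lambda>v. {..e v}))" by (intro finite_PiE) auto
  ultimately show "finite (lookup ` {a :: 'v \<Rightarrow>\<^sub>0 nat. \<forall>v. lookup a v \<le> e v})" by (rule finite_subset)
qed

lemma lookup_le_mon_deg: "lookup m v \<le> mon_deg m"
  by (cases "v \<in> keys m") (auto simp: mon_deg_def in_keys_iff intro!: member_le_sum)

lemma finite_mon_deg: "finite {m :: 'v::finite \<Rightarrow>\<^sub>0 nat. mon_deg m = n}"
  by (rule finite_subset[OF _ finite_mon_le[of "\<lambda>_. n"]]) (auto simp: lookup_le_mon_deg)

text \<open>The index set depends on \<open>m\<close> only and not on the supports of the factors,
  so this is a fixed polynomial expression in their coefficients.\<close>

lemma lookup_mult_le:
  fixes p q :: "('v::finite, 'k::comm_ring_1) mpol"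
  shows "lookup (p * q) m = (\<Sum>a\<in>{a. \<forall>v. lookup a v \<le> lookup m v}. lookup p a * lookup q (m - a))"
proof -
  let ?D = "{a. \<forall>v. lookup a v \<le> lookup m v}"
  have iff: "a + b = m \<longleftrightarrow> a \<in> ?D \<and> b = m - a" for a b
  proof
    assume "a + b = m" thus "a \<in> ?D \<and> b = m - a" by (auto simp: lookup_add)
  next
    assume "a \<in> ?D \<and> b = m - a"
    thus "a + b = m" by (intro poly_mapping_eqI) (auto simp: lookup_add lookup_minus)
  qed
  have "lookup (p * q) m = (\<Sum>a\<in>keys p. \<Sum>b\<in>keys q. if b = m - a then (if a \<in> ?D then lookup p a * lookup q b else 0) else 0)"
    unfolding mult_sum_singles[of p q] lookup_sum
    by (intro sum.cong refl) (simp add: lookup_single when_def iff)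
  also have "\<dots> = (\<Sum>a\<in>keys p. if a \<in> ?D then lookup p a * lookup q (m - a) else 0)"
    by (intro sum.cong) (auto simp: sum.delta in_keys_iff)
  also have "\<dots> = (\<Sum>a\<in>keys p \<inter> ?D. lookup p a * lookup q (m - a))"
    by (simp add: sum.If_cases Int_def)
  also have "\<dots> = (\<Sum>a\<in>?D. lookup p a * lookup q (m - a))"
    using finite_mon_le by (intro sum.mono_neutral_left) (auto simp: in_keys_iff)
  finally show ?thesis .
qed

text \<open>The degree \<open>n\<close> is recorded because closed sets of maps are cut out by
  homogeneous polynomials. Agreement is asked on \<open>End2 d\<close> only, so that coefficients at
  monomials of another degree count as zero.\<close>

definition coeff_fun :: "nat \<Rightarrow> nat \<Rightarrow> ('k::comm_ring_1 endo \<Rightarrow> 'k) \<Rightarrow> bool" where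
  "coeff_fun d n q \<longleftrightarrow> (\<exists>p. homog n p \<and> p \<in> polys_in {(i, m). mon_deg m = d} \<and>
     (\<forall>f\<in>End2 d. mp_eval p (coord f) = q f))"

lemma coeff_fun_0: "coeff_fun d n (\<lambda>_. 0)"
  unfolding coeff_fun_def by (intro exI[of _ 0]) simp

lemma coeff_fun_add:
  assumes "coeff_fun d n q" "coeff_fun d n r" shows "coeff_fun d n (\<lambda>f. q f + r f)"
proof -
  obtain a b where "homog n a" "a \<in> polys_in {(i, m). mon_deg m = d}" "\<forall>f\<in>End2 d. mp_eval a (coord f) = q f"
    "homog n b" "b \<in> polys_in {(i, m). mon_deg m = d}" "\<forall>f\<in>End2 d. mp_eval b (coord f) = r f"
    using assms unfolding coeff_fun_def by metis
  thus ?thesis unfolding coeff_fun_def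
    by (intro exI[of _ "a + b"]) (auto simp: mp_eval_add intro: homog_add polys_in_add)
qed

lemma coeff_fun_mult:
  assumes "coeff_fun d n q" "coeff_fun d k r" shows "coeff_fun d (n + k) (\<lambda>f. q f * r f)"
proof -
  obtain a b where "homog n a" "a \<in> polys_in {(i, m). mon_deg m = d}" "\<forall>f\<in>End2 d. mp_eval a (coord f) = q f"
    "homog k b" "b \<in> polys_in {(i, m). mon_deg m = d}" "\<forall>f\<in>End2 d. mp_eval b (coord f) = r f"
    using assms unfolding coeff_fun_def by metis
  thus ?thesis unfolding coeff_fun_def
    by (intro exI[of _ "a * b"]) (auto simp: mp_eval_mult intro: homog_mult polys_in_mult)
qed

lemma coeff_fun_const: "coeff_fun d 0 (\<lambda>_. c)"
  unfolding coeff_fun_def by (intro exI[of _ "Cst c"]) (auto simp: homog_Cst polys_in_Cst)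

lemma coeff_fun_cmult: "coeff_fun d n q \<Longrightarrow> coeff_fun d n (\<lambda>f. c * q f)"
  using coeff_fun_mult[OF coeff_fun_const] by fastforce

lemma coeff_fun_diff:
  "coeff_fun d n q \<Longrightarrow> coeff_fun d n r \<Longrightarrow> coeff_fun d n (\<lambda>f. q f - r f)"
  using coeff_fun_add[of d n q "\<lambda>f. (-1) * r f"] coeff_fun_cmult[of d n r "-1"] by simp

lemma coeff_fun_sum:
  "(\<And>i. i \<in> A \<Longrightarrow> coeff_fun d n (q i)) \<Longrightarrow> coeff_fun d n (\<lambda>f. \<Sum>i\<in>A. q i f)"
  by (induction A rule: infinite_finite_induct) (auto intro: coeff_fun_0 coeff_fun_add)

lemma coeff_fun_prod:
  "finite A \<Longrightarrow> (\<And>i. i \<in> A \<Longrightarrow> coeff_fun d n (q i)) \<Longrightarrow> coeff_fun d (n * card A) (\<lambda>f. \<Prod>i\<in>A. q i f)"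
proof (induction A rule: finite_induct)
  case empty show ?case by (simp add: coeff_fun_const)
next
  case (insert x A)
  thus ?case using coeff_fun_mult[of d n "q x" "n * card A" "\<lambda>f. \<Prod>i\<in>A. q i f"] by simp
qed

lemma coeff_fun_lookup: "coeff_fun d 1 (\<lambda>f. lookup (f i) m)"
proof (cases "mon_deg m = d")
  case True
  thus ?thesis unfolding coeff_fun_def
    by (intro exI[of _ "Var (i, m)"]) (auto simp: homog_Var[simplified] coord_def intro: polys_in_Var)
next
  case False
  hence "\<forall>f\<in>End2 d. lookup (f i) m = 0" by (auto simp: End2_def homog_def in_keys_iff)
  thus ?thesis unfolding coeff_fun_def by (intro exI[of _ 0]) simp
qed

definition coeffs_fun :: "nat \<Rightarrow> nat \<Rightarrow> ('k::comm_ring_1 endo \<Rightarrow> 'k pol3) \<Rightarrow> bool" where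
  "coeffs_fun d n F \<longleftrightarrow> (\<forall>m. coeff_fun d n (\<lambda>f. lookup (F f) m))"

lemma coeffs_fun_add: "coeffs_fun d n F \<Longrightarrow> coeffs_fun d n G \<Longrightarrow> coeffs_fun d n (\<lambda>f. F f + G f)"
  by (simp add: coeffs_fun_def lookup_add coeff_fun_add)

lemma coeffs_fun_diff: "coeffs_fun d n F \<Longrightarrow> coeffs_fun d n G \<Longrightarrow> coeffs_fun d n (\<lambda>f. F f - G f)"
  by (simp add: coeffs_fun_def lookup_minus coeff_fun_diff)

lemma coeffs_fun_mult: "coeffs_fun d n F \<Longrightarrow> coeffs_fun d k G \<Longrightarrow> coeffs_fun d (n + k) (\<lambda>f. F f * G f)"
  by (simp add: coeffs_fun_def lookup_mult_le coeff_fun_sum coeff_fun_mult)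

lemma coeffs_fun_cmult: "coeffs_fun d n F \<Longrightarrow> coeffs_fun d n (\<lambda>f. c * F f)"
  by (simp add: coeffs_fun_def lookup_mult_le coeff_fun_sum coeff_fun_cmult)

lemma coeffs_fun_sum: "(\<And>i. i \<in> A \<Longrightarrow> coeffs_fun d n (F i)) \<Longrightarrow> coeffs_fun d n (\<lambda>f. \<Sum>i\<in>A. F i f)"
  by (simp add: coeffs_fun_def lookup_sum coeff_fun_sum)

lemma coeffs_fun_mp_pderiv: "coeffs_fun d n F \<Longrightarrow> coeffs_fun d n (\<lambda>f. mp_pderiv j (F f))"
  by (simp add: coeffs_fun_def lookup_mp_pderiv coeff_fun_cmult del: of_nat_Suc of_nat_add)

lemma coeffs_fun_component: "coeffs_fun d 1 (\<lambda>f. f i)"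
  by (simp add: coeffs_fun_def coeff_fun_lookup[simplified])

lemma coeffs_fun_jac: "coeffs_fun d 3 jac"
proof -
  have e: "coeffs_fun d 1 (\<lambda>f. mp_pderiv j (f i))" for i j
    by (intro coeffs_fun_mp_pderiv coeffs_fun_component)
  have "coeffs_fun d (1 + 1 + 1) (\<lambda>f. mp_pderiv j (f i) * mp_pderiv l (f k) * mp_pderiv s (f r))" for i j k l r s
    by (intro coeffs_fun_mult e)
  hence "coeffs_fun d 3 (\<lambda>f. mp_pderiv j (f i) * mp_pderiv l (f k) * mp_pderiv s (f r))" for i j k l r s
    by (simp add: numeral_3_eq_3)
  hence "coeffs_fun d 3 (\<lambda>f. jac f)"
    unfolding jac_def det3_def by (intro coeffs_fun_add coeffs_fun_diff)
  thus ?thesis by simp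
qed

lemma coeff_fun_det:
  assumes "\<And>i j. i < n \<Longrightarrow> j < n \<Longrightarrow> coeff_fun d k (\<lambda>f. B f i j)"
  shows "coeff_fun d (k * n) (\<lambda>f. det (mat n n (\<lambda>(i, j). B f i j)))"
proof -
  have eq: "det (mat n n (\<lambda>(i, j). B f i j)) =
     (\<Sum>p\<in>{p. p permutes {0..<n}}. signof p * (\<Prod>i\<in>{0..<n}. B f i (p i)))" for f
  proof -
    have "(\<Prod>i = 0..<n. mat n n (\<lambda>(i, j). B f i j) $$ (i, p i)) = (\<Prod>i\<in>{0..<n}. B f i (p i))"
      if "p permutes {0..<n}" for p
      using permutes_in_image[OF that] by (intro prod.cong) auto
    thus ?thesis by (simp add: det_def)
  qed
  have "coeff_fun d (k * card {0..<n}) (\<lambda>f. \<Prod>i\<in>{0..<n}. B f i (p i))" if "p permutes {0..<n}" for p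
    using permutes_in_image[OF that] by (intro coeff_fun_prod assms) auto
  thus ?thesis unfolding eq by (intro coeff_fun_sum coeff_fun_cmult) simp
qed

lemma mp_eval_homog_list:
  assumes "homog n p" "distinct ms" "set ms = {m. mon_deg m = n}"
  shows "mp_eval p x = (\<Sum>b<length ms. lookup p (ms ! b) * mon_eval x (ms ! b))"
proof -
  have "mp_eval p x = (\<Sum>m\<in>set ms. lookup p m * mon_eval x m)"
    unfolding mp_eval_msub
    by (subst msub_superset[OF comm_ring_hom_id, of "set ms"])
      (use assms(1) in \<open>auto simp: homog_def assms(3)[THEN eqset_imp_iff]\<close>)
  also have "\<dots> = (\<Sum>b<length ms. lookup p (ms ! b) * mon_eval x (ms ! b))"
    using bij_betw_nth[OF assms(2) refl refl] by (intro sum.reindex_bij_betw[symmetric])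
  finally show ?thesis .
qed

lemma monomial_vec_nonzero:
  fixes x :: "'v \<Rightarrow> 'k::field"
  assumes "\<exists>i. x i \<noteq> 0" "set ms = {m. mon_deg m = n}"
  shows "vec (length ms) (\<lambda>b. mon_eval x (ms ! b)) \<noteq> 0\<^sub>v (length ms)"
proof
  assume v: "vec (length ms) (\<lambda>b. mon_eval x (ms ! b)) = 0\<^sub>v (length ms)"
  obtain i where i: "x i \<noteq> 0" using assms(1) by blast
  obtain b where b: "b < length ms" "ms ! b = single i n" using assms(2) in_set_conv_nth[of "single i n" ms] by auto
  have "mon_eval x (ms ! b) = 0" using arg_cong[OF v, of "\<lambda>v. v $ b"] b(1) by simp
  thus False using b(2) i by simp
qed

lemma gradient_zero_imp_zero:
  fixes J :: "'k::field_char_0 pol3"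
  assumes "homog e J" "e \<ge> 1" "\<And>j. mp_eval (mp_pderiv j J) x = 0"
  shows "mp_eval J x = 0"
proof -
  have "mp_eval (\<Sum>j\<in>UNIV. Var j * mp_pderiv j J) x = 0" by (simp add: mp_eval_simps assms)
  hence "of_nat e * mp_eval J x = 0" by (simp add: Euler_homog[OF assms(1)] mp_eval_simps)
  thus ?thesis using assms(2) by simp
qed

text \<open>The polynomial \<open>det (\<Phi>\<^sub>f \<circ> T)\<close> separates a smooth \<open>f\<^sub>0\<close> from the singular maps. Here
  \<open>\<Phi>\<^sub>f (c) = \<Sum>\<^sub>j c\<^sub>j \<partial>\<^sub>jJ\<^sub>f\<close> and \<open>T\<close> is a section of \<open>\<Phi>\<^bsub>f\<^sub>0\<^esub>\<close> in a degree where the Nullstellensatz makes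
  \<open>\<Phi>\<^bsub>f\<^sub>0\<^esub>\<close> surjective; at a singular point \<open>x\<close> of \<open>J\<^sub>f\<close> the vector of monomials in \<open>x\<close> lies in the kernel.\<close>

lemma separating_coord_poly:
  fixes f0 :: "'k::field_char_0 endo"
  assumes alg_closed: "\<And>p :: 'k poly. degree p \<ge> 1 \<Longrightarrow> \<exists>x. poly p x = 0"
    and d: "d \<ge> 2" and f0: "f0 \<in> End2 d" "smooth_form (jac f0)"
  shows "\<exists>p. coord_poly d p \<and> mp_eval p (coord f0) \<noteq> 0 \<and>
     (\<forall>f\<in>End2 d. \<not> smooth_form (jac f) \<longrightarrow> mp_eval p (coord f) = 0)"
proof -
  define e where "e = 3 * (d - 1)"
  have e: "e \<ge> 2" using d by (simp add: e_def)
  have hJ: "homog e (jac f)" if "f \<in> End2 d" for f :: "'k endo"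
    using that unfolding e_def by (intro homog_jac) (simp add: End2_def)
  have "\<exists>N. \<forall>m. mon_deg m \<ge> N \<longrightarrow> (\<exists>c. (\<forall>j\<in>UNIV. homog (mon_deg m - (e - 1)) (c j)) \<and>
           single m 1 = (\<Sum>j\<in>UNIV. c j * mp_pderiv j (jac f0)))"
  proof (rule projective_nullstellensatz[OF alg_closed])
    show "homog (e - 1) (mp_pderiv j (jac f0))" for j by (intro homog_mp_pderiv hJ f0)
    show "\<forall>v. x v = 0" if "\<forall>j\<in>UNIV. mp_eval (mp_pderiv j (jac f0)) x = 0" for x
    proof -
      have "mp_eval (jac f0) x = 0" using e that by (intro gradient_zero_imp_zero[OF hJ[OF f0(1)]]) auto
      thus ?thesis using f0(2) that unfolding smooth_form_def by blast
    qed
  qed auto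
  then obtain N where N: "\<And>m. mon_deg m \<ge> N \<Longrightarrow> \<exists>c. (\<forall>j\<in>UNIV. homog (mon_deg m - (e - 1)) (c j)) \<and>
           single m 1 = (\<Sum>j\<in>UNIV. c j * mp_pderiv j (jac f0))" by blast
  \<comment> \<open>At least \<open>e - 1\<close>, so that a coefficient of degree
    \<open>n - (e - 1)\<close> times a partial derivative has degree \<open>n\<close> despite
    truncated subtraction.\<close>
  define n where "n = max N (e - 1)"
  have "\<exists>c. \<forall>m. mon_deg m = n \<longrightarrow> (\<forall>j. homog (n - (e - 1)) (c m j)) \<and>
     single m 1 = (\<Sum>j\<in>UNIV. c m j * mp_pderiv j (jac f0))"
  proof (rule choice, intro allI)
    fix m :: "3 \<Rightarrow>\<^sub>0 nat"
    show "\<exists>y. mon_deg m = n \<longrightarrow> (\<forall>j. homog (n - (e - 1)) (y j)) \<and>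
       single m 1 = (\<Sum>j\<in>UNIV. y j * mp_pderiv j (jac f0))"
    proof (cases "mon_deg m = n")
      case True
      hence "mon_deg m \<ge> N" by (simp add: n_def)
      from N[OF this] show ?thesis unfolding True by blast
    qed simp
  qed
  then obtain c where ch: "\<And>m j. mon_deg m = n \<Longrightarrow> homog (n - (e - 1)) (c m j)"
    and c1: "\<And>m. mon_deg m = n \<Longrightarrow> single m 1 = (\<Sum>j\<in>UNIV. c m j * mp_pderiv j (jac f0))" by blast
  obtain ms :: "(3 \<Rightarrow>\<^sub>0 nat) list" where ms: "set ms = {m. mon_deg m = n}" "distinct ms"
    using finite_distinct_list[OF finite_mon_deg] by blast
  define l where "l = length ms"
  have deg: "mon_deg (ms ! a) = n" if "a < l" for a using that ms(1) nth_mem unfolding l_def by blast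
  \<comment> \<open>The coefficients \<open>c\<close> are computed from \<open>f0\<close> and stay
    fixed while \<open>f\<close> varies. Thus \<open>F f a\<close> is cubic in the coefficients of
    \<open>f\<close>, and \<open>B f0\<close> is the identity.\<close>
  define F where "F f a = (\<Sum>j\<in>UNIV. c (ms ! a) j * mp_pderiv j (jac f))" for f a
  define B where "B f = mat l l (\<lambda>(a, b). lookup (F f a) (ms ! b))" for f
  have Bdim: "B f \<in> carrier_mat l l" for f by (simp add: B_def)
  have "coeffs_fun d 3 (\<lambda>f. F f a)" for a
    unfolding F_def by (intro coeffs_fun_sum coeffs_fun_cmult coeffs_fun_mp_pderiv coeffs_fun_jac)
  hence "coeff_fun d (3 * l) (\<lambda>f. det (B f))"
    unfolding B_def by (intro coeff_fun_det) (simp add: coeffs_fun_def)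
  then obtain p where p: "homog (3 * l) p" "p \<in> polys_in {(i, m). mon_deg m = d}"
    "\<And>f. f \<in> End2 d \<Longrightarrow> mp_eval p (coord f) = det (B f)" unfolding coeff_fun_def by blast
  have "coord_poly d p" using p(1,2) by (auto simp: coord_poly_def is_homog_def polys_in_def)
  moreover have "mp_eval p (coord f0) \<noteq> 0"
  proof -
    have "B f0 = 1\<^sub>m l"
    proof (rule eq_matI)
      fix a b assume ab: "a < dim_row (1\<^sub>m l)" "b < dim_col (1\<^sub>m l)"
      hence "F f0 a = single (ms ! a) 1" unfolding F_def using c1[OF deg] by simp
      thus "B f0 $$ (a, b) = 1\<^sub>m l $$ (a, b)"
        using ab nth_eq_iff_index_eq[OF ms(2)] by (auto simp: B_def lookup_single when_def l_def)
    qed (auto simp: B_def)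
    thus ?thesis using p(3)[OF f0(1)] by simp
  qed
  moreover have "mp_eval p (coord f) = 0" if f: "f \<in> End2 d" "\<not> smooth_form (jac f)" for f
  proof -
    obtain x where x: "\<exists>i. x i \<noteq> 0" "\<And>j. mp_eval (mp_pderiv j (jac f)) x = 0"
      using f(2) unfolding smooth_form_def by blast
    define v where "v = vec l (\<lambda>b. mon_eval x (ms ! b))"
    have "v \<noteq> 0\<^sub>v l" unfolding v_def l_def by (rule monomial_vec_nonzero[OF x(1) ms(1)])
    moreover have "B f *\<^sub>v v = 0\<^sub>v l"
    proof (rule eq_vecI)
      fix a assume a: "a < dim_vec (0\<^sub>v l)"
      have h: "homog n (F f a)"
        unfolding F_def
      proof (intro homog_sum)
        fix j
        have "homog (n - (e - 1) + (e - 1)) (c (ms ! a) j * mp_pderiv j (jac f))"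
          using a by (intro homog_mult ch deg homog_mp_pderiv hJ f) simp
        moreover have "n - (e - 1) + (e - 1) = n" by (simp add: n_def)
        ultimately show "homog n (c (ms ! a) j * mp_pderiv j (jac f))" by metis
      qed
      have "(B f *\<^sub>v v) $ a = (\<Sum>b<l. lookup (F f a) (ms ! b) * mon_eval x (ms ! b))"
        using a by (simp add: B_def v_def scalar_prod_def lessThan_atLeast0)
      also have "\<dots> = mp_eval (F f a) x" by (simp add: mp_eval_homog_list[OF h ms(2,1)] l_def)
      also have "\<dots> = 0" by (simp add: F_def mp_eval_simps x(2))
      finally show "(B f *\<^sub>v v) $ a = 0\<^sub>v l $ a" using a by simp
    qed (simp add: B_def)
    moreover have "v \<in> carrier_vec l" by (simp add: v_def)
    ultimately have "det (B f) = 0" using det_0_iff_vec_prod_zero_field[OF Bdim] by blast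
    thus ?thesis using p(3)[OF f(1)] by simp
  qed
  ultimately show ?thesis by blast
qed

text \<open>The complement is cut out by all coordinate forms that vanish on the singular maps; the
  separating forms show that no smooth map satisfies all these equations.\<close>

lemma zopen_Ed:
  assumes alg_closed: "\<And>p :: 'k::field_char_0 poly. degree p \<ge> 1 \<Longrightarrow> \<exists>x. poly p x = 0"
    and d: "d \<ge> 2"
  shows "zopen_End d (Ed d :: 'k endo set)"
proof -
  define P :: "(3 \<times> (3 \<Rightarrow>\<^sub>0 nat), 'k) mpol set"
    where "P = {p. coord_poly d p \<and> (\<forall>f\<in>End2 d. \<not> smooth_form (jac f) \<longrightarrow> mp_eval p (coord f) = 0)}"
  have E: "Ed d = {f \<in> End2 d. smooth_form (jac f :: 'k pol3)}" by (rule Ed_eq_smooth[OF alg_closed d])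
  have "End2 d - Ed d = {f\<in>End2 d. \<forall>p\<in>P. mp_eval p (coord f) = 0}"
  proof (intro equalityI subsetI)
    fix f assume "f \<in> {f\<in>End2 d. \<forall>p\<in>P. mp_eval p (coord f) = 0}"
    hence f: "f \<in> End2 d" "\<And>p. p \<in> P \<Longrightarrow> mp_eval p (coord f) = 0" by auto
    have "\<not> smooth_form (jac f)"
    proof
      assume "smooth_form (jac f)"
      from separating_coord_poly[OF alg_closed d f(1) this] show False using f(2) unfolding P_def by blast
    qed
    thus "f \<in> End2 d - Ed d" using f(1) E by blast
  qed (auto simp: E P_def)
  moreover have "\<forall>p\<in>P. coord_poly d p" by (simp add: P_def)
  ultimately have "zclosed_End d (End2 d - Ed d :: 'k endo set)" unfolding zclosed_End_def by blast
  moreover have "Ed d \<subseteq> (End2 d :: 'k endo set)" unfolding E by blast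
  ultimately show ?thesis unfolding zopen_End_def by blast
qed

text \<open>If a 2 x 2 minor is nonzero, the cross product of its two rows works, because its
  product with any row is zero or the determinant up to sign. Otherwise the rank is at most one, and
  a vector orthogonal to a nonzero row, if there is one, is orthogonal to all rows.\<close>

lemma det3_zero_kernel:
  fixes M :: "3 \<Rightarrow> 3 \<Rightarrow> 'k::field"
  assumes "det3 M = 0"
  shows "\<exists>v. (\<exists>i. v i \<noteq> 0) \<and> (\<forall>i. (\<Sum>j\<in>UNIV. M i j * v j) = 0)"
proof -
  define vec3 :: "'k \<Rightarrow> 'k \<Rightarrow> 'k \<Rightarrow> 3 \<Rightarrow> 'k" where "vec3 a b c = (\<lambda>i. if i = 0 then a else if i = 1 then b else c)" for a b c
  have vs: "vec3 a b c 0 = a" "vec3 a b c 1 = b" "vec3 a b c 2 = c" for a b c by (simp_all add: vec3_def)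
  have goalI: ?thesis if "a \<noteq> 0 \<or> b \<noteq> 0 \<or> c \<noteq> 0" "\<And>i. M i 0 * a + M i 1 * b + M i 2 * c = 0" for a b c
  proof (intro exI[of _ "vec3 a b c"] conjI allI)
    show "\<exists>i. vec3 a b c i \<noteq> 0" using that(1) vs[of a b c] by metis
    show "(\<Sum>j\<in>UNIV. M i j * vec3 a b c j) = 0" for i using that(2)[of i] by (simp add: sum_3 vs)
  qed
  define cr where "cr r s i j = M r i * M s j - M r j * M s i" for r s i j
  show ?thesis
  proof (cases "\<exists>r s i j. cr r s i j \<noteq> 0")
    case True
    then obtain r s i j where nz: "cr r s i j \<noteq> 0" by blast
    let ?a = "cr r s 1 2" and ?b = "cr r s 2 0" and ?c = "cr r s 0 1"
    have "?a \<noteq> 0 \<or> ?b \<noteq> 0 \<or> ?c \<noteq> 0"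
      using nz exhaust_3[of i] exhaust_3[of j] by (auto simp: cr_def algebra_simps)
    moreover have "M t 0 * ?a + M t 1 * ?b + M t 2 * ?c = 0" for t
    proof -
      have "M t 0 * ?a + M t 1 * ?b + M t 2 * ?c \<in> {0, det3 M, - det3 M}"
        using exhaust_3[of t] exhaust_3[of r] exhaust_3[of s]
        by (elim disjE) (simp_all add: cr_def det3_def algebra_simps)
      thus ?thesis using assms by auto
    qed
    ultimately show ?thesis by (rule goalI)
  next
    case False
    hence cr0: "M r i * M s j = M r j * M s i" for r s i j by (auto simp: cr_def)
    show ?thesis
    proof (cases "\<forall>r i. M r i = 0")
      case True
      thus ?thesis by (intro goalI[of 1 0 0]) auto
    next
      case False
      then obtain r i where ri: "M r i \<noteq> 0" by blast
      consider "M r 0 \<noteq> 0 \<or> M r 1 \<noteq> 0" | "M r 0 = 0" "M r 2 \<noteq> 0"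
        using ri exhaust_3[of i] by auto
      thus ?thesis
      proof cases
        case 1
        thus ?thesis using cr0[of _ 0 r 1] by (intro goalI[of "M r 1" "- M r 0" 0]) auto
      next
        case 2
        have "M s 0 = 0" for s using cr0[of s 0 r 2] 2 by simp
        thus ?thesis by (intro goalI[of 1 0 0]) auto
      qed
    qed
  qed
qed

text \<open>A linear map whose components have only the trivial common zero has trivial kernel, so
  its constant Jacobian determinant is nonzero. The critical locus is empty, which counts as smooth
  and irreducible.\<close>

lemma Ed_1: "(Ed 1 :: 'k::field endo set) = End2 1"
proof -
  have "crit f = {}" if f: "f \<in> End2 1" for f :: "'k endo"
  proof (rule ccontr)
    assume "crit f \<noteq> {}"
    then obtain x where x: "mp_eval (jac f) x = 0" by (auto simp: crit_def)
    define M where "M i j = mp_eval (mp_pderiv j (f i)) x" for i j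
    have hf: "homog 1 (f i)" for i using f by (simp add: End2_def)
    have const: "mp_eval (mp_pderiv j (f i)) y = M i j" for i j y
    proof -
      have "homog 0 (mp_pderiv j (f i))" using homog_mp_pderiv[OF hf, of j] by simp
      from homog_0_eq_Cst[OF this] show ?thesis unfolding M_def by (metis mp_eval_Cst)
    qed
    have "det3 M = 0" using x by (simp add: jac_def det3_def M_def mp_eval_simps)
    then obtain v where v: "\<exists>i. v i \<noteq> 0" "\<And>i. (\<Sum>j\<in>UNIV. M i j * v j) = 0"
      using det3_zero_kernel by blast
    have "mp_eval (f i) v = 0" for i
    proof -
      have "mp_eval (\<Sum>j\<in>UNIV. Var j * mp_pderiv j (f i)) v = mp_eval (f i) v"
        using Euler_homog[OF hf, of i] by simp
      thus ?thesis using v(2)[of i] by (simp add: mp_eval_simps const mult.commute)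
    qed
    thus False using f v(1) by (auto simp: End2_def)
  qed
  thus ?thesis by (auto simp: Ed_def smooth_crit_def irreducible_P2_def)
qed

lemma Ed_1_open_nonempty: "(Ed 1 :: 'k::field endo set) \<noteq> {} \<and> zopen_End 1 (Ed 1 :: 'k endo set)"
proof
  have "Var \<in> (End2 1 :: 'k endo set)" by (simp add: End2_def homog_Var[simplified])
  thus "(Ed 1 :: 'k endo set) \<noteq> {}" unfolding Ed_1 by blast
  have "coord_poly 1 (1 :: (3 \<times> (3 \<Rightarrow>\<^sub>0 nat), 'k) mpol)"
    by (auto simp: coord_poly_def is_homog_def intro: homog_1)
  hence "zclosed_End 1 ({} :: 'k endo set)" unfolding zclosed_End_def by (intro exI[of _ "{1}"]) auto
  thus "zopen_End 1 (Ed 1 :: 'k endo set)" unfolding zopen_End_def Ed_1 by simp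
qed


section \<open>A map with smooth critical locus\<close>

text \<open>For \<open>f\<^sub>i = x\<^sub>i (d s - x\<^sub>i\<^sup>n)\<close> with \<open>n = d - 1\<close> and \<open>s = x\<^sub>0\<^sup>n + x\<^sub>1\<^sup>n + x\<^sub>2\<^sup>n\<close>, the Jacobian matrix is a
  diagonal matrix plus a matrix of rank one, and its determinant is \<open>d\<^sup>3 G(x\<^sub>0\<^sup>n, x\<^sub>1\<^sup>n, x\<^sub>2\<^sup>n)\<close> for a smooth
  symmetric cubic \<open>G\<close> that is transversal to the coordinate lines.\<close>

definition cubicG :: "'a::comm_ring_1 \<Rightarrow> 'a \<Rightarrow> 'a \<Rightarrow> 'a \<Rightarrow> 'a" where
  "cubicG N X Y Z = N * (X * X * X + Y * Y * Y + Z * Z * Z)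
     + (1 + N) * (X * X * Y + X * X * Z + Y * Y * X + Y * Y * Z + Z * Z * X + Z * Z * Y)
     + (2 + 3 * N) * (X * Y * Z)"

text \<open>The derivative of \<open>cubicG\<close> in its first argument; as the cubic is
  symmetric, permuted arguments give the other two.\<close>

definition cubicG' :: "'a::comm_ring_1 \<Rightarrow> 'a \<Rightarrow> 'a \<Rightarrow> 'a \<Rightarrow> 'a" where
  "cubicG' N X Y Z = 3 * N * (X * X) + (1 + N) * (2 * X * (Y + Z) + Y * Y + Z * Z) + (2 + 3 * N) * (Y * Z)"

definition exf :: "nat \<Rightarrow> 'k::comm_ring_1 endo" where
  "exf d i = Var i * (of_nat d * (\<Sum>k\<in>UNIV. Var k ^ (d - 1)) - Var i ^ (d - 1))"

lemma mp_pderiv_1 [simp]: "mp_pderiv j 1 = 0"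
  using mp_pderiv_Cst[of j 1] by simp

lemma mp_pderiv_of_nat [simp]: "mp_pderiv j (of_nat n) = 0"
  by (induction n) (simp_all add: mp_pderiv_add)

lemma mp_pderiv_numeral [simp]: "mp_pderiv j (numeral n) = 0"
  using mp_pderiv_of_nat[of j "numeral n"] by simp

lemma mp_pderiv_cubicG:
  "mp_pderiv j (cubicG (of_nat n) A B C) = cubicG' (of_nat n) A B C * mp_pderiv j A
     + cubicG' (of_nat n) B A C * mp_pderiv j B + cubicG' (of_nat n) C A B * mp_pderiv j C"
  unfolding cubicG_def cubicG'_def
  by (simp add: mp_pderiv_mult mp_pderiv_add) (simp add: algebra_simps)

text \<open>The origin of the coefficients of \<open>cubicG\<close>: for a diagonal matrix plus a
  rank one matrix the determinant is d^3 times (Y + Z)(X + Z)(X + Y) + N (X (X + Z)(X + Y) + Y (Y +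
  Z)(X + Y) + Z (Y + Z)(X + Z)).\<close>

lemma det3_rank_one_update:
  fixes d N a b c x y z :: "'a::comm_ring_1"
  defines "X \<equiv> x * a" and "Y \<equiv> y * b" and "Z \<equiv> z * c"
  assumes "M 0 0 = d * (Y + Z + N * (x * a))" "M 0 1 = d * (N * (x * b))" "M 0 2 = d * (N * (x * c))"
    "M 1 0 = d * (N * (y * a))" "M 1 1 = d * (X + Z + N * (y * b))" "M 1 2 = d * (N * (y * c))"
    "M 2 0 = d * (N * (z * a))" "M 2 1 = d * (N * (z * b))" "M 2 2 = d * (X + Y + N * (z * c))"
  shows "det3 M = d * d * d * cubicG N X Y Z"
  unfolding det3_def assms cubicG_def by (simp add: algebra_simps)

lemma jac_exf:
  assumes d: "d \<ge> 2"
  shows "jac (exf d :: 'k::comm_ring_1 endo) = of_nat d * of_nat d * of_nat d *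
    cubicG (of_nat (d - 1)) (Var 0 ^ (d - 1)) (Var 1 ^ (d - 1)) (Var 2 ^ (d - 1))"
proof -
  obtain k where k: "d = Suc (Suc k)" using d by (metis add_2_eq_Suc le_Suc_ex)
  define n where "n = Suc k"
  have dn: "d - 1 = n" "(of_nat d :: 'k pol3) = 1 + of_nat n" using k by (simp_all add: n_def)
  have pw: "(Var i :: 'k pol3) ^ n = Var i * Var i ^ k" for i by (simp add: n_def)
  have dp: "mp_pderiv j (Var i ^ n) = (if i = j then of_nat n * Var i ^ k else (0 :: 'k pol3))" for i j
    unfolding mp_pderiv_power mp_pderiv_Var by (simp add: n_def)
  have dS: "mp_pderiv j (\<Sum>k\<in>UNIV. Var k ^ n) = (of_nat n * Var j ^ k :: 'k pol3)" for j
    by (simp add: mp_pderiv_sum dp)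
  define D where "D = (of_nat d :: 'k pol3)"
  define N where "N = (of_nat n :: 'k pol3)"
  \<comment> \<open>The diagonal part is d s - x_i^n - n x_i^n = d (s - x_i^n), as d = n + 1. This
    explains the factor d before the sum in \<open>exf\<close>.\<close>
  have DN: "D = 1 + N" by (simp add: D_def N_def dn)
  have D0: "mp_pderiv j D = 0" for j by (simp add: D_def)
  have M: "mp_pderiv j (exf d i) = (if i = j then D * (\<Sum>k\<in>UNIV. Var k ^ n) - Var i ^ n else 0)
     + Var i * (D * (N * Var j ^ k) - (if i = j then N * Var i ^ k else (0 :: 'k pol3)))" for i j
    unfolding exf_def dn(1) D_def[symmetric] mp_pderiv_mult mp_pderiv_diff dS dp mp_pderiv_Var D0 N_def[symmetric]
    by simp
  have "jac (exf d :: 'k endo) = D * D * D * cubicG N (Var 0 * Var 0 ^ k) (Var 1 * Var 1 ^ k) (Var 2 * Var 2 ^ k)"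
    unfolding jac_def
    by (rule det3_rank_one_update) (simp_all add: M sum_3 pw, simp_all add: DN algebra_simps)
  thus ?thesis unfolding dn(1) D_def N_def pw .
qed

lemma cubicG'_commute: "cubicG' N X Z Y = cubicG' N X Y Z"
  by (simp add: cubicG'_def algebra_simps)

lemma of_nat_mult_neq:
  assumes "a * n \<noteq> b"
  shows "of_nat a * of_nat n - of_nat b \<noteq> (0 :: 'k::field_char_0)"
proof -
  have "of_nat (a * n) \<noteq> (of_nat b :: 'k)" using assms by (simp only: of_nat_eq_iff) simp
  thus ?thesis by simp
qed

text \<open>The difference of the two derivatives is divisible by X - Z. If X = Z, the derivative is
  (12 N + 8) X^2. Otherwise Z is determined by X through a linear relation; substituting it, after
  scaling by (2 N - 1)^2 to avoid division, leaves 3 N^2 (5 N - 2) X^2. The constants are nonzero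
  because N is a positive integer.\<close>

lemma cubicG'_two_equal:
  fixes X Z :: "'k::field_char_0"
  assumes n: "n \<ge> 1" and z: "cubicG' (of_nat n) X X Z = 0" "cubicG' (of_nat n) Z X X = 0"
  shows "X = 0 \<and> Z = 0"
proof -
  define N where "N = (of_nat n :: 'k)"
  have odd: "2 * n \<noteq> 1" "5 * n \<noteq> 2" by presburger+
  have c: "2 * N - 1 \<noteq> 0" "5 * N - 2 \<noteq> 0" "N \<noteq> 0"
    using of_nat_mult_neq[OF odd(1), where 'k = 'k] of_nat_mult_neq[OF odd(2), where 'k = 'k] n
    by (simp_all add: N_def)
  have "12 * N + 8 = of_nat (12 * n + 8)" by (simp add: N_def)
  hence c4: "12 * N + 8 \<noteq> 0" by (metis add_eq_0_iff_both_eq_0 of_nat_eq_0_iff zero_neq_numeral)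
  have "(X - Z) * ((2 * N - 1) * (X + Z) - N * X) = cubicG' N X X Z - cubicG' N Z X X"
    by (simp add: cubicG'_def algebra_simps)
  hence "(X - Z) * ((2 * N - 1) * (X + Z) - N * X) = 0" using z by (simp add: N_def)
  hence "X = Z \<or> (2 * N - 1) * (X + Z) - N * X = 0" by simp
  thus ?thesis
  proof
    assume "X = Z"
    hence "(12 * N + 8) * (X * X) = 0" using z(1) unfolding N_def[symmetric]
      by (simp add: cubicG'_def algebra_simps)
    thus ?thesis using c4 \<open>X = Z\<close> by simp
  next
    assume "(2 * N - 1) * (X + Z) - N * X = 0"
    hence w: "(2 * N - 1) * Z = - (N - 1) * X" by (simp add: algebra_simps)
    have "(2 * N - 1) * (2 * N - 1) * cubicG' N Z X X =
       3 * N * (((2 * N - 1) * Z) * ((2 * N - 1) * Z)) + (1 + N) * (4 * X * (2 * N - 1) * ((2 * N - 1) * Z)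
        + 2 * (X * X) * ((2 * N - 1) * (2 * N - 1))) + (2 + 3 * N) * (X * X) * ((2 * N - 1) * (2 * N - 1))"
      by (simp add: cubicG'_def algebra_simps)
    also have "\<dots> = 3 * N * N * (5 * N - 2) * (X * X)" unfolding w by (simp add: algebra_simps)
    finally have "3 * N * N * (5 * N - 2) * (X * X) = 0" using z(2) by (simp add: N_def)
    hence "X = 0" using c by simp
    thus ?thesis using w c by simp
  qed
qed

text \<open>Differences of derivatives split off X - Y and Y - Z. If both remaining linear factors
  vanish, subtracting them gives (3 N - 1)(X - Z) = 0; so two of the coordinates agree in any
  case.\<close>

lemma cubicG'_nonsingular:
  fixes X Y Z :: "'k::field_char_0"
  assumes n: "n \<ge> 1"
    and z: "cubicG' (of_nat n) X Y Z = 0" "cubicG' (of_nat n) Y X Z = 0" "cubicG' (of_nat n) Z X Y = 0"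
  shows "X = 0 \<and> Y = 0 \<and> Z = 0"
proof -
  define N where "N = (of_nat n :: 'k)"
  have "3 * n \<noteq> 1" by presburger
  hence c: "3 * N - 1 \<noteq> 0" using of_nat_mult_neq[of 3 n 1, where 'k = 'k] by (simp add: N_def)
  have "(X - Y) * ((2 * N - 1) * (X + Y) - N * Z) = cubicG' N X Y Z - cubicG' N Y X Z"
    by (simp add: cubicG'_def algebra_simps)
  hence 1: "X = Y \<or> (2 * N - 1) * (X + Y) - N * Z = 0" using z by (simp add: N_def)
  have "(Y - Z) * ((2 * N - 1) * (Y + Z) - N * X) = cubicG' N Y X Z - cubicG' N Z X Y"
    by (simp add: cubicG'_def algebra_simps)
  hence 2: "Y = Z \<or> (2 * N - 1) * (Y + Z) - N * X = 0" using z by (simp add: N_def)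
  have "(3 * N - 1) * (X - Z) = ((2 * N - 1) * (X + Y) - N * Z) - ((2 * N - 1) * (Y + Z) - N * X)"
    by (simp add: algebra_simps)
  with 1 2 c have "X = Y \<or> Y = Z \<or> X = Z" by auto
  thus ?thesis
  proof (elim disjE)
    assume "X = Y"
    thus ?thesis using cubicG'_two_equal[OF n, of X Z] z by simp
  next
    assume "Y = Z"
    thus ?thesis using cubicG'_two_equal[OF n, of Y X] z cubicG'_commute[of "of_nat n" Y Y X] by simp
  next
    assume "X = Z"
    thus ?thesis using cubicG'_two_equal[OF n, of X Y] z cubicG'_commute[of "of_nat n" X X Y] by simp
  qed
qed

text \<open>On a coordinate line only two equations are available: the derivative in the third
  direction carries a factor x_j^(n-1), which vanishes there when n > 1.\<close>

lemma cubicG'_line: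
  fixes X Y :: "'k::field_char_0"
  assumes n: "n \<ge> 1"
    and z: "cubicG' (of_nat n) X Y 0 = 0" "cubicG' (of_nat n) Y X 0 = 0"
  shows "X = 0"
proof -
  define N where "N = (of_nat n :: 'k)"
  have "2 * n \<noteq> 1" by presburger
  hence c: "2 * N - 1 \<noteq> 0" using of_nat_mult_neq[of 2 n 1, where 'k = 'k] by (simp add: N_def)
  have "6 * N + 3 = of_nat (6 * n + 3)" by (simp add: N_def)
  hence c4: "6 * N + 3 \<noteq> 0" by (metis add_eq_0_iff_both_eq_0 of_nat_eq_0_iff zero_neq_numeral)
  have "(X - Y) * ((2 * N - 1) * (X + Y)) = cubicG' N X Y 0 - cubicG' N Y X 0"
    by (simp add: cubicG'_def algebra_simps)
  hence "X = Y \<or> X + Y = 0" using z c by (simp add: N_def)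
  thus ?thesis
  proof
    assume "X = Y"
    hence "(6 * N + 3) * (X * X) = 0" using z(1) unfolding N_def[symmetric]
      by (simp add: cubicG'_def algebra_simps)
    thus ?thesis using c4 by simp
  next
    assume "X + Y = 0"
    hence "Y = - X" by (simp add: eq_neg_iff_add_eq_0 add.commute)
    hence "(2 * N - 1) * (X * X) = 0" using z(1) unfolding N_def[symmetric]
      by (simp add: cubicG'_def algebra_simps)
    thus ?thesis using c by simp
  qed
qed

lemma cubicG'_corner:
  fixes X :: "'k::field_char_0"
  assumes n: "n \<ge> 1" and z: "cubicG' (of_nat n) X 0 0 = 0"
  shows "X = 0"
  using assms by (simp add: cubicG'_def)

lemma mp_eval_cubicG': "mp_eval (cubicG' (of_nat n) A B C) x =
   cubicG' (of_nat n) (mp_eval A x) (mp_eval B x) (mp_eval C x)"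
proof -
  have num: "mp_eval (numeral k) x = numeral k" for k
    using mp_eval_of_nat[of "numeral k" x] by simp
  show ?thesis by (simp add: cubicG'_def mp_eval_simps num)
qed

text \<open>The j-th derivative is a nonzero constant times x_j^(n-1) g_j, with g_j a derivative of
  the cubic. If all vanish, then x_j = 0 or g_j = 0 for each j, and the cases follow the set of
  vanishing coordinates. The gradient is thus nonzero at every nonzero point, on the curve or
  not.\<close>

lemma smooth_form_jac_exf:
  assumes d: "d \<ge> 2"
  shows "smooth_form (jac (exf d :: 'k::field_char_0 endo))"
  unfolding smooth_form_def
proof (intro allI impI)
  fix x :: "3 \<Rightarrow> 'k" assume x: "\<exists>i. x i \<noteq> 0"
  define n where "n = d - 1"
  have n: "n \<ge> 1" using d by (simp add: n_def)
  define g where "g j = (if j = 0 then cubicG' (of_nat n) (x 0 ^ n) (x 1 ^ n) (x 2 ^ n)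
     else if j = 1 then cubicG' (of_nat n) (x 1 ^ n) (x 0 ^ n) (x 2 ^ n)
     else cubicG' (of_nat n) (x 2 ^ n) (x 0 ^ n) (x 1 ^ n))" for j :: 3
  have dp: "mp_pderiv j (Var i ^ n) = (if i = j then of_nat n * Var i ^ (n - 1) else (0 :: 'k pol3))" for i j
    by (simp add: mp_pderiv_power mp_pderiv_Var)
  have pd: "mp_eval (mp_pderiv j (jac (exf d))) x = of_nat d * of_nat d * of_nat d * (of_nat n * x j ^ (n - 1) * g j)" for j
    using exhaust_3[of j] unfolding jac_exf[OF d] n_def[symmetric]
    by (auto simp: mp_pderiv_mult mp_pderiv_cubicG dp mp_eval_simps mp_eval_cubicG' g_def)
  show "\<exists>j. mp_eval (mp_pderiv j (jac (exf d))) x \<noteq> 0"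
  proof (rule ccontr)
    assume "\<nexists>j. mp_eval (mp_pderiv j (jac (exf d))) x \<noteq> 0"
    hence g0: "x j = 0 \<or> g j = 0" for j using pd[of j] d n by auto
    have pz: "x j ^ n = 0 \<longleftrightarrow> x j = 0" for j using n by simp
    have g: "x 0 = 0 \<or> cubicG' (of_nat n) (x 0 ^ n) (x 1 ^ n) (x 2 ^ n) = 0"
      "x 1 = 0 \<or> cubicG' (of_nat n) (x 1 ^ n) (x 0 ^ n) (x 2 ^ n) = 0"
      "x 2 = 0 \<or> cubicG' (of_nat n) (x 2 ^ n) (x 0 ^ n) (x 1 ^ n) = 0"
      using g0[of 0] g0[of 1] g0[of 2] by (simp_all add: g_def)
    have zp: "(0::'k) ^ n = 0" using n by simp
    note swap = cubicG'_commute[of "of_nat n"]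
    have "x 0 = 0 \<and> x 1 = 0 \<and> x 2 = 0"
    proof (cases "x 0 = 0"; cases "x 1 = 0"; cases "x 2 = 0")
      assume "x 0 \<noteq> 0" "x 1 \<noteq> 0" "x 2 \<noteq> 0"
      thus ?thesis using cubicG'_nonsingular[OF n, of "x 0 ^ n" "x 1 ^ n" "x 2 ^ n"] g pz by blast
    next
      assume "x 0 \<noteq> 0" "x 1 \<noteq> 0" "x 2 = 0"
      thus ?thesis using cubicG'_line[OF n, of "x 0 ^ n" "x 1 ^ n"] g pz[of 0] by (simp add: zp)
    next
      assume "x 0 \<noteq> 0" "x 1 = 0" "x 2 \<noteq> 0"
      thus ?thesis using cubicG'_line[OF n, of "x 0 ^ n" "x 2 ^ n"] g pz[of 0] swap[of "x 0 ^ n" 0 "x 2 ^ n"]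
        by (simp add: zp)
    next
      assume "x 0 = 0" "x 1 \<noteq> 0" "x 2 \<noteq> 0"
      thus ?thesis using cubicG'_line[OF n, of "x 1 ^ n" "x 2 ^ n"] g pz[of 1] swap[of "x 1 ^ n" 0 "x 2 ^ n"]
          swap[of "x 2 ^ n" 0 "x 1 ^ n"] by (simp add: zp)
    next
      assume "x 0 \<noteq> 0" "x 1 = 0" "x 2 = 0"
      thus ?thesis using cubicG'_corner[OF n, of "x 0 ^ n"] g pz[of 0] by (simp add: zp)
    next
      assume "x 0 = 0" "x 1 \<noteq> 0" "x 2 = 0"
      thus ?thesis using cubicG'_corner[OF n, of "x 1 ^ n"] g pz[of 1] by (simp add: zp)
    next
      assume "x 0 = 0" "x 1 = 0" "x 2 \<noteq> 0"
      thus ?thesis using cubicG'_corner[OF n, of "x 2 ^ n"] g pz[of 2] by (simp add: zp)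
    qed simp
    thus False using x exhaust_3 by metis
  qed
qed

lemma homog_of_nat: "homog 0 (of_nat n :: ('v, 'k::comm_ring_1) mpol)"
  by (induction n) (auto intro: homog_add homog_1)

text \<open>At a common zero each x_i^n is 0 or d s. Summing gives s = m d s for a natural number m,
  and m d is not 1 since d >= 2; hence s = 0 and every x_i is 0.\<close>

lemma exf_End2:
  assumes d: "d \<ge> 2"
  shows "(exf d :: 'k::field_char_0 endo) \<in> End2 d"
proof -
  define n where "n = d - 1"
  have n: "n \<ge> 1" "d = 1 + n" using d by (simp_all add: n_def)
  have "homog (1 + n) (exf d i :: 'k pol3)" for i
  proof -
    have V: "homog n (Var k ^ n :: 'k pol3)" for k using homog_power[OF homog_Var, of n k] by simp
    have "homog (0 + n) (of_nat d * (\<Sum>k\<in>UNIV. Var k ^ n) :: 'k pol3)"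
      by (intro homog_mult homog_of_nat homog_sum V)
    thus ?thesis unfolding exf_def n_def[symmetric]
      by (intro homog_mult homog_Var homog_diff V) simp
  qed
  moreover have "x i = 0" if z: "\<And>i. mp_eval (exf d i) x = 0" for x :: "3 \<Rightarrow> 'k" and i
  proof -
    define s where "s = x 0 ^ n + x 1 ^ n + x 2 ^ n"
    have c: "x i ^ n = 0 \<or> x i ^ n = of_nat d * s" for i
      using z[of i] n(1) unfolding exf_def n_def[symmetric] s_def
      by (auto simp: mp_eval_simps sum_3)
    have k: "k * d \<noteq> 1" for k using d by (cases k) auto
    have nz: "of_nat k * of_nat d - 1 \<noteq> (0::'k)" for k
      using of_nat_mult_neq[OF k[of k], where 'k = 'k] by simp
    have "s = 0"
    proof (rule ccontr)
      assume s: "s \<noteq> 0"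
      have "\<exists>k::nat. x i ^ n = of_nat k * (of_nat d * s)" for i
        using c[of i] by (metis mult_1 mult_zero_left of_nat_0 of_nat_1)
      then obtain k :: "3 \<Rightarrow> nat" where k: "\<And>i. x i ^ n = of_nat (k i) * (of_nat d * s)" by metis
      have "s = of_nat (k 0 + k 1 + k 2) * (of_nat d * s)"
        unfolding of_nat_add distrib_right k[symmetric] s_def[symmetric] ..
      hence "(of_nat (k 0 + k 1 + k 2) * of_nat d - 1) * s = 0"
        unfolding left_diff_distrib mult.assoc by simp
      thus False using nz[of "k 0 + k 1 + k 2"] s by (metis mult_eq_0_iff)
    qed
    hence "x i ^ n = 0" using c[of i] by auto
    thus ?thesis using n(1) by simp
  qed
  ultimately show ?thesis using n(2) by (auto simp: End2_def)
qed

lemma Ed_nonempty: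
  assumes alg_closed: "\<And>p :: 'k::field_char_0 poly. degree p \<ge> 1 \<Longrightarrow> \<exists>x. poly p x = 0"
    and d: "d \<ge> 2"
  shows "(Ed d :: 'k endo set) \<noteq> {}"
proof -
  have "exf d \<in> {f \<in> End2 d. smooth_form (jac f :: 'k pol3)}"
    using exf_End2[OF d] smooth_form_jac_exf[OF d] by blast
  hence "exf d \<in> (Ed d :: 'k endo set)" using Ed_eq_smooth[OF alg_closed d] by simp
  thus ?thesis by (metis empty_iff)
qed


section \<open>Sections and derivations on a smooth plane curve\<close>

text \<open>A form of degree at least 2 vanishes to second order at the origin, and so do its
  multiples. This excludes nonzero linear forms as multiples of \<open>J\<close>.\<close>

lemma not_dvd_of_pderiv_origin:
  fixes J p :: "'k::field pol3"
  assumes J: "homog e J" "e \<ge> 2" and p: "mp_eval (mp_pderiv j p) (\<lambda>_. 0) \<noteq> 0"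
  shows "\<not> J dvd p"
proof
  assume "J dvd p"
  then obtain s where s: "p = J * s" unfolding dvd_def by blast
  have "mp_eval J (\<lambda>_. 0) = 0" using J by (intro mp_eval_origin[OF J(1)]) simp
  moreover have "mp_eval (mp_pderiv j J) (\<lambda>_. 0) = 0"
    using J by (intro mp_eval_origin[OF homog_mp_pderiv[OF J(1)]]) simp
  ultimately show False using p by (simp add: s mp_pderiv_mult mp_eval_simps)
qed

lemma prime_elem_dvd_prodD:
  assumes "prime_elem p" "finite A" "p dvd prod f A"
  shows "\<exists>a\<in>A. p dvd f a"
  using assms(2,3)
proof (induction A rule: finite_induct)
  case empty
  thus ?case using assms(1) by (simp add: prime_elem_def)
next
  case (insert a A)
  hence "p dvd f a \<or> p dvd prod f A" using prime_elem_dvd_multD[OF assms(1), of "f a" "prod f A"] by simp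
  thus ?case using insert.IH by blast
qed

text \<open>A section of negative degree vanishes: if \<open>n\<close> is proportional to \<open>w\<close> on the curve, the ratio
  \<open>z\<^sup>\<delta> n / w\<close> is at every point an eigenvalue of one constant matrix, since the Nullstellensatz expresses
  all monomials of a large degree through \<open>w\<close> and \<open>J\<close>. So it is constant, and it is zero where \<open>z = 0\<close>.\<close>

lemma negative_section_zero:
  fixes J :: "'k::field_char_0 pol3" and w n :: "3 \<Rightarrow> 'k pol3"
  assumes alg_closed: "\<And>p :: 'k poly. degree p \<ge> 1 \<Longrightarrow> \<exists>x. poly p x = 0"
    and J: "homog e J" "e \<ge> 2" "smooth_form J"
    and w: "\<And>k. homog dw (w k)" and n: "\<And>k. homog dn (n k)" and less: "dn < dw"
    and nz: "\<And>x. \<exists>i. x i \<noteq> 0 \<Longrightarrow> mp_eval J x = 0 \<Longrightarrow> \<exists>k. mp_eval (w k) x \<noteq> 0"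
    and par: "\<And>x k l. \<exists>i. x i \<noteq> 0 \<Longrightarrow> mp_eval J x = 0 \<Longrightarrow>
       mp_eval (n l) x * mp_eval (w k) x = mp_eval (n k) x * mp_eval (w l) x"
  shows "J dvd n k"
proof -
  have prime: "prime_elem J" using J(2) by (intro smooth_form_prime[OF alg_closed J(1) _ J(3)]) simp_all
  define \<delta> where "\<delta> = dw - dn"
  have \<delta>: "\<delta> \<ge> 1" using less by (simp add: \<delta>_def)
  define h where "h = (\<lambda>i::3 option. case i of None \<Rightarrow> J | Some k \<Rightarrow> w k)"
  define dh where "dh = (\<lambda>i::3 option. case i of None \<Rightarrow> e | Some k \<Rightarrow> dw)"
  have "\<exists>N. \<forall>m. mon_deg m \<ge> N \<longrightarrow> (\<exists>c. (\<forall>i\<in>UNIV. homog (mon_deg m - dh i) (c i)) \<and>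
           single m (1::'k) = (\<Sum>i\<in>UNIV. c i * h i))"
  proof (rule projective_nullstellensatz[OF alg_closed])
    show "homog (dh i) (h i)" for i using J(1) w by (cases i) (auto simp: h_def dh_def)
    show "\<forall>v. x v = 0" if z: "\<forall>i\<in>UNIV. mp_eval (h i) x = 0" for x
    proof (rule ccontr)
      assume x: "\<not> (\<forall>v. x v = 0)"
      have "mp_eval J x = 0" using z[THEN bspec, of None] by (simp add: h_def)
      then obtain k where "mp_eval (w k) x \<noteq> 0" using nz[of x] x by blast
      thus False using z[THEN bspec, of "Some k"] by (simp add: h_def)
    qed
  qed auto
  then obtain N where N: "\<And>m. mon_deg m \<ge> N \<Longrightarrow> \<exists>c. (\<forall>i\<in>UNIV. homog (mon_deg m - dh i) (c i)) \<and>
           single m (1::'k) = (\<Sum>i\<in>UNIV. c i * h i)" by blast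
  \<comment> \<open>At least \<open>dw\<close>, so that \<open>\<delta> + (P - dw) + dn\<close> is
    again \<open>P\<close>.\<close>
  define P where "P = max N dw"
  have "\<exists>c. \<forall>m. mon_deg m = P \<longrightarrow> (\<forall>i. homog (P - dh i) (c m i)) \<and>
     single m (1::'k) = (\<Sum>i\<in>UNIV. c m i * h i)"
  proof (rule choice, intro allI)
    fix m :: "3 \<Rightarrow>\<^sub>0 nat"
    show "\<exists>c. mon_deg m = P \<longrightarrow> (\<forall>i. homog (P - dh i) (c i)) \<and> single m (1::'k) = (\<Sum>i\<in>UNIV. c i * h i)"
    proof (cases "mon_deg m = P")
      case True
      hence "mon_deg m \<ge> N" by (simp add: P_def)
      from N[OF this] show ?thesis unfolding True by blast
    qed simp
  qed
  then obtain c where ch: "\<And>m i. mon_deg m = P \<Longrightarrow> homog (P - dh i) (c m i)"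
    and c1: "\<And>m. mon_deg m = P \<Longrightarrow> single m (1::'k) = (\<Sum>i\<in>UNIV. c m i * h i)" by blast
  obtain ms :: "(3 \<Rightarrow>\<^sub>0 nat) list" where ms: "set ms = {m. mon_deg m = P}" "distinct ms"
    using finite_distinct_list[OF finite_mon_deg] by blast
  define L where "L = length ms"
  have deg: "mon_deg (ms ! a) = P" if "a < L" for a using that ms(1) nth_mem unfolding L_def by blast
  \<comment> \<open>In the expression of a monomial through \<open>J\<close> and \<open>w\<close>,
    the \<open>J\<close> term is dropped and \<open>w k\<close> is replaced by z^\<delta> n_k, of
    the same degree. At a point of the curve this multiplies the monomial by the ratio, so
    \<open>R\<close> has the monomial vector as an eigenvector.\<close>
  define Q where "Q a = Var 2 ^ \<delta> * (\<Sum>k\<in>UNIV. c (ms ! a) (Some k) * n k)" for a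
  have Q: "homog P (Q a)" if a: "a < L" for a
  proof -
    have "homog (1 * \<delta> + ((P - dw) + dn)) (Q a)"
      unfolding Q_def
    proof (intro homog_mult homog_power homog_Var homog_sum n)
      fix k
      show "homog (P - dw) (c (ms ! a) (Some k))" using ch[OF deg[OF a], of "Some k"] by (simp add: dh_def)
    qed
    moreover have "1 * \<delta> + ((P - dw) + dn) = P" using less by (simp add: \<delta>_def P_def)
    ultimately show ?thesis by metis
  qed
  define R where "R = mat L L (\<lambda>(a, b). lookup (Q a) (ms ! b))"
  have Rc: "R \<in> carrier_mat L L" by (simp add: R_def)
  define \<Lambda> where "\<Lambda> = {r. eigenvalue R r}"
  have "char_poly R \<noteq> 0" using degree_monic_char_poly[OF Rc] by auto
  hence fin: "finite \<Lambda>"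
    unfolding \<Lambda>_def eigenvalue_root_char_poly[OF Rc] by (rule poly_roots_finite)
  have ratio: "\<exists>r\<in>\<Lambda>. \<forall>k. x 2 ^ \<delta> * mp_eval (n k) x = r * mp_eval (w k) x"
    if x: "\<exists>i. x i \<noteq> 0" "mp_eval J x = 0" for x
  proof -
    obtain k0 where k0: "mp_eval (w k0) x \<noteq> 0" using nz[OF x] by blast
    define r where "r = x 2 ^ \<delta> * mp_eval (n k0) x / mp_eval (w k0) x"
    have r: "x 2 ^ \<delta> * mp_eval (n k) x = r * mp_eval (w k) x" for k
      using par[OF x, of k k0] k0 by (simp add: r_def field_simps)
    define v where "v = vec L (\<lambda>b. mon_eval x (ms ! b))"
    have "v \<noteq> 0\<^sub>v L" unfolding v_def L_def by (rule monomial_vec_nonzero[OF x(1) ms(1)])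
    moreover have "R *\<^sub>v v = r \<cdot>\<^sub>v v"
    proof (rule eq_vecI)
      fix a assume "a < dim_vec (r \<cdot>\<^sub>v v)"
      hence a: "a < L" by (simp add: v_def)
      have "(R *\<^sub>v v) $ a = (\<Sum>b<L. lookup (Q a) (ms ! b) * mon_eval x (ms ! b))"
        using a by (simp add: R_def v_def scalar_prod_def lessThan_atLeast0)
      also have "\<dots> = mp_eval (Q a) x" by (simp add: mp_eval_homog_list[OF Q[OF a] ms(2,1)] L_def)
      also have "\<dots> = (\<Sum>k\<in>UNIV. mp_eval (c (ms ! a) (Some k)) x * (x 2 ^ \<delta> * mp_eval (n k) x))"
        by (simp add: Q_def mp_eval_simps sum_distrib_left ac_simps)
      also have "\<dots> = r * (\<Sum>k\<in>UNIV. mp_eval (c (ms ! a) (Some k)) x * mp_eval (w k) x)"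
        unfolding r by (simp add: sum_distrib_left ac_simps)
      also have "(\<Sum>k\<in>UNIV. mp_eval (c (ms ! a) (Some k)) x * mp_eval (w k) x)
          = mp_eval (\<Sum>i\<in>UNIV. c (ms ! a) i * h i) x"
        using x(2) by (simp add: UNIV_option_conv sum.reindex mp_eval_simps h_def)
      also have "\<dots> = mon_eval x (ms ! a)" by (simp add: c1[OF deg[OF a], symmetric] mp_eval_single)
      finally show "(R *\<^sub>v v) $ a = (r \<cdot>\<^sub>v v) $ a" using a by (simp add: v_def)
    qed (simp add: R_def v_def)
    moreover have "v \<in> carrier_vec (dim_row R)" by (simp add: v_def R_def)
    ultimately have "eigenvalue R r" unfolding eigenvalue_def eigenvector_def using Rc by auto
    thus ?thesis using r by (auto simp: \<Lambda>_def)
  qed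
  define q where "q r k = Var 2 ^ \<delta> * n k - Cst r * w k" for r k
  \<comment> \<open>Finitely many eigenvalues cover the curve, so a product over them vanishes on
    it. As \<open>J\<close> is prime, one eigenvalue works on the whole curve.\<close>
  have "\<exists>r\<in>\<Lambda>. \<forall>k. J dvd q r k"
  proof (rule ccontr)
    assume "\<not> (\<exists>r\<in>\<Lambda>. \<forall>k. J dvd q r k)"
    then obtain kk where kk: "\<And>r. r \<in> \<Lambda> \<Longrightarrow> \<not> J dvd q r (kk r)" by metis
    have "J dvd (\<Prod>r\<in>\<Lambda>. q r (kk r))"
    proof (rule smooth_form_dvd[OF alg_closed J])
      fix x :: "3 \<Rightarrow> 'k" assume "\<exists>i. x i \<noteq> 0" "mp_eval J x = 0"
      from ratio[OF this] obtain r where "r \<in> \<Lambda>" "mp_eval (q r (kk r)) x = 0"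
        by (auto simp: q_def mp_eval_simps)
      thus "mp_eval (\<Prod>r\<in>\<Lambda>. q r (kk r)) x = 0" using fin by (auto simp: mp_eval_prod intro!: prod_zero)
    qed
    hence "\<exists>r\<in>\<Lambda>. J dvd q r (kk r)" by (rule prime_elem_dvd_prodD[OF prime fin])
    thus False using kk by blast
  qed
  then obtain r where r: "\<And>k. J dvd q r k" by blast
  obtain y where y: "\<exists>i. y i \<noteq> 0" "y 2 = 0" "mp_eval J y = 0"
    using ex_zero_on_line[OF alg_closed J(1)] J(2) by fastforce
  obtain k1 where k1: "mp_eval (w k1) y \<noteq> 0" using nz[OF y(1,3)] by blast
  obtain s where "q r k1 = J * s" using r[of k1] unfolding dvd_def by blast
  hence "mp_eval (q r k1) y = 0" using y(3) by (simp add: mp_eval_mult)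
  hence "r * mp_eval (w k1) y = 0" using y(2) \<delta> by (simp add: q_def mp_eval_simps zero_power)
  hence "r = 0" using k1 by simp
  hence "J dvd Var 2 ^ \<delta> * n k" using r[of k] by (simp add: q_def)
  moreover have "\<not> J dvd Var 2"
    by (rule not_dvd_of_pderiv_origin[OF J(1,2), of 2]) (simp add: mp_pderiv_Var)
  hence "\<not> J dvd Var 2 ^ \<delta>" using prime_elem_dvd_power[OF prime] by blast
  ultimately show ?thesis using prime by (simp add: prime_elem_dvd_mult_iff)
qed

text \<open>For fixed \<open>v\<close> this is a derivation in \<open>u\<close> that kills
  \<open>J\<close>, hence tangent to the curve. For \<open>u\<close> and \<open>v\<close> of equal
  degree, its vanishing modulo \<open>J\<close> says that u / v has zero derivative along the
  curve.\<close>

definition bracket :: "'k::comm_ring_1 pol3 \<Rightarrow> 'k pol3 \<Rightarrow> 'k pol3 \<Rightarrow> 'k pol3" where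
  "bracket J u v = det3 (\<lambda>i j. if i = 0 then mp_pderiv j J else if i = 1 then mp_pderiv j u else mp_pderiv j v)"

lemma bracket_add: "bracket J (u + u') v = bracket J u v + bracket J u' v"
  and bracket_mult: "bracket J (u * u') v = bracket J u v * u' + u * bracket J u' v"
  and bracket_self: "bracket J u u = 0"
  and bracket_J: "bracket J J v = 0"
  and bracket_Cst: "bracket J (Cst c) v = 0"
  and bracket_swap: "bracket J v u = - bracket J u v"
  by (simp_all add: bracket_def det3_def mp_pderiv_add mp_pderiv_mult algebra_simps)

lemma bracket_diff: "bracket J (u - u') v = bracket J u v - bracket J u' v"
  by (simp add: bracket_def det3_def mp_pderiv_diff algebra_simps)

lemma bracket_power: "bracket J (u ^ Suc m) v = of_nat (Suc m) * u ^ m * bracket J u v"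
proof (induction m)
  case (Suc m)
  have "bracket J (u ^ Suc (Suc m)) v = bracket J u v * u ^ Suc m + u * bracket J (u ^ Suc m) v"
    by (simp only: power_Suc[of u "Suc m"] bracket_mult)
  also have "\<dots> = of_nat (Suc (Suc m)) * u ^ Suc m * bracket J u v"
    unfolding Suc by (simp add: algebra_simps)
  finally show ?case .
qed simp

text \<open>Restriction to the line spanned by \<open>x\<close>, as a polynomial in the scaling parameter.\<close>

definition on_line :: "(3 \<Rightarrow> 'k::comm_ring_1) \<Rightarrow> 'k pol3 \<Rightarrow> 'k poly" where
  "on_line x = msub (\<lambda>c. [:c:]) (\<lambda>v. monom (x v) 1)"

lemma comm_ring_hom_on_line: "comm_ring_hom (on_line x)"
  unfolding on_line_def by (rule comm_ring_hom_msub[OF comm_ring_hom_const_poly])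

lemma on_line_Cst: "on_line x (Cst c) = [:c:]"
  and on_line_Var: "on_line x (Var v) = monom (x v) 1"
  by (simp_all add: on_line_def comm_ring_hom_const_poly)

lemma poly_on_line_1: "poly (on_line x p) 1 = mp_eval p x"
proof -
  have "comm_ring_hom (\<lambda>q::'a poly. poly q 1)" by unfold_locales simp_all
  from hom_msub[OF this comm_ring_hom_const_poly, of "\<lambda>v. monom (x v) 1" p]
  show ?thesis by (simp add: on_line_def mp_eval_msub poly_monom id_def)
qed

lemma on_line_homog:
  assumes "homog n p" shows "on_line x p = monom (mp_eval p x) n"
proof -
  have m: "mon_eval (\<lambda>v. monom (x v) 1) m = monom (mon_eval x m) (mon_deg m)" for m
    unfolding mon_eval_def mon_deg_def monom_power prod_monom by simp
  have "on_line x p = (\<Sum>m\<in>keys p. monom (lookup p m * mon_eval x m) n)"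
    unfolding on_line_def msub_def m using assms
    by (intro sum.cong) (auto simp: homog_def smult_monom)
  also have "\<dots> = monom (mp_eval p x) n" by (simp add: mp_eval_msub msub_def monom_sum)
  finally show ?thesis .
qed

text \<open>Two linear forms cut out the line. Substituting x_v / x_1 times \<open>Var 1\<close> for
  every variable changes a polynomial only by the ideal they generate, and this substitution factors
  through \<open>on_line\<close>.\<close>

lemma on_line_zero_imp_ideal:
  fixes x :: "3 \<Rightarrow> 'k::field"
  assumes x1: "x 1 \<noteq> 0" and b: "on_line x b = 0"
  shows "\<exists>b1 b2. b = (Cst (x 1) * Var 0 - Cst (x 0) * Var 1) * b1 + (Cst (x 1) * Var 2 - Cst (x 2) * Var 1) * b2"
proof -
  define lam where "lam = Cst (x 1) * Var 0 - Cst (x 0) * (Var 1 :: 'k pol3)"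
  define mu where "mu = Cst (x 1) * Var 2 - Cst (x 2) * (Var 1 :: 'k pol3)"
  define I where "I = {lam * b1 + mu * b2 |b1 b2. True}"
  have Iadd: "p + q \<in> I" if pq: "p \<in> I" "q \<in> I" for p q
  proof -
    obtain a b a' b' where "p = lam * a + mu * b" "q = lam * a' + mu * b'" using pq by (auto simp: I_def)
    hence "p + q = lam * (a + a') + mu * (b + b')" by (simp add: algebra_simps)
    thus ?thesis unfolding I_def by blast
  qed
  have Imult: "q * p \<in> I" if p: "p \<in> I" for p q
  proof -
    obtain a b where "p = lam * a + mu * b" using p by (auto simp: I_def)
    hence "q * p = lam * (q * a) + mu * (q * b)" by (simp add: algebra_simps)
    thus ?thesis unfolding I_def by blast
  qed
  have I0: "0 \<in> I" unfolding I_def by (rule CollectI, rule exI[of _ 0], rule exI[of _ 0]) simp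
  have Ilam: "lam \<in> I" unfolding I_def by (rule CollectI, rule exI[of _ 1], rule exI[of _ 0]) simp
  have Imu: "mu \<in> I" unfolding I_def by (rule CollectI, rule exI[of _ 0], rule exI[of _ 1]) simp
  define s where "s v = Cst (x v / x 1) * (Var 1 :: 'k pol3)" for v
  interpret S: comm_ring_hom "msub Cst s" by (rule comm_ring_hom_msub[OF comm_ring_hom_Cst])
  have diff: "p - msub Cst s p \<in> I" for p
  proof (induction p rule: mpol_induct)
    case (Cst c) thus ?case by (simp add: comm_ring_hom_Cst I0)
  next
    case (Var v)
    have cc: "Cst (inverse (x 1)) * Cst (x 1) = (1 :: 'k pol3)" using x1 by (simp flip: Cst_mult)
    have "Var v - s v \<in> {Cst (inverse (x 1)) * lam, 0, Cst (inverse (x 1)) * mu}"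
      using exhaust_3[of v] x1
      by (auto simp: s_def lam_def mu_def algebra_simps divide_inverse cc simp flip: mult.assoc Cst_mult)
    thus ?case using Imult Ilam Imu I0 by (auto simp: comm_ring_hom_Cst)
  next
    case (add p q)
    thus ?case using Iadd[OF add] by (simp add: S.hom_add algebra_simps)
  next
    case (mult p q)
    have "q * (p - msub Cst s p) + msub Cst s p * (q - msub Cst s q) \<in> I"
      by (intro Iadd Imult mult)
    thus ?case by (simp add: S.hom_mult algebra_simps)
  qed
  define F where "F r = poly (map_poly Cst r) (Cst (inverse (x 1)) * (Var 1 :: 'k pol3))" for r
  have F: "comm_ring_hom F" unfolding F_def by (rule comm_ring_hom_poly_map_poly[OF comm_ring_hom_Cst])
  interpret F: comm_ring_hom F by (rule F)
  have "F (on_line x b) = msub Cst s b"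
  proof (rule mpol_hom_eqI[OF comm_ring_hom_comp[OF F comm_ring_hom_on_line]])
    show "comm_ring_hom (msub Cst s)" by unfold_locales
    show "F (on_line x (Cst c)) = msub Cst s (Cst c)" for c
      by (simp add: on_line_Cst F_def map_poly_pCons' comm_ring_hom_Cst)
    show "F (on_line x (Var v)) = msub Cst s (Var v)" for v
      by (simp add: on_line_Var F_def monom_Suc monom_0 map_poly_pCons' comm_ring_hom_Cst s_def
          divide_inverse Cst_mult ac_simps)
  qed
  hence "msub Cst s b = 0" using b by (simp add: F.hom_zero)
  hence "b \<in> I" using diff[of b] by simp
  thus ?thesis unfolding I_def lam_def mu_def by blast
qed

text \<open>On the line the first variable is x_0 / x_1 times the second. Whether a polynomial in
  these two restricts to zero is thus a matter of one root over k[y], whose multiplicity can be read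
  off.\<close>

lemma on_line_unnest_const:
  fixes x :: "3 \<Rightarrow> 'k::field"
  assumes x1: "x 1 \<noteq> 0"
  shows "on_line x (unnest [:r:]) = pcompose (poly r [:0, x 0 / x 1:]) [:0, x 1:]"
proof -
  define H where "H = (\<lambda>q::'k poly. pcompose q [:0, x 1:])"
  have H: "comm_ring_hom H" unfolding H_def
    by unfold_locales (simp_all add: pcompose_add pcompose_mult)
  have G: "comm_ring_hom (\<lambda>r. H (poly r [:0, x 0 / x 1:]))"
    using comm_ring_hom_comp[OF H, of "\<lambda>r. poly r [:0, x 0 / x 1:]"] by unfold_locales
      (simp_all add: H_def pcompose_add pcompose_mult)
  note U = comm_ring_hom_comp[OF comm_ring_hom_on_line[of x] comm_ring_hom_unnest]
  note c = comm_ring_hom_const_poly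
  have inner: "on_line x (unnest [:[:s:]:]) = H s" for s
    by (rule poly_hom_eqI[OF comm_ring_hom_comp[OF comm_ring_hom_comp[OF U c] c] H])
      (simp_all add: unnest_const unnest_y on_line_Cst on_line_Var H_def monom_Suc monom_0 pcompose_pCons)
  have "on_line x (unnest [:r:]) = H (poly r [:0, x 0 / x 1:])"
  proof (rule poly_hom_eqI[OF comm_ring_hom_comp[OF U c] G])
    show "on_line x (unnest [:[:s:]:]) = H (poly [:s:] [:0, x 0 / x 1:])" for s by (simp add: inner)
    show "on_line x (unnest [:pCons 0 1:]) = H (poly (pCons 0 1) [:0, x 0 / x 1:])"
      using x1 by (simp add: unnest_x on_line_Var H_def monom_Suc monom_0 pcompose_pCons)
  qed
  thus ?thesis by (simp add: H_def)
qed


text \<open>If \<open>u / u'\<close> has zero derivative along the curve and \<open>u\<close> vanishes at \<open>x\<close>, then \<open>u\<close> vanishes to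
  every order \<open>m\<close> at \<open>x\<close>, that is \<open>a u \<equiv> b lam\<^sup>m\<close> modulo \<open>J\<close> with \<open>a\<close> nonzero at \<open>x\<close>, where \<open>lam\<close> is a
  uniformizer. A nonzero element of \<open>(u, J) \<inter> k[x,y]\<close> bounds this order unless \<open>J\<close> divides \<open>u\<close>.\<close>

lemma zero_derivative_imp_dvd:
  fixes J u u' :: "'k::field_char_0 pol3"
  assumes J: "homog e J" "e \<ge> 2" and prime: "prime_elem J"
    and x: "mp_eval J x = 0" "mp_eval (mp_pderiv 2 J) x \<noteq> 0" "x 1 \<noteq> 0"
    and u: "homog D u" "mp_eval u x = 0"
    and u': "homog D u'" "D \<ge> 1" "mp_eval u' x \<noteq> 0"
    and br: "J dvd bracket J u u'"
  shows "J dvd u"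
proof (rule ccontr)
  assume nd: "\<not> J dvd u"
  define lam where "lam = Cst (x 1) * Var 0 - Cst (x 0) * (Var 1 :: 'k pol3)"
  define mu where "mu = Cst (x 1) * Var 2 - Cst (x 2) * (Var 1 :: 'k pol3)"
  interpret E: comm_ring_hom "on_line x" by (rule comm_ring_hom_on_line)
  have Elam: "on_line x lam = 0" and Emu: "on_line x mu = 0"
    by (simp_all add: lam_def mu_def E.hom_minus E.hom_mult on_line_Cst on_line_Var smult_monom mult.commute)
  have EJ: "on_line x J = 0" by (simp add: on_line_homog[OF J(1)] x)
  have Edvd: "on_line x p = 0" if "J dvd p" for p
    using that EJ by (auto simp: dvd_def E.hom_mult)
  have nlam: "\<not> J dvd lam"
    by (rule not_dvd_of_pderiv_origin[OF J, of 0])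
      (simp add: lam_def mp_pderiv_diff mp_pderiv_mult mp_pderiv_Var mp_eval_simps x)
  have cancel: "J dvd p" if "J dvd lam ^ m * p" for m p
    using that nlam prime prime_elem_dvd_power[OF prime, of lam m] by (auto simp: prime_elem_dvd_mult_iff)
  obtain J1 J2 where J12: "J = lam * J1 + mu * J2"
    using on_line_zero_imp_ideal[OF x(3) EJ] unfolding lam_def mu_def by blast
  have "mp_pderiv 2 J = lam * mp_pderiv 2 J1 + Cst (x 1) * J2 + mu * mp_pderiv 2 J2"
    unfolding J12 by (simp add: lam_def mu_def mp_pderiv_add mp_pderiv_mult mp_pderiv_diff mp_pderiv_Var)
  hence "on_line x (mp_pderiv 2 J) = [:x 1:] * on_line x J2"
    by (simp add: E.hom_add E.hom_mult Elam Emu on_line_Cst)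
  moreover have "on_line x (mp_pderiv 2 J) \<noteq> 0" using x(2) poly_on_line_1[of x "mp_pderiv 2 J"] by auto
  \<comment> \<open>The coefficient of \<open>mu\<close> in \<open>J\<close> does not vanish on the
    line, so the curve relation expresses \<open>mu\<close> locally through \<open>lam\<close>. This
    makes \<open>lam\<close> a uniformizer.\<close>
  ultimately have EJ2: "on_line x J2 \<noteq> 0" by auto
  define \<Delta> where "\<Delta> h = bracket J h u'" for h
  have \<Delta>lam: "on_line x (\<Delta> lam) \<noteq> 0"
  proof -
    have Eu: "x 0 * mp_eval (mp_pderiv 0 p) x + x 1 * mp_eval (mp_pderiv 1 p) x + x 2 * mp_eval (mp_pderiv 2 p) x
       = of_nat n * mp_eval p x" if "homog n p" for n and p :: "'k pol3"
      using arg_cong[OF Euler_homog[OF that], of "\<lambda>p. mp_eval p x"] by (simp add: mp_eval_simps sum_3)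
    define a0 a1 a2 where "a0 = mp_eval (mp_pderiv 0 J) x" and "a1 = mp_eval (mp_pderiv 1 J) x"
      and "a2 = mp_eval (mp_pderiv 2 J) x"
    define b0 b1 b2 where "b0 = mp_eval (mp_pderiv 0 u') x" and "b1 = mp_eval (mp_pderiv 1 u') x"
      and "b2 = mp_eval (mp_pderiv 2 u') x"
    have 1: "x 0 * a0 + x 1 * a1 = - (x 2 * a2)"
      using Eu[OF J(1)] x(1) by (simp add: a0_def a1_def a2_def eq_neg_iff_add_eq_0)
    have 2: "x 0 * b0 + x 1 * b1 = of_nat D * mp_eval u' x - x 2 * b2"
      using Eu[OF u'(1)] by (simp add: b0_def b1_def b2_def eq_diff_eq)
    \<comment> \<open>The Euler relations of \<open>J\<close> and \<open>u'\<close> reduce this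
      value to D u' times the derivative of \<open>J\<close> in the third variable, both nonzero at
      \<open>x\<close>.\<close>
    have "mp_eval (\<Delta> lam) x = - b2 * (x 0 * a0 + x 1 * a1) + a2 * (x 0 * b0 + x 1 * b1)"
      by (simp add: \<Delta>_def bracket_def det3_def lam_def mp_pderiv_diff mp_pderiv_mult mp_pderiv_Var
          mp_eval_simps a0_def a1_def a2_def b0_def b1_def b2_def algebra_simps)
    also have "\<dots> = a2 * (of_nat D * mp_eval u' x)" unfolding 1 2 by (simp add: algebra_simps)
    finally have "mp_eval (\<Delta> lam) x \<noteq> 0" using x(2) u'(2,3) by (simp add: a2_def)
    thus ?thesis using poly_on_line_1[of x "\<Delta> lam"] by auto
  qed
  have ord: "\<exists>a b. on_line x a \<noteq> 0 \<and> J dvd a * u - b * lam ^ m" for m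
  proof (induction m)
    case 0
    show ?case by (intro exI[of _ 1] exI[of _ u]) (simp add: E.hom_one)
  next
    case (Suc m)
    then obtain a b where ab: "on_line x a \<noteq> 0" "J dvd a * u - b * lam ^ m" by blast
    obtain c where "a * u - b * lam ^ m = J * c" using ab(2) unfolding dvd_def by blast
    hence c: "a * u = b * lam ^ m + J * c" by (simp add: algebra_simps)
    \<comment> \<open>For m > 0, apply \<Delta> to a u = b lam^m + J c, multiply by a and cancel
      lam^(m-1). On the line only m a b \<Delta>(lam) = 0 remains, and characteristic zero gives the
      claim.\<close>
    have "on_line x b = 0"
    proof (cases m)
      case 0
      have "on_line x u = 0" by (simp add: on_line_homog[OF u(1)] u(2))
      hence "on_line x (b * lam ^ m + J * c) = 0" by (simp add: E.hom_mult flip: c)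
      thus ?thesis by (simp add: 0 E.hom_add E.hom_mult EJ)
    next
      case (Suc k)
      obtain s where s: "\<Delta> u = J * s" using br unfolding \<Delta>_def dvd_def by blast
      have "\<Delta> (a * u) = \<Delta> a * u + a * (J * s)" by (simp add: \<Delta>_def bracket_mult s[unfolded \<Delta>_def])
      moreover have "\<Delta> (b * lam ^ m + J * c) = \<Delta> b * lam ^ m + b * (of_nat m * lam ^ k * \<Delta> lam) + J * \<Delta> c"
        unfolding \<Delta>_def Suc bracket_add bracket_mult bracket_power bracket_J by simp
      ultimately have "\<Delta> a * u + a * (J * s) = \<Delta> b * lam ^ m + b * (of_nat m * lam ^ k * \<Delta> lam) + J * \<Delta> c"
        using c by simp
      hence "a * (\<Delta> a * u + a * (J * s)) = a * (\<Delta> b * lam ^ m + b * (of_nat m * lam ^ k * \<Delta> lam) + J * \<Delta> c)"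
        by simp
      hence "\<Delta> a * (a * u) + J * (a * a * s) = a * \<Delta> b * lam ^ m + lam ^ k * (of_nat m * a * b * \<Delta> lam) + J * (a * \<Delta> c)"
        by (simp add: algebra_simps)
      hence "lam ^ k * (of_nat m * a * b * \<Delta> lam - lam * (\<Delta> a * b - a * \<Delta> b)) = J * (\<Delta> a * c + a * a * s - a * \<Delta> c)"
        unfolding c Suc by (simp add: algebra_simps)
      hence "J dvd lam ^ k * (of_nat m * a * b * \<Delta> lam - lam * (\<Delta> a * b - a * \<Delta> b))" by simp
      hence "J dvd of_nat m * a * b * \<Delta> lam - lam * (\<Delta> a * b - a * \<Delta> b)" by (rule cancel)
      from Edvd[OF this] have "on_line x (of_nat m) * on_line x a * on_line x b * on_line x (\<Delta> lam) = 0"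
        by (simp add: E.hom_minus E.hom_mult Elam)
      moreover have "on_line x (of_nat m) \<noteq> 0"
        using poly_on_line_1[of x "of_nat m"] Suc by (auto simp del: of_nat_Suc)
      ultimately show ?thesis using ab(1) \<Delta>lam by simp
    qed
    then obtain b1 b2 where b: "b = lam * b1 + mu * b2"
      using on_line_zero_imp_ideal[of x b, OF x(3)] unfolding lam_def mu_def by blast
    \<comment> \<open>Multiplying by \<open>J2\<close> trades \<open>mu\<close> for
      \<open>lam\<close>, since J2 mu = J - J1 lam; one more factor \<open>lam\<close> splits
      off.\<close>
    have "(J2 * a) * u - (J2 * b1 - J1 * b2) * lam ^ Suc m = J * (J2 * c + b2 * lam ^ m)"
    proof -
      have "(J2 * a) * u = J2 * (b * lam ^ m + J * c)" unfolding c[symmetric] by (simp add: ac_simps)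
      moreover have "J2 * b = lam * (J2 * b1 - J1 * b2) + b2 * J" by (simp add: b J12 algebra_simps)
      hence "J2 * b * lam ^ m = (lam * (J2 * b1 - J1 * b2) + b2 * J) * lam ^ m" by simp
      ultimately show ?thesis by (simp add: algebra_simps)
    qed
    hence "J dvd (J2 * a) * u - (J2 * b1 - J1 * b2) * lam ^ Suc m" by simp
    moreover have "on_line x (J2 * a) \<noteq> 0" using EJ2 ab(1) by (simp add: E.hom_mult)
    ultimately show ?case by blast
  qed
  interpret n: comm_ring_hom "nest :: 'k pol3 \<Rightarrow> _" by (rule comm_ring_hom_nest)
  interpret un: comm_ring_hom "unnest :: _ \<Rightarrow> 'k pol3" by (rule comm_ring_hom_unnest)
  have deg: "degree (nest J) \<ge> 1" using x(2) by (intro degree_nest_ge_1) auto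
  have nd': "\<not> nest J dvd nest u" using nd by (simp add: nest_dvd_iff)
  obtain \<alpha> \<beta> R where R: "R \<noteq> 0" "\<alpha> * nest J + \<beta> * nest u = [:R:]"
    using eliminate_prime[OF prime_elem_nest_iff[THEN iffD2, OF prime] deg nd'] by blast
  define \<rho> where "\<rho> = [:0, x 0 / x 1:]"
  \<comment> \<open>Up to a constant, \<open>R\<close> is lam^r R1 with R1 nonzero on the line.
    Applying \<open>ord\<close> at \<open>Suc r\<close> and cancelling lam^r would force R1 to
    vanish on the line.\<close>
  define r where "r = Polynomial.order \<rho> R"
  obtain R1 where R1: "R = [:- \<rho>, 1:] ^ r * R1" "\<not> [:- \<rho>, 1:] dvd R1"
    using order_decomp[OF R(1)] unfolding r_def by blast
  have "poly R1 \<rho> \<noteq> 0" using R1(2) by (simp only: poly_eq_0_iff_dvd) simp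
  hence ER1: "on_line x (unnest [:R1:]) \<noteq> 0"
    unfolding on_line_unnest_const[of x, OF x(3)] \<rho>_def[symmetric] using x(3) by (simp add: pcompose_eq_0_iff)
  have "nest lam = [:[:[:x 1:]:] * [:- \<rho>, 1:]:]"
    using x(3) by (simp add: lam_def n.hom_minus n.hom_mult nest_Cst nest_Var0 nest_Var1 \<rho>_def)
  hence lam: "lam = unnest [:[:[:x 1:]:] * [:- \<rho>, 1:]:]" by (metis unnest_nest)
  define C :: "'k pol3" where "C = Cst (x 1 ^ r)"
  have "[:[:[:x 1:]:] * [:- \<rho>, 1:]:] ^ r * [:R1:] = [:[:[:x 1 ^ r:]:]:] * [:R:]"
    unfolding R1(1) poly_const_pow power_mult_distrib by (simp add: mult.commute)
  hence lR: "lam ^ r * unnest [:R1:] = C * unnest [:R:]"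
    unfolding lam C_def by (metis un.hom_mult un.hom_power unnest_const)
  have uR: "unnest \<alpha> * J + unnest \<beta> * u = unnest [:R:]"
    unfolding R(2)[symmetric] by (simp add: un.hom_add un.hom_mult unnest_nest)
  obtain a b where ab: "on_line x a \<noteq> 0" "J dvd a * u - b * lam ^ Suc r" using ord by blast
  obtain c where "a * u - b * lam ^ Suc r = J * c" using ab(2) unfolding dvd_def by blast
  hence c: "a * u = b * lam ^ Suc r + J * c" by (simp add: algebra_simps)
  have "lam ^ r * (a * unnest [:R1:] - C * unnest \<beta> * b * lam) = J * (C * (a * unnest \<alpha> + unnest \<beta> * c))"
  proof -
    have "lam ^ r * (a * unnest [:R1:]) = C * (a * (unnest \<alpha> * J + unnest \<beta> * u))"
      unfolding uR using lR by (simp add: ac_simps)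
    also have "\<dots> = C * (a * unnest \<alpha> * J + unnest \<beta> * (a * u))" by (simp add: algebra_simps)
    also have "\<dots> = C * (a * unnest \<alpha> * J + unnest \<beta> * (b * lam ^ Suc r + J * c))" by (simp only: c)
    finally show ?thesis by (simp add: algebra_simps)
  qed
  hence "J dvd lam ^ r * (a * unnest [:R1:] - C * unnest \<beta> * b * lam)" by simp
  hence "J dvd a * unnest [:R1:] - C * unnest \<beta> * b * lam" by (rule cancel)
  from Edvd[OF this] have "on_line x a * on_line x (unnest [:R1:]) = 0"
    by (simp add: E.hom_minus E.hom_mult Elam)
  thus False using ab(1) ER1 by simp
qed

text \<open>\<open>J\<close> divides neither its nonzero derivative, which has smaller degree, nor a
  variable. Being prime, it does not divide their product, which is therefore nonzero somewhere on
  the curve.\<close>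

lemma ex_good_point:
  fixes J :: "'k::field_char_0 pol3"
  assumes alg_closed: "\<And>p :: 'k poly. degree p \<ge> 1 \<Longrightarrow> \<exists>x. poly p x = 0"
    and J: "homog e J" "e \<ge> 2" "smooth_form J"
  shows "\<exists>x. (\<exists>i. x i \<noteq> 0) \<and> mp_eval J x = 0 \<and> mp_eval (mp_pderiv 2 J) x \<noteq> 0 \<and> x 1 \<noteq> 0"
proof -
  have prime: "prime_elem J" using J(2) by (intro smooth_form_prime[OF alg_closed J(1) _ J(3)]) simp_all
  have nz: "mp_pderiv 2 J \<noteq> 0" by (rule smooth_form_pderiv2_nonzero[OF J])
  have "\<not> J dvd mp_pderiv 2 J"
  proof
    assume "J dvd mp_pderiv 2 J"
    then obtain s where s: "mp_pderiv 2 J = J * s" unfolding dvd_def by blast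
    have h: "homog (e - 1) (J * s)" using homog_mp_pderiv[OF J(1), of 2] by (simp add: s)
    have nz': "J * s \<noteq> 0" using nz s by simp
    obtain b where b: "homog b s"
      using homog_factor_left[of "e - 1" s J] h nz' by (auto simp: mult.commute)
    have "e - 1 = e + b" by (rule homog_unique[OF h homog_mult[OF J(1) b] nz'])
    thus False using J(2) by simp
  qed
  moreover have "\<not> J dvd Var 1"
    by (rule not_dvd_of_pderiv_origin[OF J(1,2), of 1]) (simp add: mp_pderiv_Var)
  ultimately have nd: "\<not> J dvd mp_pderiv 2 J * Var 1" using prime by (simp add: prime_elem_dvd_mult_iff)
  show ?thesis
  proof (rule ccontr)
    assume no: "\<not> ?thesis"
    have "J dvd mp_pderiv 2 J * Var 1"
    proof (rule smooth_form_dvd[OF alg_closed J])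
      fix x :: "3 \<Rightarrow> 'k" assume "\<exists>i. x i \<noteq> 0" "mp_eval J x = 0"
      hence "mp_eval (mp_pderiv 2 J) x = 0 \<or> x 1 = 0" using no by blast
      thus "mp_eval (mp_pderiv 2 J * Var 1) x = 0" by (auto simp: mp_eval_simps)
    qed
    thus False using nd by blast
  qed
qed

text \<open>A morphism cannot be constant on the curve, because each of its components vanishes somewhere on it.\<close>

lemma ex_bracket_not_dvd:
  fixes J :: "'k::field_char_0 pol3" and g :: "'k endo"
  assumes alg_closed: "\<And>p :: 'k poly. degree p \<ge> 1 \<Longrightarrow> \<exists>x. poly p x = 0"
    and J: "homog e J" "e \<ge> 2" "smooth_form J"
    and g: "\<And>i. homog D (g i)" "D \<ge> 1"
    and nz: "\<And>x. \<exists>i. x i \<noteq> 0 \<Longrightarrow> \<exists>i. mp_eval (g i) x \<noteq> 0"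
  shows "\<exists>a b. \<not> J dvd bracket J (g a) (g b)"
proof (rule ccontr)
  assume "\<nexists>a b. \<not> J dvd bracket J (g a) (g b)"
  hence br: "J dvd bracket J (g a) (g b)" for a b by blast
  have prime: "prime_elem J" using J(2) by (intro smooth_form_prime[OF alg_closed J(1) _ J(3)]) simp_all
  obtain x where x: "\<exists>i. x i \<noteq> 0" "mp_eval J x = 0" "mp_eval (mp_pderiv 2 J) x \<noteq> 0" "x 1 \<noteq> 0"
    using ex_good_point[OF alg_closed J] by blast
  obtain b where b: "mp_eval (g b) x \<noteq> 0" using nz[OF x(1)] by blast
  \<comment> \<open>The combination of \<open>g a\<close> and \<open>g b\<close> that vanishes at
    \<open>x\<close>. Once \<open>J\<close> divides it, a zero of \<open>g b\<close> on the curve is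
    a zero of every component.\<close>
  define u where "u a = Cst (mp_eval (g b) x) * g a - Cst (mp_eval (g a) x) * g b" for a
  have u: "J dvd u a" for a
  proof (rule zero_derivative_imp_dvd[OF J(1,2) prime x(2-4) _ _ g(1,2) b])
    show "homog D (u a)" unfolding u_def by (intro homog_diff homog_Cst_mult g)
    show "mp_eval (u a) x = 0" by (simp add: u_def mp_eval_simps)
    have "bracket J (u a) (g b) = Cst (mp_eval (g b) x) * bracket J (g a) (g b)"
      by (simp add: u_def bracket_diff bracket_mult bracket_Cst bracket_self)
    thus "J dvd bracket J (u a) (g b)" using br by simp
  qed
  have "e \<ge> 1" using J(2) by simp
  from common_zero_prime[OF alg_closed J(1) this prime g(1,2)]
  obtain y where y: "\<exists>i. y i \<noteq> 0" "mp_eval J y = 0" "mp_eval (g b) y = 0" by blast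
  have "mp_eval (g a) y = 0" for a
  proof -
    obtain s where "u a = J * s" using u unfolding dvd_def by blast
    hence "mp_eval (u a) y = 0" using y(2) by (simp add: mp_eval_mult)
    thus ?thesis using y(3) b by (simp add: u_def mp_eval_simps)
  qed
  thus False using nz[OF y(1)] by blast
qed

section \<open>Iterates\<close>

fun iter_endo :: "'k::comm_ring_1 endo \<Rightarrow> nat \<Rightarrow> 'k endo" where
  "iter_endo f 0 = Var"
| "iter_endo f (Suc k) = (\<lambda>i. msub Cst (iter_endo f k) (f i))"

lemma mp_eval_iter_endo: "(\<lambda>i. mp_eval (iter_endo f k i) x) = (apply_endo f ^^ k) x"
  by (induction k) (simp_all add: mp_eval_msub_Cst apply_endo_def)

lemma homog_iter_endo: "(\<And>i. homog d (f i)) \<Longrightarrow> homog (d ^ k) (iter_endo f k i)"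
proof (induction k arbitrary: i)
  case 0 show ?case using homog_Var by simp
next
  case (Suc k)
  thus ?case using homog_msub[of d "f i" "d ^ k" "iter_endo f k"] by simp
qed

lemma iter_endo_nonzero:
  assumes f: "f \<in> End2 d" and x: "\<exists>i. x i \<noteq> 0"
  shows "\<exists>i. mp_eval (iter_endo f k i) x \<noteq> 0"
proof (induction k)
  case (Suc k)
  let ?y = "\<lambda>v. mp_eval (iter_endo f k v) x"
  have "\<exists>i. mp_eval (f i) ?y \<noteq> 0" using f Suc unfolding End2_def by blast
  thus ?case by (simp add: mp_eval_msub_Cst)
qed (use x in simp)

lemma det3_mult: "det3 (\<lambda>i j. \<Sum>l\<in>UNIV. A i l * B l j) = det3 A * det3 B"
  unfolding det3_def sum_3 by (simp add: algebra_simps)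

lemma hom_det3: "comm_ring_hom F \<Longrightarrow> F (det3 M) = det3 (\<lambda>i j. F (M i j))"
proof -
  assume "comm_ring_hom F"
  then interpret comm_ring_hom F .
  show ?thesis by (simp add: det3_def hom_add hom_mult hom_minus)
qed

text \<open>By the chain rule, passing from f^k to f^(k+1) multiplies the Jacobian by that of f
  composed with f^k; the factor \<open>jac f\<close> of the innermost map survives.\<close>

lemma jac_dvd_jac_iter_endo: "k \<ge> 1 \<Longrightarrow> jac f dvd jac (iter_endo f k)"
proof (induction k rule: nat_induct_at_least)
  case base
  show ?case by (simp add: jac_def)
next
  case (Suc k)
  have "jac (iter_endo f (Suc k)) = det3 (\<lambda>i j. \<Sum>l\<in>UNIV. msub Cst (iter_endo f k) (mp_pderiv l (f i)) * mp_pderiv j (iter_endo f k l))"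
    by (simp add: jac_def mp_pderiv_msub)
  also have "\<dots> = msub Cst (iter_endo f k) (jac f) * jac (iter_endo f k)"
    unfolding det3_mult jac_def by (simp add: hom_det3[OF comm_ring_hom_msub[OF comm_ring_hom_Cst]])
  finally show ?case using Suc by simp
qed

section \<open>Adjugate matrices\<close>

text \<open>Indices in type \<open>3\<close> are cyclic, so \<open>i + 1, i + 2\<close> are the other two indices.\<close>

definition adj3 :: "(3 \<Rightarrow> 3 \<Rightarrow> 'a::comm_ring_1) \<Rightarrow> 3 \<Rightarrow> 3 \<Rightarrow> 'a" where
  "adj3 M i l = M (l + 1) (i + 1) * M (l + 2) (i + 2) - M (l + 1) (i + 2) * M (l + 2) (i + 1)"

lemma add_3: "(0::3) + 1 = 1" "(1::3) + 1 = 2" "(2::3) + 1 = 0" "(0::3) + 2 = 2" "(1::3) + 2 = 0" "(2::3) + 2 = 1"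
  by simp_all

lemma mult_adj3: "(\<Sum>j\<in>UNIV. M l j * adj3 M j m) = (if l = m then det3 M else 0)"
  using exhaust_3[of l] exhaust_3[of m]
  by (elim disjE) (simp_all only: sum_3 adj3_def add_3, simp_all add: det3_def algebra_simps)

text \<open>Each difference is a combination of the null relations with entries of \<open>M\<close>
  as coefficients, so the rows of the adjugate are parallel to \<open>w\<close> whatever the rank of
  \<open>M\<close>.\<close>

lemma adj3_parallel:
  assumes "\<And>j. (\<Sum>l\<in>UNIV. w l * M l j) = 0"
  shows "adj3 M i l * w k = adj3 M i k * (w l :: 'a::comm_ring_1)"
proof -
  have z: "w 0 * M 0 j + w 1 * M 1 j + w 2 * M 2 j = 0" for j using assms[of j] by (simp add: sum_3)
  define p q where "p = i + 1" and "q = i + 2"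
  have c01: "adj3 M i 0 * w 1 = adj3 M i 1 * w 0"
  proof -
    have "adj3 M i 0 * w 1 - adj3 M i 1 * w 0
      = M 2 q * (w 0 * M 0 p + w 1 * M 1 p + w 2 * M 2 p) - M 2 p * (w 0 * M 0 q + w 1 * M 1 q + w 2 * M 2 q)"
      unfolding adj3_def add_3 p_def[symmetric] q_def[symmetric] by (simp add: algebra_simps)
    thus ?thesis by (simp add: z)
  qed
  have c12: "adj3 M i 1 * w 2 = adj3 M i 2 * w 1"
  proof -
    have "adj3 M i 1 * w 2 - adj3 M i 2 * w 1
      = M 0 q * (w 0 * M 0 p + w 1 * M 1 p + w 2 * M 2 p) - M 0 p * (w 0 * M 0 q + w 1 * M 1 q + w 2 * M 2 q)"
      unfolding adj3_def add_3 p_def[symmetric] q_def[symmetric] by (simp add: algebra_simps)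
    thus ?thesis by (simp add: z)
  qed
  have c20: "adj3 M i 2 * w 0 = adj3 M i 0 * w 2"
  proof -
    have "adj3 M i 2 * w 0 - adj3 M i 0 * w 2
      = M 1 q * (w 0 * M 0 p + w 1 * M 1 p + w 2 * M 2 p) - M 1 p * (w 0 * M 0 q + w 1 * M 1 q + w 2 * M 2 q)"
      unfolding adj3_def add_3 p_def[symmetric] q_def[symmetric] by (simp add: algebra_simps)
    thus ?thesis by (simp add: z)
  qed
  show ?thesis using exhaust_3[of k] exhaust_3[of l] c01 c12 c20 by auto
qed

text \<open>Column \<open>m\<close> of the adjugate is the cross product of the gradients of the
  other two components, so pairing it with the gradient of \<open>J\<close> gives a determinant of
  three gradients.\<close>

lemma gradient_adj3_bracket:
  "(\<Sum>j\<in>UNIV. mp_pderiv j J * adj3 (\<lambda>i j. mp_pderiv j (g i)) j m) = bracket J (g (m + 1)) (g (m + 2))"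
  unfolding sum_3 adj3_def add_3 bracket_def det3_def by (simp add: algebra_simps)

text \<open>Let \<open>g = f\<^sup>k\<close> and \<open>J \<circ> g = J H\<close>. On the curve \<open>\<nabla>J(g) Dg = H \<nabla>J\<close> and \<open>det Dg = 0\<close>, hence \<open>H (\<nabla>J adj Dg) = 0\<close>.
  If \<open>H = 0\<close> on the curve, then the rows of \<open>adj Dg\<close> are multiples of \<open>\<nabla>J(g)\<close> by sections of negative
  degree. So \<open>\<nabla>J adj Dg = 0\<close> in either case, i.e. \<open>g\<close> has zero derivative along the curve.\<close>

lemma Ed_not_pcp:
  fixes f :: "'k::field_char_0 endo"
  assumes alg_closed: "\<And>p :: 'k poly. degree p \<ge> 1 \<Longrightarrow> \<exists>x. poly p x = 0"
    and d: "d \<ge> 2" and f: "f \<in> Ed d"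
  shows "\<not> pcp f"
proof
  assume "pcp f"
  then obtain k where k: "k \<ge> 1" "\<And>x. x \<in> crit f \<Longrightarrow> (apply_endo f ^^ k) x \<in> crit f"
    unfolding pcp_def by blast
  have fE: "f \<in> End2 d" and sm: "smooth_form (jac f)"
    using f Ed_eq_smooth[OF alg_closed d] by auto
  define J where "J = jac f"
  define e where "e = 3 * (d - 1)"
  have hf: "homog d (f i)" for i using fE by (simp add: End2_def)
  have J: "homog e J" "e \<ge> 2" "smooth_form J"
    using d sm homog_jac[of d f, OF hf] by (simp_all add: J_def e_def)
  have e3: "e \<ge> 3" using d by (simp add: e_def)
  have prime: "prime_elem J" using J(2) by (intro smooth_form_prime[OF alg_closed J(1) _ J(3)]) simp_all
  define g where "g = iter_endo f k"
  define D where "D = d ^ k"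
  have D: "D \<ge> 1" using d by (simp add: D_def)
  have hg: "homog D (g i)" for i unfolding g_def D_def by (rule homog_iter_endo[OF hf])
  have gnz: "\<exists>i. mp_eval (g i) x \<noteq> 0" if "\<exists>i. x i \<noteq> 0" for x
    unfolding g_def by (rule iter_endo_nonzero[OF fE that])
  have gC: "mp_eval J (\<lambda>i. mp_eval (g i) x) = 0" if "\<exists>i. x i \<noteq> 0" "mp_eval J x = 0" for x
    using k(2)[of x] that by (simp add: g_def mp_eval_iter_endo crit_def J_def)
  have "J dvd msub Cst g J"
  proof (rule smooth_form_dvd[OF alg_closed J])
    fix x :: "3 \<Rightarrow> 'k" assume "\<exists>i. x i \<noteq> 0" "mp_eval J x = 0"
    thus "mp_eval (msub Cst g J) x = 0" unfolding mp_eval_msub_Cst by (rule gC)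
  qed
  \<comment> \<open>Modulo \<open>J\<close>, the cofactor \<open>H\<close> is the normal derivative
    of \<open>g\<close> along the curve.\<close>
  then obtain H where H: "msub Cst g J = J * H" unfolding dvd_def by blast
  define M where "M i j = mp_pderiv j (g i)" for i j
  define w where "w i = msub Cst g (mp_pderiv i J)" for i
  define N where "N = adj3 M"
  have wM: "(\<Sum>i\<in>UNIV. w i * M i j) = mp_pderiv j J * H + J * mp_pderiv j H" for j
    using mp_pderiv_msub[of j g J] by (simp add: H mp_pderiv_mult w_def M_def)
  have "J dvd det3 M"
    using jac_dvd_jac_iter_endo[OF k(1), of f] by (simp add: J_def M_def[abs_def] g_def jac_def)
  then obtain T where T: "det3 M = J * T" unfolding dvd_def by blast
  define B where "B m = (\<Sum>j\<in>UNIV. mp_pderiv j J * N j m)" for m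
  \<comment> \<open>Multiply \<open>wM\<close> by the adjugate: the left side becomes w_m det M, a
    multiple of \<open>J\<close>, and the right side is H B_m modulo \<open>J\<close>.\<close>
  have "J dvd H * B m" for m
  proof -
    have "(\<Sum>j\<in>UNIV. (\<Sum>i\<in>UNIV. w i * M i j) * N j m) = (\<Sum>i\<in>UNIV. w i * (\<Sum>j\<in>UNIV. M i j * N j m))"
      by (simp add: sum_distrib_left sum_distrib_right mult.assoc) (rule sum.swap)
    also have "\<dots> = (\<Sum>i\<in>UNIV. if i = m then w i * det3 M else 0)"
      by (intro sum.cong) (auto simp: N_def mult_adj3)
    also have "\<dots> = J * (w m * T)" by (simp add: T ac_simps)
    finally have "J * (w m * T) = (\<Sum>j\<in>UNIV. (mp_pderiv j J * H + J * mp_pderiv j H) * N j m)"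
      by (simp add: wM)
    also have "\<dots> = H * B m + J * (\<Sum>j\<in>UNIV. mp_pderiv j H * N j m)"
      by (simp add: B_def algebra_simps sum.distrib sum_distrib_left)
    finally have "H * B m = J * (w m * T - (\<Sum>j\<in>UNIV. mp_pderiv j H * N j m))"
      by (simp add: algebra_simps)
    thus ?thesis by simp
  qed
  hence HB: "J dvd H \<or> J dvd B m" for m using prime by (simp add: prime_elem_dvd_mult_iff)
  have "J dvd B m" for m
  proof (cases "J dvd H")
    case False
    thus ?thesis using HB by blast
  next
    case True
    then obtain H' where H': "H = J * H'" unfolding dvd_def by blast
    have "J dvd N i l" for i l
    proof (rule negative_section_zero[OF alg_closed J, of "(e - 1) * D" w "2 * (D - 1)" "N i"])
      show "homog ((e - 1) * D) (w k)" for k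
        unfolding w_def by (intro homog_msub homog_mp_pderiv J hg)
      have "homog ((D - 1) + (D - 1)) (N i l)" for l
        unfolding N_def adj3_def M_def by (intro homog_diff homog_mult homog_mp_pderiv hg)
      thus "homog (2 * (D - 1)) (N i l)" for l by (simp add: mult_2)
      have "2 * (D - 1) < 2 * D" using D by simp
      also have "2 * D \<le> (e - 1) * D" using e3 by (intro mult_right_mono) auto
      finally show "2 * (D - 1) < (e - 1) * D" .
      fix x :: "3 \<Rightarrow> 'k" assume x: "\<exists>i. x i \<noteq> 0" "mp_eval J x = 0"
      \<comment> \<open>\<open>w\<close> at \<open>x\<close> is the gradient of \<open>J\<close> at
        g(x), which again lies on the smooth curve.\<close>
      show "\<exists>k. mp_eval (w k) x \<noteq> 0"
        unfolding w_def mp_eval_msub_Cst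
        using J(3)[unfolded smooth_form_def, rule_format, OF gnz[OF x(1)] gC[OF x]] .
      have "(\<Sum>l\<in>UNIV. mp_eval (w l) x * mp_eval (M l j) x) = 0" for j
        using arg_cong[OF wM[of j], of "\<lambda>p. mp_eval p x"] x(2) by (simp add: H' mp_eval_simps)
      from adj3_parallel[of "\<lambda>l. mp_eval (w l) x" "\<lambda>l j. mp_eval (M l j) x", OF this]
      show "mp_eval (N i l) x * mp_eval (w k) x = mp_eval (N i k) x * mp_eval (w l) x" for k l
        by (simp add: N_def adj3_def mp_eval_simps)
    qed
    thus ?thesis unfolding B_def by (intro dvd_sum dvd_mult)
  qed
  moreover have "B m = bracket J (g (m + 1)) (g (m + 2))" for m
    unfolding gradient_adj3_bracket[of J g m, symmetric] B_def N_def M_def[abs_def] ..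
  ultimately have br: "J dvd bracket J (g (m + 1)) (g (m + 2))" for m by metis
  have all: "J dvd bracket J (g a) (g b)" for a b
  proof -
    have c: "J dvd bracket J (g 1) (g 2)" "J dvd bracket J (g 2) (g 0)" "J dvd bracket J (g 0) (g 1)"
      using br[of 0] br[of 1] br[of 2] by (simp_all only: add_3)
    hence c': "J dvd bracket J (g 2) (g 1)" "J dvd bracket J (g 0) (g 2)" "J dvd bracket J (g 1) (g 0)"
      by (simp_all add: bracket_swap[of J "g 2" "g 1"] bracket_swap[of J "g 0" "g 2"] bracket_swap[of J "g 1" "g 0"])
    show ?thesis using exhaust_3[of a] exhaust_3[of b] c c' by (auto simp: bracket_self)
  qed
  have "\<exists>a b. \<not> J dvd bracket J (g a) (g b)"
    by (rule ex_bracket_not_dvd[OF alg_closed J hg D gnz])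
  then obtain a b where "\<not> J dvd bracket J (g a) (g b)" by (elim exE)
  with all show False by simp
qed


theorem theorem15:
  assumes alg_closed: "\<And>p :: 'k::field_char_0 poly. degree p \<ge> 1 \<Longrightarrow> \<exists>x. poly p x = 0"
  shows "(\<forall>d\<ge>1. (Ed d :: 'k endo set) \<noteq> {} \<and> zopen_End d (Ed d :: 'k endo set))
       \<and> (\<forall>d\<ge>2. \<forall>f\<in>(Ed d :: 'k endo set). \<not> pcp f)
       \<and> (\<forall>d\<ge>2. \<not> zdense_End d {f \<in> (End2 d :: 'k endo set). pcp f})"
proof (intro conjI allI impI ballI)
  fix d :: nat assume "d \<ge> 1"
  then consider "d = 1" | "d \<ge> 2" by linarith
  thus "(Ed d :: 'k endo set) \<noteq> {}"
    by cases (use Ed_1_open_nonempty[where 'k = 'k] Ed_nonempty[OF alg_closed, of d] in blast)+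
next
  fix d :: nat assume "d \<ge> 1"
  then consider "d = 1" | "d \<ge> 2" by linarith
  thus "zopen_End d (Ed d :: 'k endo set)"
    by cases (use Ed_1_open_nonempty[where 'k = 'k] zopen_Ed[OF alg_closed, of d] in blast)+
next
  fix d :: nat and f :: "'k endo" assume d: "d \<ge> 2" and f: "f \<in> Ed d"
  show "\<not> pcp f" by (rule Ed_not_pcp[OF alg_closed d f])
next
  fix d :: nat assume d: "d \<ge> 2"
  have "zclosed_End d (End2 d - Ed d :: 'k endo set)"
    using zopen_Ed[OF alg_closed d] by (simp add: zopen_End_def)
  moreover have "{f \<in> (End2 d :: 'k endo set). pcp f} \<subseteq> End2 d - Ed d"
    using Ed_not_pcp[OF alg_closed d] by blast
  moreover have "End2 d - Ed d \<noteq> (End2 d :: 'k endo set)"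
    using Ed_nonempty[OF alg_closed d] by (auto simp: Ed_def)
  ultimately show "\<not> zdense_End d {f \<in> (End2 d :: 'k endo set). pcp f}"
    unfolding zdense_End_def by blast
qed

end
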